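(* For all $(p,q)\in\Delta(K)\times\Delta(L)$, the limit $v(p,q)=\lim_{T\to\infty} v_T(p,q)$ exists, where $v_T(p,q)$ is the value of the $T$-stage Markov chain game with incomplete information on both sides and initial probabilities $(p,q)$.
   Context: For a finite set $S$, $\Delta(S)$ is the set of probabilities on $S$ (seen as row vectors). $I,J,K,L$ are disjoint finite non-empty sets, $g:K\times L\times I\times J\to[-1,1]$ is a payoff function, and $M$, $N$ are arbitrary stochastic matrices on $K$ and $L$ respectively. The Markov chain game with initial probabilities $(p,q)\in\Delta(K)\times\Delta(L)$: $(k_t)_{t\ge1}$ is a Markov chain with initial law $p$ and transition matrix $M$, and $(l_t)_{t\ge1}$ is an independent Markov chain with initial law $q$ and transition matrix $N$. At the beginning of every stage $t\ge1$, Player 1 observes $k_t$ and Player 2 observes $l_t$; then both players simultaneously choose actions $i_t\in I$ and $j_t\in J$; the stage payoff of Player 1 is $g(k_t,l_t,i_t,j_t)$ (zero-sum, not observed); then $(i_t,j_t)$ is publicly observed and the play goes to stage $t+1$. With $H_t=(I\times J)^t$ and $H_0=\{\emptyset\}$, a strategy $\sigma\in\Sigma$ of Player 1 is a sequence $(\sigma_t)_{t\ge1}$ of maps $\sigma_t:H_{t-1}\times K^t\to\Delta(I)$, and a strategy $\tau\in\mathcal T$ of Player 2 is a sequence of maps $\tau_t:H_{t-1}\times L^t\to\Delta(J)$. Let $\mathbb P_{p,q,\sigma,\tau}$ be the induced probability on $(K\times L\times I\times J)^\infty$, and $\gamma_T^{p,q}(\sigma,\tau)=\mathbb E_{p,q,\sigma,\tau}\big[\frac1T\sum_{t=1}^T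 g(k_t,l_t,i_t,j_t)\big]$. The value of the $T$-stage game is $v_T(p,q)=\max_{\sigma\in\Sigma}\min_{\tau\in\mathcal T}\gamma_T^{p,q}(\sigma,\tau)=\min_{\tau\in\mathcal T}\max_{\sigma\in\Sigma}\gamma_T^{p,q}(\sigma,\tau)$. *)

theory Defs
  imports "HOL-Probability.Probability"
begin

text \<open>
  The finite non-empty sets \<open>K\<close>, \<open>L\<close>, \<open>I\<close>, \<open>J\<close> are finite types.  A probability on a finite set
  is a \<open>pmf\<close>, and a stochastic matrix on \<open>K\<close> is given by its rows: \<open>M k\<close> is the law of the next
  state when the current state is \<open>k\<close>.
\<close>

text \<open>
  The public history \<open>h\<close> before stage \<open>t\<close> has length \<open>t - 1\<close> and the list of the states observed
  by a player has length \<open>t\<close>, most recent last.  The lengths determine \<open>t\<close>, so a single function on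
  lists encodes the whole sequence \<open>(\<sigma>\<^sub>t)\<^sub>t\<close>; its values on lists of other lengths are never used.
  Player 1 has \<open>'s = 'k\<close>, \<open>'a = 'i\<close>, and Player 2 has \<open>'s = 'l\<close>, \<open>'a = 'j\<close>.
\<close>

type_synonym ('i, 'j, 's, 'a) strategy = "('i \<times> 'j) list \<Rightarrow> 's list \<Rightarrow> 'a pmf"

type_synonym ('k, 'l, 'i, 'j) play = "('k \<times> 'l \<times> 'i \<times> 'j) list"

definition states1 :: "('k, 'l, 'i, 'j) play \<Rightarrow> 'k list" where
  "states1 w = map (\<lambda>(k, l, i, j). k) w"

definition states2 :: "('k, 'l, 'i, 'j) play \<Rightarrow> 'l list" where
  "states2 w = map (\<lambda>(k, l, i, j). l) w"

definition actions :: "('k, 'l, 'i, 'j) play \<Rightarrow> ('i \<times> 'j) list" where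
  "actions w = map (\<lambda>(k, l, i, j). (i, j)) w"

definition next_state :: "('s \<Rightarrow> 's pmf) \<Rightarrow> 's pmf \<Rightarrow> 's list \<Rightarrow> 's pmf" where
  "next_state P p ss = (if ss = [] then p else P (last ss))"

text \<open>
  \<open>play_pmf M N p q \<sigma> \<tau> T\<close> is the law of the first \<open>T\<close> stages, i.e. the marginal of the
  induced probability on \<open>(K \<times> L \<times> I \<times> J)\<^sup>\<infinity>\<close> on its first \<open>T\<close> coordinates.
\<close>

primrec play_pmf ::
  "('k \<Rightarrow> 'k pmf) \<Rightarrow> ('l \<Rightarrow> 'l pmf) \<Rightarrow> 'k pmf \<Rightarrow> 'l pmf \<Rightarrow>
   ('i, 'j, 'k, 'i) strategy \<Rightarrow> ('i, 'j, 'l, 'j) strategy \<Rightarrow> nat \<Rightarrow> ('k, 'l, 'i, 'j) play pmf" where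
  "play_pmf M N p q \<sigma> \<tau> 0 = return_pmf []"
| "play_pmf M N p q \<sigma> \<tau> (Suc t) =
     bind_pmf (play_pmf M N p q \<sigma> \<tau> t) (\<lambda>w.
     bind_pmf (next_state M p (states1 w)) (\<lambda>k.
     bind_pmf (next_state N q (states2 w)) (\<lambda>l.
     bind_pmf (\<sigma> (actions w) (states1 w @ [k])) (\<lambda>i.
     bind_pmf (\<tau> (actions w) (states2 w @ [l])) (\<lambda>j.
     return_pmf (w @ [(k, l, i, j)]))))))"

definition payoff ::
  "('k \<Rightarrow> 'l \<Rightarrow> 'i \<Rightarrow> 'j \<Rightarrow> real) \<Rightarrow> ('k \<Rightarrow> 'k pmf) \<Rightarrow> ('l \<Rightarrow> 'l pmf) \<Rightarrow> 'k pmf \<Rightarrow> 'l pmf \<Rightarrow> nat \<Rightarrow>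
   ('i, 'j, 'k, 'i) strategy \<Rightarrow> ('i, 'j, 'l, 'j) strategy \<Rightarrow> real" where
  "payoff g M N p q T \<sigma> \<tau> =
     measure_pmf.expectation (play_pmf M N p q \<sigma> \<tau> T)
       (\<lambda>w. (1 / real T) * (\<Sum>(k, l, i, j)\<leftarrow>w. g k l i j))"

definition is_max :: "real set \<Rightarrow> real \<Rightarrow> bool" where
  "is_max A m \<longleftrightarrow> m \<in> A \<and> (\<forall>x\<in>A. x \<le> m)"

definition is_min :: "real set \<Rightarrow> real \<Rightarrow> bool" where
  "is_min A m \<longleftrightarrow> m \<in> A \<and> (\<forall>x\<in>A. m \<le> x)"

definition is_maxmin :: "('a \<Rightarrow> 'b \<Rightarrow> real) \<Rightarrow> real \<Rightarrow> bool" where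
  "is_maxmin f v \<longleftrightarrow> (\<exists>m. (\<forall>x. is_min (range (f x)) (m x)) \<and> is_max (range m) v)"

definition is_minmax :: "('a \<Rightarrow> 'b \<Rightarrow> real) \<Rightarrow> real \<Rightarrow> bool" where
  "is_minmax f v \<longleftrightarrow> (\<exists>m. (\<forall>y. is_max (range (\<lambda>x. f x y)) (m y)) \<and> is_min (range m) v)"

text \<open>
  \<open>v = max\<^sub>\<sigma> min\<^sub>\<tau> \<gamma>\<^sub>T(\<sigma>,\<tau>) = min\<^sub>\<tau> max\<^sub>\<sigma> \<gamma>\<^sub>T(\<sigma>,\<tau>)\<close>, all optima being attained.
\<close>

definition is_game_value ::
  "('k \<Rightarrow> 'l \<Rightarrow> 'i \<Rightarrow> 'j \<Rightarrow> real) \<Rightarrow> ('k \<Rightarrow> 'k pmf) \<Rightarrow> ('l \<Rightarrow> 'l pmf) \<Rightarrow> 'k pmf \<Rightarrow> 'l pmf \<Rightarrow> nat \<Rightarrow>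
   real \<Rightarrow> bool" where
  "is_game_value g M N p q T v \<longleftrightarrow>
     is_maxmin (payoff g M N p q T) v \<and> is_minmax (payoff g M N p q T) v"

lemma is_game_value_unique:
  "is_game_value g M N p q T v \<Longrightarrow> is_game_value g M N p q T v' \<Longrightarrow> v = v'"
proof -
  assume a: "is_game_value g M N p q T v" "is_game_value g M N p q T v'"
  obtain m n where m: "\<forall>x. is_min (range (payoff g M N p q T x)) (m x)" "is_max (range m) v"
    and n: "\<forall>x. is_min (range (payoff g M N p q T x)) (n x)" "is_max (range n) v'"
    using a unfolding is_game_value_def is_maxmin_def by blast
  have "m x = n x" for x
    using m(1) n(1) unfolding is_min_def by (meson order_antisym)
  then have "m = n" by blast
  then show "v = v'" using m(2) n(2) unfolding is_max_def by (meson order_antisym)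
qed

end

theory Submission
  imports Defs
begin

text \<open>
  Everything is phrased with unnormalised laws: nonnegative vectors in place of probabilities.
  A player's behaviour is encoded by a \<open>plan\<close>, the joint weight of his current state and of his own
  actions along every public history. Plans form convex compact sets, payoffs are bilinear in the two
  plans, and every plan comes from a strategy that looks only at the public history and the current
  state. The minimax theorem \<open>saddle_point_exists\<close> therefore gives the value with all optima attained,
  and the function \<open>val t p q\<close>, which is \<open>t\<close> times the value, makes sense for all nonnegative \<open>p\<close>, \<open>q\<close>. It
  is homogeneous, superadditive in \<open>p\<close>, subadditive in \<open>q\<close>, and obeys a recursion over blocks of stages
  (\<open>val_block1\<close>, \<open>val_block2\<close>). Passing to unnormalised laws is what makes this recursion free of
  divisions by probabilities of histories.

  Some power \<open>D\<close> of both transition matrices has an idempotent support (\<open>mixing_exists\<close>). For such a \<open>D\<close>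
  the recurrent states split into classes inside which one block of \<open>D\<close> stages mixes with a uniform
  constant \<open>\<alpha>\<close>. Two laws on the recurrent states that give the same masses to the classes then have
  values of \<open>t\<close>-stage games that differ by a constant independent of \<open>t\<close> (\<open>merge_right\<close>), because
  a player can pretend to have the other law until both have merged. So asymptotically only the masses
  of the classes matter, and they do not change over a block unless the actions reveal something.

  Write \<open>f t = val t / t\<close>. Suppose that \<open>f t p q\<close> and \<open>f s p q\<close> stay apart as \<open>t\<close> and \<open>s\<close> tend to infinity, and
  let \<open>(p, q)\<close> maximise the upper limit of \<open>f t p q - f s p q + \<theta> (|p|\<^sup>2 + |q|\<^sup>2)\<close>. If Player 1's
  optimal play in the game of length \<open>t\<close> splits \<open>p\<close>, then \<open>f s\<close>, being concave in \<open>p\<close>, does not increase on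
  average, while the strictly convex term does; by maximality \<open>f t\<close> has to decrease on average, which is
  impossible for optimal play. Hence optimal play over a block of fixed length \<open>n\<close> reveals asymptotically
  nothing about the class (\<open>variance_bound\<close>), and the same holds for Player 2 in the game of length \<open>s\<close>.
  Along suitable subsequences the two plans for the block converge to exactly non-revealing plans. When
  the opponent does not reveal his class, his law after the block may be replaced by the one before it.
  So during the block the optimal plan of the first game earns at least \<open>f t p q\<close> per stage against a
  non-revealing opponent, and the optimal plan of the second game concedes at most \<open>f s p q\<close>, up to an
  error of order \<open>1/n\<close> (\<open>nonrevealing_upper\<close>, \<open>nonrevealing_lower\<close>). In the limit
  both payoffs are the same number, whence \<open>f t p q - f s p q\<close> is small (\<open>gap_at_maximiser\<close>).

  This needs lengths \<open>t\<close> at which \<open>f t p q\<close> is not much smaller than \<open>f (t - n) p q\<close>; they exist because a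
  bounded sequence cannot decrease by \<open>\<epsilon> n / t\<close> at every step of length \<open>n\<close> (\<open>descent\<close>).
\<close>

section \<open>A minimax theorem\<close>

text \<open>
  Mixing two elements of \<open>X\<close> is required only at the level of payoffs, so that \<open>X\<close> may be an arbitrary
  topological space.
\<close>

definition affinelike :: "'x set \<Rightarrow> 'y set \<Rightarrow> ('x \<Rightarrow> 'y \<Rightarrow> real) \<Rightarrow> bool" where
  "affinelike X Y f \<longleftrightarrow> (\<forall>x\<in>X. \<forall>x'\<in>X. \<forall>u\<in>{0..1}. \<exists>z\<in>X. \<forall>y\<in>Y. f z y = u * f x y + (1 - u) * f x' y)"

lemma affinelikeD:
  assumes "affinelike X Y f" "x \<in> X" "x' \<in> X" "0 \<le> u" "u \<le> 1"
  obtains z where "z \<in> X" "\<And>y. y \<in> Y \<Longrightarrow> f z y = u * f x y + (1 - u) * f x' y"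
  using assms unfolding affinelike_def by fastforce

lemma affinelike_minus:
  assumes "affinelike X Y f"
  shows "affinelike X Y (\<lambda>x y. - f x y)"
  unfolding affinelike_def
proof (intro ballI)
  fix x x' u assume "x \<in> X" "x' \<in> X" "u \<in> {0..1::real}"
  then obtain z where "z \<in> X" "\<And>y. y \<in> Y \<Longrightarrow> f z y = u * f x y + (1 - u) * f x' y"
    using affinelikeD[OF assms, of x x' u] by auto
  then show "\<exists>z\<in>X. \<forall>y\<in>Y. - f z y = u * - f x y + (1 - u) * - f x' y"
    by (intro bexI[of _ z]) auto
qed

text \<open>
  The image of \<open>X\<close> under the two payoffs is a compact convex subset of the plane that misses a closed
  quadrant; the normal vector of a separating line gives the weights of the mixture.
\<close>

lemma two_alternatives:
  fixes f :: "'x::topological_space \<Rightarrow> 'y \<Rightarrow> real"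
  assumes X: "compact X" and cont: "\<And>y. y \<in> Y \<Longrightarrow> continuous_on X (\<lambda>x. f x y)"
    and aff: "affinelike X Y f" and y: "y1 \<in> Y" "y2 \<in> Y"
    and lt: "\<And>x. x \<in> X \<Longrightarrow> f x y1 < \<alpha> \<or> f x y2 < \<alpha>"
  shows "\<exists>u\<in>{0..1}. \<forall>x\<in>X. u * f x y1 + (1 - u) * f x y2 < \<alpha>"
proof (cases "X = {}")
  case True
  then show ?thesis by force
next
  case False
  then obtain x0 where x0: "x0 \<in> X" by blast
  let ?S = "(\<lambda>x. (f x y1, f x y2)) ` X"
  let ?C = "{z :: real \<times> real. \<alpha> \<le> fst z \<and> \<alpha> \<le> snd z}"
  have "compact ?S"
    using X cont y by (intro compact_continuous_image continuous_on_Pair) auto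
  moreover have "convex ?S"
    unfolding convex_alt
  proof (intro ballI allI impI)
    fix v w u assume "v \<in> ?S" "w \<in> ?S" and u: "0 \<le> u \<and> u \<le> (1::real)"
    then obtain a b where a: "a \<in> X" "v = (f a y1, f a y2)" and b: "b \<in> X" "w = (f b y1, f b y2)"
      by blast
    obtain z where "z \<in> X" "\<And>y. y \<in> Y \<Longrightarrow> f z y = (1 - u) * f a y + (1 - (1 - u)) * f b y"
      using affinelikeD[OF aff a(1) b(1), of "1 - u"] u by auto
    then have "(1 - u) *\<^sub>R v + u *\<^sub>R w = (f z y1, f z y2)" "z \<in> X"
      using a b y by auto
    then show "(1 - u) *\<^sub>R v + u *\<^sub>R w \<in> ?S" by blast
  qed
  moreover have "closed ?C"
    by (intro closed_Collect_conj closed_Collect_le continuous_intros)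
  moreover have "convex ?C"
    unfolding convex_alt
  proof (intro ballI allI impI)
    fix v w and u :: real assume vw: "v \<in> ?C" "w \<in> ?C" "0 \<le> u \<and> u \<le> 1"
    have "\<alpha> = (1 - u) * \<alpha> + u * \<alpha>" by (simp add: algebra_simps)
    also have "\<dots> \<le> (1 - u) * fst v + u * fst w"
      using vw by (intro add_mono mult_left_mono) auto
    finally have 1: "\<alpha> \<le> (1 - u) * fst v + u * fst w" .
    have "\<alpha> = (1 - u) * \<alpha> + u * \<alpha>" by (simp add: algebra_simps)
    also have "\<dots> \<le> (1 - u) * snd v + u * snd w"
      using vw by (intro add_mono mult_left_mono) auto
    finally show "(1 - u) *\<^sub>R v + u *\<^sub>R w \<in> ?C" using 1 by simp
  qed
  moreover have "?S \<inter> ?C = {}" using lt by force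
  ultimately have "\<exists>a b. (\<forall>z\<in>?S. inner a z < b) \<and> (\<forall>z\<in>?C. b < inner a z)"
    using False by (intro separating_hyperplane_compact_closed) blast+
  then obtain a b where sep: "\<And>z. z \<in> ?S \<Longrightarrow> inner a z < b" "\<And>z. z \<in> ?C \<Longrightarrow> b < inner a z"
    by blast
  obtain a1 a2 where a: "a = (a1, a2)" by fastforce
  have C: "b < a1 * s + a2 * t" if "\<alpha> \<le> s" "\<alpha> \<le> t" for s t
    using sep(2)[of "(s, t)"] that a by simp
  have S: "a1 * f x y1 + a2 * f x y2 < b" if "x \<in> X" for x
    using sep(1)[of "(f x y1, f x y2)"] that a by auto
  \<comment> \<open>\<open>?C\<close> is unbounded upwards, so the normal vector is nonnegative.\<close>
  have nonneg: "0 \<le> c" if "\<And>s. \<alpha> \<le> s \<Longrightarrow> b < c * s + d" for c d :: real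
  proof (rule ccontr)
    assume "\<not> 0 \<le> c"
    then have c: "c < 0" by simp
    have "b < c * (max \<alpha> ((b - d) / c)) + d" by (rule that) simp
    also have "c * (max \<alpha> ((b - d) / c)) \<le> c * ((b - d) / c)"
      using c by (intro mult_left_mono_neg) auto
    finally show False using c by simp
  qed
  have a1: "0 \<le> a1" using nonneg[of a1 "a2 * \<alpha>"] C by auto
  have a2: "0 \<le> a2" using nonneg[of a2 "a1 * \<alpha>"] C by (auto simp: add.commute)
  have pos: "0 < a1 + a2"
  proof (rule ccontr)
    assume "\<not> 0 < a1 + a2"
    then have "a1 = 0" "a2 = 0" using a1 a2 by auto
    then show False using S[OF x0] C[of \<alpha> \<alpha>] by simp
  qed
  define u where "u = a1 / (a1 + a2)"
  have u: "1 - u = a2 / (a1 + a2)" using pos by (simp add: u_def field_simps)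
  have "u * f x y1 + (1 - u) * f x y2 < \<alpha>" if x: "x \<in> X" for x
  proof -
    have "a1 * f x y1 + a2 * f x y2 < (a1 + a2) * \<alpha>"
      using S[OF x] C[of \<alpha> \<alpha>] by (simp add: algebra_simps)
    moreover have "u * f x y1 + (1 - u) * f x y2 = (a1 * f x y1 + a2 * f x y2) / (a1 + a2)"
      unfolding u by (simp add: u_def add_divide_distrib)
    ultimately show ?thesis using pos by (simp add: pos_divide_less_eq mult.commute)
  qed
  moreover have "u \<in> {0..1}" using a1 a2 pos by (simp add: u_def)
  ultimately show ?thesis by blast
qed

text \<open>
  The induction removes one alternative \<open>y\<close> and shrinks \<open>X\<close> to the points where \<open>y\<close> fails. This is again a
  compact set closed under mixing, where by induction a single \<open>y'\<close> works; \<open>y\<close> and \<open>y'\<close> are then mixed by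
  the case of two alternatives.
\<close>

lemma finite_alternatives:
  fixes f :: "'x::topological_space \<Rightarrow> 'y \<Rightarrow> real"
  assumes "finite F" "F \<noteq> {}" "F \<subseteq> Y" "compact X"
    and "\<And>y. y \<in> Y \<Longrightarrow> continuous_on X (\<lambda>x. f x y)"
    and "affinelike X Y f" "affinelike Y X (\<lambda>y x. f x y)"
    and "\<And>x. x \<in> X \<Longrightarrow> \<exists>y\<in>F. f x y < \<alpha>"
  shows "\<exists>y\<in>Y. \<forall>x\<in>X. f x y < \<alpha>"
  using assms
proof (induction F arbitrary: X rule: finite_ne_induct)
  case (singleton y)
  then show ?case by auto
next
  case (insert y F)
  let ?X = "{x \<in> X. \<alpha> \<le> f x y}"
  have yY: "y \<in> Y" using insert.prems by auto
  have cont: "continuous_on ?X (\<lambda>x. f x y')" if "y' \<in> Y" for y'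
    using insert.prems(3)[OF that] by (rule continuous_on_subset) auto
  have "?X = X \<inter> {x \<in> X. \<alpha> \<le> f x y}" by auto
  moreover have "compact {x \<in> X. \<alpha> \<le> f x y}"
  proof -
    have "closedin (top_of_set X) (X \<inter> (\<lambda>x. f x y) -` {\<alpha>..})"
      using insert.prems(3)[OF yY] by (rule continuous_closedin_preimage) auto
    moreover have "X \<inter> (\<lambda>x. f x y) -` {\<alpha>..} = ?X" by auto
    ultimately show ?thesis using insert.prems(2) closedin_compact by metis
  qed
  ultimately have comp: "compact ?X" by auto
  have "\<exists>y'\<in>Y. \<forall>x\<in>?X. f x y' < \<alpha>"
  proof (rule insert.IH)
    show "F \<subseteq> Y" using insert.prems by auto
    show "affinelike ?X Y f"
      unfolding affinelike_def
    proof (intro ballI)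
      fix x x' u assume x: "x \<in> ?X" "x' \<in> ?X" "u \<in> {0..1::real}"
      obtain z where z: "z \<in> X" "\<And>y. y \<in> Y \<Longrightarrow> f z y = u * f x y + (1 - u) * f x' y"
        using affinelikeD[OF insert.prems(4), of x x' u] x by auto
      have "\<alpha> = u * \<alpha> + (1 - u) * \<alpha>" by (simp add: algebra_simps)
      also have "\<dots> \<le> u * f x y + (1 - u) * f x' y"
        using x by (intro add_mono mult_left_mono) auto
      finally have "\<alpha> \<le> f z y" using z yY by simp
      then show "\<exists>z\<in>?X. \<forall>y\<in>Y. f z y = u * f x y + (1 - u) * f x' y" using z by blast
    qed
    show "affinelike Y ?X (\<lambda>y x. f x y)"
      unfolding affinelike_def
    proof (intro ballI)
      fix a b u assume "a \<in> Y" "b \<in> Y" "u \<in> {0..1::real}"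
      then obtain z where "z \<in> Y" "\<And>x. x \<in> X \<Longrightarrow> f x z = u * f x a + (1 - u) * f x b"
        using affinelikeD[OF insert.prems(5), of a b u] by auto
      then show "\<exists>z\<in>Y. \<forall>x\<in>?X. f x z = u * f x a + (1 - u) * f x b" by auto
    qed
    show "\<exists>y\<in>F. f x y < \<alpha>" if "x \<in> ?X" for x
      using insert.prems(6)[of x] that by auto
  qed (use comp cont in auto)
  then obtain y' where y': "y' \<in> Y" "\<And>x. x \<in> ?X \<Longrightarrow> f x y' < \<alpha>"
    by blast
  then have alt: "f x y < \<alpha> \<or> f x y' < \<alpha>" if "x \<in> X" for x
    using that by (cases "f x y < \<alpha>") auto
  obtain u where u: "u \<in> {0..1}" "\<And>x. x \<in> X \<Longrightarrow> u * f x y + (1 - u) * f x y' < \<alpha>"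
    using two_alternatives[OF insert.prems(2) insert.prems(3) insert.prems(4) yY y'(1) alt] by blast
  obtain z where "z \<in> Y" "\<And>x. x \<in> X \<Longrightarrow> f x z = u * f x y + (1 - u) * f x y'"
    using affinelikeD[OF insert.prems(5) yY y'(1), of u] u(1) by auto
  then show ?case using u(2) by metis
qed

lemma compact_alternatives:
  fixes f :: "'x::topological_space \<Rightarrow> 'y \<Rightarrow> real"
  assumes X: "compact X" and Y: "Y \<noteq> {}" and cont: "\<And>y. y \<in> Y \<Longrightarrow> continuous_on X (\<lambda>x. f x y)"
    and aff: "affinelike X Y f" "affinelike Y X (\<lambda>y x. f x y)"
    and lt: "\<And>x. x \<in> X \<Longrightarrow> \<exists>y\<in>Y. f x y < \<alpha>"
  shows "\<exists>y\<in>Y. \<forall>x\<in>X. f x y < \<alpha>"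
proof -
  define U where "U y = X \<inter> (\<lambda>x. f x y) -` {..<\<alpha>}" for y
  have U: "openin (top_of_set X) (U y)" if "y \<in> Y" for y
    unfolding U_def using cont[OF that] by (rule continuous_openin_preimage_gen) auto
  have "\<exists>\<D>\<subseteq>U ` Y. finite \<D> \<and> X \<subseteq> \<Union>\<D>"
  proof -
    have "\<forall>\<C>. (\<forall>c\<in>\<C>. openin (top_of_set X) c) \<and> X \<subseteq> \<Union>\<C> \<longrightarrow> (\<exists>\<D>\<subseteq>\<C>. finite \<D> \<and> X \<subseteq> \<Union>\<D>)"
      using X compact_eq_openin_cover by blast
    moreover have "X \<subseteq> \<Union>(U ` Y)"
    proof
      fix x assume "x \<in> X"
      then show "x \<in> \<Union>(U ` Y)" using lt[of x] unfolding U_def by blast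
    qed
    moreover have "\<forall>c\<in>U ` Y. openin (top_of_set X) c" using U by blast
    ultimately show ?thesis by blast
  qed
  then obtain \<D> where D: "\<D> \<subseteq> U ` Y" "finite \<D>" "X \<subseteq> \<Union>\<D>" by blast
  obtain F where F: "F \<subseteq> Y" "finite F" "X \<subseteq> \<Union>(U ` F)"
    using finite_subset_image[OF D(2,1)] D(3) by blast
  obtain y0 where "y0 \<in> Y" using Y by blast
  show ?thesis
  proof (rule finite_alternatives[OF _ _ _ X cont aff])
    show "finite (insert y0 F)" "insert y0 F \<noteq> {}" "insert y0 F \<subseteq> Y"
      using F \<open>y0 \<in> Y\<close> by simp_all
    show "\<exists>y\<in>insert y0 F. f x y < \<alpha>" if xX: "x \<in> X" for x
    proof -
      obtain y where "y \<in> F" "x \<in> U y" using F(3) xX by blast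
      then show ?thesis unfolding U_def by blast
    qed
  qed
qed

lemma maximin_strategy_exists:
  fixes f :: "'x::topological_space \<Rightarrow> 'y::topological_space \<Rightarrow> real"
  assumes X: "compact X" "X \<noteq> {}" and Y: "compact Y" "Y \<noteq> {}"
    and cx: "\<And>y. y \<in> Y \<Longrightarrow> continuous_on X (\<lambda>x. f x y)"
    and cy: "\<And>x. x \<in> X \<Longrightarrow> continuous_on Y (\<lambda>y. f x y)"
    and aff: "affinelike X Y f" "affinelike Y X (\<lambda>y x. f x y)"
    and bound: "\<And>y. y \<in> Y \<Longrightarrow> \<exists>x\<in>X. v \<le> f x y"
  shows "\<exists>x\<in>X. \<forall>y\<in>Y. v \<le> f x y"
proof (rule ccontr)
  assume *: "\<not> ?thesis"
  have "\<exists>y\<in>Y. \<forall>x\<in>X. f x y < v"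
  proof (rule compact_alternatives[OF X(1) Y(2) cx aff])
    show "\<exists>y\<in>Y. f x y < v" if "x \<in> X" for x
      using * that by (meson not_le)
  qed
  then show False using bound by force
qed

text \<open>
  \<open>v\<close> is the infimum over \<open>y\<close> of the best reply payoffs. If no \<open>x\<close> guaranteed \<open>v\<close>, then some \<open>y\<close> would keep all
  payoffs strictly below \<open>v\<close> by the preceding lemmas. The second player guarantees \<open>v\<close> by the same
  argument with the roles exchanged.
\<close>

theorem saddle_point_exists:
  fixes f :: "'x::topological_space \<Rightarrow> 'y::topological_space \<Rightarrow> real"
  assumes X: "compact X" "X \<noteq> {}" and Y: "compact Y" "Y \<noteq> {}"
    and cx: "\<And>y. y \<in> Y \<Longrightarrow> continuous_on X (\<lambda>x. f x y)"
    and cy: "\<And>x. x \<in> X \<Longrightarrow> continuous_on Y (\<lambda>y. f x y)"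
    and aff: "affinelike X Y f" "affinelike Y X (\<lambda>y x. f x y)"
  shows "\<exists>x\<in>X. \<exists>y\<in>Y. (\<forall>x'\<in>X. f x' y \<le> f x y) \<and> (\<forall>y'\<in>Y. f x y \<le> f x y')"
proof -
  have "\<forall>y\<in>Y. \<exists>x. x \<in> X \<and> (\<forall>x'\<in>X. f x' y \<le> f x y)"
  proof
    fix y assume "y \<in> Y"
    from continuous_attains_sup[OF X(1,2) cx[OF this]]
    show "\<exists>x. x \<in> X \<and> (\<forall>x'\<in>X. f x' y \<le> f x y)" by blast
  qed
  from bchoice[OF this]
  obtain r where r: "\<And>y. y \<in> Y \<Longrightarrow> r y \<in> X \<and> (\<forall>x'\<in>X. f x' y \<le> f (r y) y)" by blast
  define h where "h y = f (r y) y" for y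
  have bdd: "bdd_below (h ` Y)"
  proof -
    obtain x0 where x0: "x0 \<in> X" using X by blast
    obtain y0 where y0: "\<And>y. y \<in> Y \<Longrightarrow> f x0 y0 \<le> f x0 y"
      using continuous_attains_inf[OF Y cy[OF x0]] by blast
    have "f x0 y0 \<le> h y" if "y \<in> Y" for y
    proof -
      have "f x0 y0 \<le> f x0 y" using y0[OF that] .
      also have "\<dots> \<le> h y" using r[OF that] x0 unfolding h_def by simp
      finally show ?thesis .
    qed
    then show ?thesis by (rule bdd_belowI2)
  qed
  define v where "v = Inf (h ` Y)"
  have low: "\<exists>y\<in>Y. - v \<le> - f a y" if aX: "a \<in> X" for a
  proof -
    obtain y0 where y0: "y0 \<in> Y" "\<And>y. y \<in> Y \<Longrightarrow> f a y0 \<le> f a y"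
      using continuous_attains_inf[OF Y cy[OF aX]] by blast
    have "f a y0 \<le> z" if z: "z \<in> h ` Y" for z
    proof -
      obtain y where y: "y \<in> Y" "z = h y" using z by blast
      have "f a y0 \<le> f a y" using y0(2) y(1) .
      also have "\<dots> \<le> h y" using r[OF y(1)] aX unfolding h_def by simp
      finally show "f a y0 \<le> z" using y(2) by simp
    qed
    moreover have "h ` Y \<noteq> {}" using Y(2) by simp
    ultimately have "f a y0 \<le> v" unfolding v_def by (intro cInf_greatest)
    then have "- v \<le> - f a y0" by simp
    then show "\<exists>y\<in>Y. - v \<le> - f a y" using y0(1) by blast
  qed
  have high: "\<exists>x\<in>X. v \<le> f x y" if "y \<in> Y" for y
  proof -
    have "h y \<in> h ` Y" using that by simp
    then have "v \<le> h y" unfolding v_def using bdd by (rule cInf_lower)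
    then show ?thesis using r[OF that] unfolding h_def by (intro bexI[of _ "r y"]) simp_all
  qed
  have "\<exists>x\<in>X. \<forall>y\<in>Y. v \<le> f x y"
    by (rule maximin_strategy_exists[OF X Y cx cy aff high])
  then obtain x where x: "x \<in> X" "\<And>y. y \<in> Y \<Longrightarrow> v \<le> f x y" by blast
  have aff': "affinelike Y X (\<lambda>y x. - f x y)" "affinelike X Y (\<lambda>x y. - f x y)"
    using aff by (auto intro: affinelike_minus)
  have "\<exists>y\<in>Y. \<forall>x\<in>X. - v \<le> - f x y"
    by (rule maximin_strategy_exists[OF Y X _ _ aff' low]) (use cx cy in \<open>auto intro: continuous_on_minus\<close>)
  then obtain y where y: "y \<in> Y" "\<And>x. x \<in> X \<Longrightarrow> - v \<le> - f x y" by blast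
  have "f x y = v" using x(2)[OF y(1)] y(2)[OF x(1)] by auto
  moreover have "f x' y \<le> v" if "x' \<in> X" for x' using y(2)[OF that] by simp
  ultimately show ?thesis using x y(1) by (intro bexI[of _ x] bexI[of _ y]) auto
qed

section \<open>Plans\<close>

abbreviation mass :: "('s::finite \<Rightarrow> real) \<Rightarrow> real" where
  "mass p \<equiv> sum p UNIV"

definition stochastic :: "('s::finite \<Rightarrow> 's \<Rightarrow> real) \<Rightarrow> bool" where
  "stochastic M \<longleftrightarrow> (\<forall>k k'. 0 \<le> M k k') \<and> (\<forall>k. mass (M k) = 1)"

definition step :: "('s::finite \<Rightarrow> 's \<Rightarrow> real) \<Rightarrow> ('s \<Rightarrow> real) \<Rightarrow> 's \<Rightarrow> real" where
  "step M p = (\<lambda>k'. \<Sum>k\<in>UNIV. p k * M k k')"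

definition nonneg :: "('s \<Rightarrow> real) \<Rightarrow> bool" where
  "nonneg p \<longleftrightarrow> (\<forall>k. 0 \<le> p k)"

lemma nonnegI: "(\<And>k. 0 \<le> p k) \<Longrightarrow> nonneg p"
  by (simp add: nonneg_def)

lemma nonnegD: "nonneg p \<Longrightarrow> 0 \<le> p k"
  by (simp add: nonneg_def)

lemma nonneg_zero [simp]: "nonneg (\<lambda>k. 0)"
  by (simp add: nonneg_def)

lemma nonneg_add: "nonneg p \<Longrightarrow> nonneg p' \<Longrightarrow> nonneg (\<lambda>k. p k + p' k)"
  by (simp add: nonneg_def)

lemma nonneg_scale: "0 \<le> s \<Longrightarrow> nonneg p \<Longrightarrow> nonneg (\<lambda>k. s * p k)"
  by (simp add: nonneg_def)

lemma nonneg_sum: "(\<And>x. x \<in> X \<Longrightarrow> nonneg (f x)) \<Longrightarrow> nonneg (\<lambda>k. \<Sum>x\<in>X. f x k)"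
  by (simp add: nonneg_def sum_nonneg)

lemma mass_nonneg: "nonneg p \<Longrightarrow> 0 \<le> mass p"
  by (simp add: nonneg_def sum_nonneg)

lemma step_nonneg: "stochastic M \<Longrightarrow> nonneg p \<Longrightarrow> nonneg (step M p)"
  by (auto simp: step_def stochastic_def nonneg_def intro!: sum_nonneg)

lemma mass_step: "stochastic M \<Longrightarrow> mass (step M p) = mass p"
  unfolding step_def stochastic_def by (subst sum.swap) (simp add: sum_distrib_left[symmetric])

lemma step_add: "step M (\<lambda>k. p k + p' k) k' = step M p k' + step M p' k'"
  by (simp add: step_def sum.distrib ring_distribs)

lemma step_scale: "step M (\<lambda>k. s * p k) k' = s * step M p k'"
  by (simp add: step_def sum_distrib_left mult.assoc)

lemma step_sum: "step M (\<lambda>k. \<Sum>x\<in>X. f x k) k' = (\<Sum>x\<in>X. step M (f x) k')"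
  unfolding step_def by (simp add: sum_distrib_right) (rule sum.swap)

lemma step_mono: "stochastic M \<Longrightarrow> (\<And>k. p k \<le> p' k) \<Longrightarrow> step M p k' \<le> step M p' k'"
  by (auto simp: step_def stochastic_def intro!: sum_mono mult_right_mono)

lemma steps_nonneg: "stochastic M \<Longrightarrow> nonneg p \<Longrightarrow> nonneg ((step M ^^ n) p)"
  by (induction n) (auto intro: step_nonneg)

lemma mass_steps: "stochastic M \<Longrightarrow> mass ((step M ^^ n) p) = mass p"
  by (induction n) (auto simp: mass_step)

definition hist :: "nat \<Rightarrow> 'e::finite list set" where
  "hist t = {h. length h = t}"

lemma finite_hist [simp]: "finite (hist t)"
  unfolding hist_def using finite_lists_length_eq[of "UNIV :: 'e::finite set" t] by simp

lemma hist_0 [simp]: "hist 0 = {[]}"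
  by (auto simp: hist_def)

lemma hist_length: "h \<in> hist t \<Longrightarrow> length h = t"
  by (simp add: hist_def)

lemma sum_hist_append: "(\<Sum>h\<in>hist (n + t). F h) = (\<Sum>h\<in>hist n. \<Sum>h'\<in>hist t. F (h @ h'))"
proof -
  have "(\<Sum>h\<in>hist n. \<Sum>h'\<in>hist t. F (h @ h')) = (\<Sum>(h, h')\<in>hist n \<times> hist t. F (h @ h'))"
    by (simp add: sum.cartesian_product)
  also have "\<dots> = (\<Sum>h\<in>hist (n + t). F h)"
    by (rule sum.reindex_bij_witness[of _ "\<lambda>h. (take n h, drop n h)" "\<lambda>(h, h'). h @ h'"])
      (auto simp: hist_def)
  finally show ?thesis by simp
qed

lemma sum_hist_Suc: "(\<Sum>h\<in>hist (Suc t). F h) = (\<Sum>h\<in>hist t. \<Sum>e\<in>UNIV. F (h @ [e]))"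
proof -
  have "(\<Sum>h'\<in>hist 1. F (h @ h')) = (\<Sum>e\<in>UNIV. F (h @ [e]))" for h
    by (rule sum.reindex_bij_witness[of _ "\<lambda>e. [e]" hd]) (auto simp: hist_def length_Suc_conv)
  then show ?thesis using sum_hist_append[of F t 1] by simp
qed

text \<open>
  An element of type \<open>'e\<close> is a pair of actions, and \<open>sel\<close> selects the player's own action. The value \<open>c h a k\<close> is
  the weight with which the player's state is \<open>k\<close> at the end of the public history \<open>h\<close>, his own actions were
  those in \<open>h\<close>, and he now chooses \<open>a\<close>. It depends on the actions of the opponent in \<open>h\<close>, but does not
  include their probabilities. The vector \<open>weights sel M p c h\<close> is then proportional to the posterior law of
  the current state. Plans are defined on histories of every length, so that one plan serves for all
  horizons.
\<close>

type_synonym ('e, 'a, 's) plan = "'e list \<Rightarrow> 'a \<Rightarrow> 's \<Rightarrow> real"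

definition weights ::
  "('e \<Rightarrow> 'a) \<Rightarrow> ('s::finite \<Rightarrow> 's \<Rightarrow> real) \<Rightarrow> ('s \<Rightarrow> real) \<Rightarrow> ('e, 'a, 's) plan \<Rightarrow> 'e list \<Rightarrow> 's \<Rightarrow> real" where
  "weights sel M p c h = (if h = [] then p else step M (c (butlast h) (sel (last h))))"

definition plans ::
  "('e \<Rightarrow> 'a::finite) \<Rightarrow> ('s::finite \<Rightarrow> 's \<Rightarrow> real) \<Rightarrow> ('s \<Rightarrow> real) \<Rightarrow> ('e, 'a, 's) plan set" where
  "plans sel M p =
     {c. (\<forall>h a k. 0 \<le> c h a k) \<and> (\<forall>h k. (\<Sum>a\<in>UNIV. c h a k) = weights sel M p c h k)}"

lemma weights_Nil [simp]: "weights sel M p c [] = p"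
  by (simp add: weights_def)

lemma weights_snoc [simp]: "weights sel M p c (h @ [e]) = step M (c h (sel e))"
  by (simp add: weights_def)

lemma plan_nonneg: "c \<in> plans sel M p \<Longrightarrow> 0 \<le> c h a k"
  by (simp add: plans_def)

lemma plan_sum: "c \<in> plans sel M p \<Longrightarrow> (\<Sum>a\<in>UNIV. c h a k) = weights sel M p c h k"
  by (simp add: plans_def)

lemma plan_le_weights: "c \<in> plans sel M p \<Longrightarrow> c h a k \<le> weights sel M p c h k"
  using member_le_sum[of a UNIV "\<lambda>a. c h a k"] by (simp add: plan_sum plan_nonneg)

lemma plan_mass: "c \<in> plans sel M p \<Longrightarrow> (\<Sum>a\<in>UNIV. mass (c h a)) = mass (weights sel M p c h)"
  by (subst sum.swap) (simp add: plan_sum)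

lemma weights_nonneg: "c \<in> plans sel M p \<Longrightarrow> nonneg (weights sel M p c h)"
  using plan_le_weights[of c sel M p h] plan_nonneg[of c sel M p h]
  by (intro nonnegI) (meson order_trans)

lemma mass_weights_nonneg: "c \<in> plans sel M p \<Longrightarrow> 0 \<le> mass (weights sel M p c h)"
  by (simp add: mass_nonneg weights_nonneg)

lemma mass_plan_nonneg: "c \<in> plans sel M p \<Longrightarrow> 0 \<le> mass (c h a)"
  by (simp add: sum_nonneg plan_nonneg)

lemma mass_weights_snoc:
  "stochastic M \<Longrightarrow> mass (weights sel M p c (h @ [e])) = mass (c h (sel e))"
  by (simp add: mass_step)

lemma weights_le_steps:
  assumes "stochastic M" "c \<in> plans sel M p"
  shows "weights sel M p c h k \<le> (step M ^^ length h) p k"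
proof (induction h arbitrary: k rule: rev_induct)
  case (snoc e h)
  have "step M (c h (sel e)) k \<le> step M ((step M ^^ length h) p) k"
    using assms(1)
  proof (rule step_mono)
    show "c h (sel e) k' \<le> (step M ^^ length h) p k'" for k'
      using plan_le_weights[OF assms(2)] snoc.IH by (rule order_trans)
  qed
  then show ?case by simp
qed simp

lemma plan_le_mass:
  assumes "stochastic M" "c \<in> plans sel M p" "nonneg p"
  shows "c h a k \<le> mass p"
proof -
  have "c h a k \<le> (step M ^^ length h) p k"
    using plan_le_weights[OF assms(2)] weights_le_steps[OF assms(1,2)] by (rule order_trans)
  also have "\<dots> \<le> mass ((step M ^^ length h) p)"
    using nonnegD[OF steps_nonneg[OF assms(1,3)]] by (intro member_le_sum) auto
  finally show ?thesis using mass_steps[OF assms(1)] by simp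
qed

lemma weights_add:
  "weights sel M (\<lambda>k. p k + p' k) (\<lambda>h a k. c h a k + c' h a k) h k
   = weights sel M p c h k + weights sel M p' c' h k"
  by (simp add: weights_def step_add)

lemma weights_scale:
  "weights sel M (\<lambda>k. s * p k) (\<lambda>h a k. s * c h a k) h k = s * weights sel M p c h k"
  by (simp add: weights_def step_scale)

lemma plans_add:
  "c \<in> plans sel M p \<Longrightarrow> c' \<in> plans sel M p' \<Longrightarrow>
   (\<lambda>h a k. c h a k + c' h a k) \<in> plans sel M (\<lambda>k. p k + p' k)"
  by (simp add: plans_def weights_add sum.distrib)

lemma plans_scale:
  "c \<in> plans sel M p \<Longrightarrow> 0 \<le> s \<Longrightarrow> (\<lambda>h a k. s * c h a k) \<in> plans sel M (\<lambda>k. s * p k)"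
  by (simp add: plans_def weights_scale sum_distrib_left[symmetric])

section \<open>Behaviour strategies\<close>

text \<open>
  The histories are reversed only to have a primitive recursion on their last step.
\<close>

primrec rev_weights ::
  "('e list \<Rightarrow> 's \<Rightarrow> 'a \<Rightarrow> real) \<Rightarrow> ('e \<Rightarrow> 'a) \<Rightarrow> ('s::finite \<Rightarrow> 's \<Rightarrow> real) \<Rightarrow> ('s \<Rightarrow> real) \<Rightarrow> 'e list \<Rightarrow> 's \<Rightarrow> real"
  where
  "rev_weights x sel M p [] = p"
| "rev_weights x sel M p (e # r) = step M (\<lambda>k. rev_weights x sel M p r k * x (rev r) k (sel e))"

definition realize ::
  "('e list \<Rightarrow> 's \<Rightarrow> 'a \<Rightarrow> real) \<Rightarrow> ('e \<Rightarrow> 'a) \<Rightarrow> ('s::finite \<Rightarrow> 's \<Rightarrow> real) \<Rightarrow> ('s \<Rightarrow> real) \<Rightarrow> ('e, 'a, 's) plan"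
  where
  "realize x sel M p = (\<lambda>h a k. rev_weights x sel M p (rev h) k * x h k a)"

lemma weights_realize: "weights sel M p (realize x sel M p) h = rev_weights x sel M p (rev h)"
  by (cases h rule: rev_cases) (simp_all add: realize_def)

lemma rev_weights_nonneg:
  assumes "stochastic M" "\<And>h k a. 0 \<le> x h k a" "nonneg p"
  shows "nonneg (rev_weights x sel M p r)"
proof (induction r)
  case (Cons e r)
  then have "nonneg (\<lambda>k. rev_weights x sel M p r k * x (rev r) k (sel e))"
    using assms(2) by (simp add: nonneg_def)
  then show ?case using step_nonneg[OF assms(1)] by simp
qed (simp add: assms)

lemma realize_in_plans:
  assumes "stochastic M" "\<And>h k a. 0 \<le> x h k a" "\<And>h k. (\<Sum>a\<in>UNIV. x h k a) = 1" "nonneg p"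
  shows "realize x sel M p \<in> plans sel M p"
  unfolding plans_def mem_Collect_eq weights_realize
  using assms rev_weights_nonneg[of M x p sel, THEN nonnegD]
  by (simp add: realize_def sum_distrib_left[symmetric])

lemma rev_weights_add:
  "rev_weights x sel M (\<lambda>k. p k + p' k) r k = rev_weights x sel M p r k + rev_weights x sel M p' r k"
  by (induction r arbitrary: k) (simp_all add: step_add[symmetric] ring_distribs)

lemma plan_eq_realize:
  assumes "\<And>h a k. c h a k = weights sel M p c h k * x h k a"
  shows "c = realize x sel M p"
proof -
  have "weights sel M p c h = rev_weights x sel M p (rev h)" for h
  proof (induction h rule: rev_induct)
    case (snoc e h)
    have "c h (sel e) = (\<lambda>k. weights sel M p c h k * x h k (sel e))" using assms by blast
    then show ?case using snoc by simp
  qed simp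
  then show ?thesis unfolding realize_def using assms by (intro ext) simp
qed

text \<open>
  Where the current weight is \<open>0\<close> any choice of actions realizes the plan; the uniform one is taken.
\<close>

definition behaviour ::
  "('e \<Rightarrow> 'a::finite) \<Rightarrow> ('s::finite \<Rightarrow> 's \<Rightarrow> real) \<Rightarrow> ('s \<Rightarrow> real) \<Rightarrow> ('e, 'a, 's) plan \<Rightarrow>
   'e list \<Rightarrow> 's \<Rightarrow> 'a \<Rightarrow> real" where
  "behaviour sel M p c h k a =
     (if weights sel M p c h k = 0 then 1 / real CARD('a) else c h a k / weights sel M p c h k)"

lemma behaviour:
  assumes "c \<in> plans sel M p"
  shows "0 \<le> behaviour sel M p c h k a" "(\<Sum>a\<in>UNIV. behaviour sel M p c h k a) = 1"
    "realize (behaviour sel M p c) sel M p = c"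
proof -
  show "0 \<le> behaviour sel M p c h k a"
    using weights_nonneg[OF assms, THEN nonnegD] plan_nonneg[OF assms] by (simp add: behaviour_def)
  show "(\<Sum>a\<in>UNIV. behaviour sel M p c h k a) = 1"
    using plan_sum[OF assms, of h k]
    by (cases "weights sel M p c h k = 0") (simp_all add: behaviour_def sum_divide_distrib[symmetric])
  show "realize (behaviour sel M p c) sel M p = c"
  proof (rule plan_eq_realize[symmetric])
    show "c h a k = weights sel M p c h k * behaviour sel M p c h k a" for h a k
      using plan_le_weights[OF assms, of h a k] plan_nonneg[OF assms, of h a k]
      by (simp add: behaviour_def)
  qed
qed

text \<open>
  A plan for the sum of two laws is played for each of them separately: the player behaves in the same
  way in each state and ignores which of the two laws has selected it. This makes the value Lipschitz, and
  it isolates a small part of a law in the merging argument.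
\<close>

lemma plan_split:
  assumes M: "stochastic M" and c: "c \<in> plans sel M (\<lambda>k. p k + p' k)"
    and p: "nonneg p" "nonneg p'"
  obtains c1 c2 where "c1 \<in> plans sel M p" "c2 \<in> plans sel M p'" "c = (\<lambda>h a k. c1 h a k + c2 h a k)"
proof
  let ?x = "behaviour sel M (\<lambda>k. p k + p' k) c"
  show "realize ?x sel M p \<in> plans sel M p" "realize ?x sel M p' \<in> plans sel M p'"
    by (intro realize_in_plans M behaviour(1,2)[OF c] p)+
  show "c = (\<lambda>h a k. realize ?x sel M p h a k + realize ?x sel M p' h a k)"
    using behaviour(3)[OF c]
    by (auto simp: realize_def rev_weights_add ring_distribs fun_eq_iff)
qed

lemma plans_nonempty:
  assumes "stochastic M" "nonneg p"
  shows "plans (sel :: 'e \<Rightarrow> 'a::finite) M p \<noteq> {}"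
  using realize_in_plans[of M "\<lambda>h k a. 1 / real CARD('a)" p sel] assms by auto

section \<open>Signals\<close>

text \<open>
  A player may choose his actions by a lottery \<open>s\<close> that is independent of his state. His state then evolves
  freely, and the history only rescales its law. The lottery may imitate the actions of somebody who has
  another state, which is how a player pretends to have another law.
\<close>

lemma signal_plan:
  assumes M: "stochastic M" and q: "nonneg q" and s: "\<And>h a. 0 \<le> s h a"
    and sum_s: "\<And>h. (\<Sum>a\<in>UNIV. s h a) = S h" and snoc: "\<And>h e. S (h @ [e]) = s h (sel e)"
  shows "(\<lambda>h a k. s h a * (step M ^^ length h) q k) \<in> plans sel M (\<lambda>k. S [] * q k)"
    and "weights sel M (\<lambda>k. S [] * q k) (\<lambda>h a k. s h a * (step M ^^ length h) q k) h = (\<lambda>k. S h * (step M ^^ length h) q k)"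
proof -
  let ?c = "\<lambda>h a k. s h a * (step M ^^ length h) q k"
  show w: "weights sel M (\<lambda>k. S [] * q k) ?c h = (\<lambda>k. S h * (step M ^^ length h) q k)" for h
    by (cases h rule: rev_cases) (auto simp: step_scale snoc)
  show "?c \<in> plans sel M (\<lambda>k. S [] * q k)"
    unfolding plans_def mem_Collect_eq w using s steps_nonneg[OF M q, THEN nonnegD]
    by (simp add: sum_distrib_right[symmetric] sum_s)
qed

lemma uniform_plan:
  fixes sel :: "'e \<Rightarrow> 'a::finite"
  assumes M: "stochastic M" and q: "nonneg q"
  obtains d where "d \<in> plans sel M q"
    "\<And>h. weights sel M q d h = (\<lambda>k. (1 / real CARD('a)) ^ length h * (step M ^^ length h) q k)"
proof -
  let ?s = "\<lambda>h :: 'e list. \<lambda>a :: 'a. (1 / real CARD('a)) ^ Suc (length h)"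
  let ?S = "\<lambda>h :: 'e list. (1 / real CARD('a)) ^ length h"
  have "(\<Sum>a\<in>UNIV. ?s h a) = ?S h" for h by simp
  then show ?thesis
    using signal_plan(1)[of M q ?s ?S sel] signal_plan(2)[of M q ?s ?S sel] that M q
    by (simp del: power_Suc)
qed

section \<open>Cutting and pasting plans\<close>

lemma weights_append:
  "weights sel M (weights sel M p c h0) (\<lambda>h. c (h0 @ h)) h = weights sel M p c (h0 @ h)"
  by (simp add: weights_def butlast_append)

lemma subplan: "c \<in> plans sel M p \<Longrightarrow> (\<lambda>h. c (h0 @ h)) \<in> plans sel M (weights sel M p c h0)"
  by (simp add: plans_def weights_append)

definition paste :: "nat \<Rightarrow> ('e, 'a, 's) plan \<Rightarrow> ('e list \<Rightarrow> ('e, 'a, 's) plan) \<Rightarrow> ('e, 'a, 's) plan" where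
  "paste n c c' h = (if length h < n then c h else c' (take n h) (drop n h))"

lemma weights_paste_short:
  assumes "length h \<le> n"
  shows "weights sel M p (paste n c c') h = weights sel M p c h"
  using assms by (cases h rule: rev_cases) (simp_all add: paste_def)

lemma weights_paste_long:
  assumes "n \<le> length h"
  shows "weights sel M p (paste n c c') h
    = weights sel M (weights sel M p c (take n h)) (c' (take n h)) (drop n h)"
proof (cases "length h = n")
  case True
  then show ?thesis by (simp add: weights_paste_short)
next
  case False
  then have "h \<noteq> []" using assms by auto
  then obtain h' e where h: "h = h' @ [e]" by (cases h rule: rev_cases) auto
  then have n: "n \<le> length h'" using assms False by simp
  then have "paste n c c' h' = c' (take n h') (drop n h')" by (simp add: paste_def)
  then show ?thesis unfolding h using n by simp
qed

lemma paste_in_plans: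
  assumes "c \<in> plans sel M p" "\<And>h. length h = n \<Longrightarrow> c' h \<in> plans sel M (weights sel M p c h)"
  shows "paste n c c' \<in> plans sel M p"
proof -
  have "0 \<le> paste n c c' h a k \<and> (\<Sum>a\<in>UNIV. paste n c c' h a k) = weights sel M p (paste n c c') h k"
    for h a k
  proof (cases "length h < n")
    case True
    then have "weights sel M p (paste n c c') h = weights sel M p c h"
      by (simp add: weights_paste_short)
    then show ?thesis
      using True plan_sum[OF assms(1)] plan_nonneg[OF assms(1)] by (simp add: paste_def)
  next
    case False
    then have "length (take n h) = n" by simp
    note c' = assms(2)[OF this]
    show ?thesis
      using False plan_sum[OF c'] plan_nonneg[OF c'] by (simp add: weights_paste_long paste_def)
  qed
  then show ?thesis by (simp add: plans_def)
qed

section \<open>Compactness\<close>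

lemma compact_functions:
  assumes "compact S"
  shows "compact {f :: 'a \<Rightarrow> 'b::topological_space. \<forall>x. f x \<in> S}"
proof -
  have "compactin (product_topology (\<lambda>_. euclidean) UNIV) (PiE (UNIV :: 'a set) (\<lambda>_. S))"
    using assms by (simp add: compactin_PiE)
  moreover have "PiE (UNIV :: 'a set) (\<lambda>_. S) = {f. \<forall>x. f x \<in> S}" by (auto simp: PiE_def)
  ultimately show ?thesis by (simp add: euclidean_product_topology)
qed

lemma continuous_on_plan: "continuous_on S (\<lambda>c :: ('e, 'a, 's) plan. c h a k)"
proof -
  have "continuous_on S (\<lambda>c :: ('e, 'a, 's) plan. c h)"
    by (rule continuous_on_subset[OF continuous_on_product_coordinates subset_UNIV])
  then have "continuous_on S (\<lambda>c :: ('e, 'a, 's) plan. c h a)"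
    by (rule continuous_on_product_then_coordinatewise)
  then show ?thesis
    by (rule continuous_on_product_then_coordinatewise)
qed

lemma continuous_on_weights:
  "continuous_on S (\<lambda>c :: ('e, 'a, 's::finite) plan. weights sel M p c h k)"
proof (cases h rule: rev_cases)
  case (snoc h' e)
  have "continuous_on S (\<lambda>c :: ('e, 'a, 's) plan. \<Sum>k'\<in>UNIV. c h' (sel e) k' * M k' k)"
    by (rule continuous_on_sum, rule continuous_on_mult, rule continuous_on_plan, rule continuous_on_const)
  then show ?thesis by (simp add: snoc step_def)
qed simp

text \<open>
  The plans form a closed subset of a product of intervals. The topology is that of pointwise convergence.
\<close>

lemma compact_plans:
  fixes sel :: "'e \<Rightarrow> 'a::finite" and M :: "'s::finite \<Rightarrow> 's \<Rightarrow> real"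
  assumes "stochastic M" "nonneg p"
  shows "compact (plans sel M p)"
proof -
  let ?B = "{c :: ('e, 'a, 's) plan. \<forall>h. c h \<in> {x. \<forall>a. x a \<in> {y. \<forall>k. y k \<in> {0..mass p}}}}"
  have sub: "plans sel M p \<subseteq> ?B"
  proof
    fix c assume "c \<in> plans sel M p"
    then show "c \<in> ?B"
      using plan_le_mass[OF assms(1) _ assms(2), of c sel] plan_nonneg[of c sel M p]
      by (simp only: mem_Collect_eq atLeastAtMost_iff) blast
  qed
  have "compact {y :: 's \<Rightarrow> real. \<forall>k. y k \<in> {0..mass p}}"
    by (rule compact_functions, rule compact_Icc)
  from compact_functions[OF compact_functions[OF this]]
  have B: "compact ?B" by (simp only: mem_Collect_eq)
  have pos: "closed {c :: ('e, 'a, 's) plan. 0 \<le> c h a k}" for h a k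
    by (rule closed_Collect_le, rule continuous_on_const, rule continuous_on_plan)
  have sum: "closed {c :: ('e, 'a, 's) plan. (\<Sum>a\<in>UNIV. c h a k) = weights sel M p c h k}" for h k
    by (rule closed_Collect_eq, rule continuous_on_sum, rule continuous_on_plan, rule continuous_on_weights)
  have closed: "closed (plans sel M p)"
    unfolding plans_def
    by (rule closed_Collect_conj; (rule closed_Collect_all)+; rule pos sum)
  have "?B \<inter> plans sel M p = plans sel M p" using sub by (rule Int_absorb1)
  then show ?thesis
    using compact_Int_closed[OF B closed] by (simp only:)
qed

section \<open>Values of the games between plans\<close>

locale game =
  fixes sel1 :: "'e::finite \<Rightarrow> 'a::finite" and sel2 :: "'e \<Rightarrow> 'b::finite"
    and M :: "'k::finite \<Rightarrow> 'k \<Rightarrow> real" and N :: "'l::finite \<Rightarrow> 'l \<Rightarrow> real"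
    and g :: "'k \<Rightarrow> 'l \<Rightarrow> 'e \<Rightarrow> real"
  assumes sel: "bij (\<lambda>e. (sel1 e, sel2 e))"
    and M: "stochastic M" and N: "stochastic N"
    and g_bound: "\<bar>g k l e\<bar> \<le> 1"
begin

abbreviation "A \<equiv> plans sel1 M"
abbreviation "B \<equiv> plans sel2 N"
abbreviation "wA \<equiv> weights sel1 M"
abbreviation "wB \<equiv> weights sel2 N"

definition stage :: "('e, 'a, 'k) plan \<Rightarrow> ('e, 'b, 'l) plan \<Rightarrow> 'e list \<Rightarrow> real" where
  "stage c d h = (\<Sum>e\<in>UNIV. \<Sum>k\<in>UNIV. \<Sum>l\<in>UNIV. c h (sel1 e) k * d h (sel2 e) l * g k l e)"

definition total :: "nat \<Rightarrow> ('e, 'a, 'k) plan \<Rightarrow> ('e, 'b, 'l) plan \<Rightarrow> real" where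
  "total n c d = (\<Sum>t<n. \<Sum>h\<in>hist t. stage c d h)"

lemma sum_sel: "(\<Sum>e\<in>UNIV. F (sel1 e) (sel2 e)) = (\<Sum>a\<in>UNIV. \<Sum>b\<in>UNIV. F a b)"
proof -
  have "(\<Sum>e\<in>UNIV. F (sel1 e) (sel2 e)) = (\<Sum>e\<in>UNIV. (\<lambda>(a, b). F a b) (sel1 e, sel2 e))" by simp
  also have "\<dots> = (\<Sum>ab\<in>UNIV. (\<lambda>(a, b). F a b) ab)"
    using sel by (rule sum.reindex_bij_betw)
  also have "\<dots> = (\<Sum>a\<in>UNIV. \<Sum>b\<in>UNIV. F a b)"
    by (simp add: sum.cartesian_product)
  finally show ?thesis .
qed

text \<open>
  Weighting the histories by what the opponent contributes to their probability, one recovers the law of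
  the state without any observation: posteriors average to the prior, moved by the chain.
\<close>

lemma sum_weights_state:
  assumes "c \<in> A p" "d \<in> B q"
  shows "(\<Sum>h\<in>hist t. wA p c h k * mass (wB q d h)) = (step M ^^ t) p k * mass q"
proof (induction t arbitrary: k)
  case (Suc t)
  have "(\<Sum>e\<in>UNIV. wA p c (h @ [e]) k * mass (wB q d (h @ [e]))) = step M (\<lambda>k. wA p c h k * mass (wB q d h)) k" for h
  proof -
    have "(\<Sum>e\<in>UNIV. wA p c (h @ [e]) k * mass (wB q d (h @ [e])))
        = (\<Sum>e\<in>UNIV. step M (c h (sel1 e)) k * mass (d h (sel2 e)))"
      by (simp add: mass_step[OF N])
    also have "\<dots> = (\<Sum>a\<in>UNIV. \<Sum>b\<in>UNIV. step M (c h a) k * mass (d h b))"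
      by (rule sum_sel)
    also have "\<dots> = (\<Sum>a\<in>UNIV. step M (c h a) k) * (\<Sum>b\<in>UNIV. mass (d h b))"
      by (simp add: sum_product)
    also have "(\<Sum>a\<in>UNIV. step M (c h a) k) = step M (wA p c h) k"
      by (simp add: step_sum[symmetric] plan_sum[OF assms(1)])
    also have "(\<Sum>b\<in>UNIV. mass (d h b)) = mass (wB q d h)"
      by (rule plan_mass[OF assms(2)])
    finally show ?thesis by (simp add: step_scale[symmetric] mult.commute)
  qed
  then have "(\<Sum>h\<in>hist (Suc t). wA p c h k * mass (wB q d h))
      = (\<Sum>h\<in>hist t. step M (\<lambda>k. wA p c h k * mass (wB q d h)) k)"
    by (simp only: sum_hist_Suc)
  also have "\<dots> = step M (\<lambda>k. (step M ^^ t) p k * mass q) k"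
    by (simp only: step_sum[symmetric] Suc.IH)
  also have "\<dots> = (step M ^^ Suc t) p k * mass q"
    by (simp add: step_scale[symmetric] mult.commute)
  finally show ?case .
qed simp

lemma sum_weights_mass:
  assumes "c \<in> A p" "d \<in> B q"
  shows "(\<Sum>h\<in>hist t. mass (wA p c h) * mass (wB q d h)) = mass p * mass q"
proof -
  have "(\<Sum>h\<in>hist t. mass (wA p c h) * mass (wB q d h))
      = (\<Sum>k\<in>UNIV. \<Sum>h\<in>hist t. wA p c h k * mass (wB q d h))"
    by (subst sum.swap) (simp add: sum_distrib_right)
  also have "\<dots> = mass ((step M ^^ t) p) * mass q"
    by (simp add: sum_weights_state[OF assms] sum_distrib_right)
  finally show ?thesis by (simp add: mass_steps[OF M])
qed

lemma stage_bound:
  assumes c: "c \<in> A p" and d: "d \<in> B q"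
  shows "\<bar>stage c d h\<bar> \<le> mass (wA p c h) * mass (wB q d h)"
proof -
  have "\<bar>stage c d h\<bar> \<le> (\<Sum>e\<in>UNIV. \<Sum>k\<in>UNIV. \<Sum>l\<in>UNIV. c h (sel1 e) k * d h (sel2 e) l)"
    unfolding stage_def
  proof (intro order_trans[OF sum_abs] sum_mono)
    fix e k l
    have nn: "0 \<le> c h (sel1 e) k * d h (sel2 e) l"
      using plan_nonneg[OF c] plan_nonneg[OF d] by simp
    have "\<bar>c h (sel1 e) k * d h (sel2 e) l * g k l e\<bar> = c h (sel1 e) k * d h (sel2 e) l * \<bar>g k l e\<bar>"
      using nn by (simp add: abs_mult plan_nonneg[OF c] plan_nonneg[OF d])
    also have "\<dots> \<le> c h (sel1 e) k * d h (sel2 e) l * 1"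
      using nn g_bound by (rule mult_left_mono[rotated])
    finally show "\<bar>c h (sel1 e) k * d h (sel2 e) l * g k l e\<bar> \<le> c h (sel1 e) k * d h (sel2 e) l"
      by simp
  qed
  also have "\<dots> = (\<Sum>e\<in>UNIV. mass (c h (sel1 e)) * mass (d h (sel2 e)))"
    by (simp add: sum_product)
  also have "\<dots> = (\<Sum>a\<in>UNIV. \<Sum>b\<in>UNIV. mass (c h a) * mass (d h b))"
    by (rule sum_sel)
  also have "\<dots> = mass (wA p c h) * mass (wB q d h)"
    by (simp add: plan_mass[OF c, symmetric] plan_mass[OF d, symmetric] sum_product)
  finally show ?thesis .
qed

lemma total_bound:
  assumes "c \<in> A p" "d \<in> B q"
  shows "\<bar>total n c d\<bar> \<le> real n * mass p * mass q"
proof -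
  have "\<bar>total n c d\<bar> \<le> (\<Sum>t<n. \<Sum>h\<in>hist t. mass (wA p c h) * mass (wB q d h))"
    unfolding total_def
    by (intro order_trans[OF sum_abs] sum_mono stage_bound assms)
  then show ?thesis by (simp add: sum_weights_mass[OF assms] mult.assoc)
qed

lemma total_add_left: "total n (\<lambda>h a k. c h a k + c' h a k) d = total n c d + total n c' d"
  by (simp add: total_def stage_def sum.distrib ring_distribs)

lemma total_add_right: "total n c (\<lambda>h a k. d h a k + d' h a k) = total n c d + total n c d'"
  by (simp add: total_def stage_def sum.distrib ring_distribs)

lemma total_scale_left: "total n (\<lambda>h a k. s * c h a k) d = s * total n c d"
  by (simp add: total_def stage_def sum_distrib_left mult.assoc)

lemma total_scale_right: "total n c (\<lambda>h a k. s * d h a k) = s * total n c d"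
  by (simp add: total_def stage_def sum_distrib_left mult_ac)

lemma total_append:
  "total (n + m) c d = total n c d + (\<Sum>h\<in>hist n. total m (\<lambda>h'. c (h @ h')) (\<lambda>h'. d (h @ h')))"
proof -
  have "total (n + m) c d = total n c d + (\<Sum>t<m. \<Sum>h\<in>hist (n + t). stage c d h)"
    unfolding total_def by (induction m) (simp_all add: add.assoc)
  also have "(\<Sum>t<m. \<Sum>h\<in>hist (n + t). stage c d h)
      = (\<Sum>t<m. \<Sum>h\<in>hist n. \<Sum>h'\<in>hist t. stage (\<lambda>h'. c (h @ h')) (\<lambda>h'. d (h @ h')) h')"
    by (simp add: sum_hist_append stage_def)
  also have "\<dots> = (\<Sum>h\<in>hist n. total m (\<lambda>h'. c (h @ h')) (\<lambda>h'. d (h @ h')))"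
    unfolding total_def by (rule sum.swap)
  finally show ?thesis .
qed

lemma total_cong:
  assumes "\<And>h. length h < n \<Longrightarrow> c h = c' h" "\<And>h. length h < n \<Longrightarrow> d h = d' h"
  shows "total n c d = total n c' d'"
  unfolding total_def stage_def
  using assms by (intro sum.cong refl) (simp add: hist_length)

lemma tendsto_total:
  assumes "\<And>h a k. (\<lambda>i. c i h a k) \<longlonglongrightarrow> c' h a k" "\<And>h b l. (\<lambda>i. d i h b l) \<longlonglongrightarrow> d' h b l"
  shows "(\<lambda>i. total n (c i) (d i)) \<longlonglongrightarrow> total n c' d'"
  unfolding total_def stage_def
  by (intro tendsto_sum tendsto_mult assms tendsto_const)

lemma continuous_on_total_left: "continuous_on S (\<lambda>c. total n c d)"
  unfolding total_def stage_def
  by (rule continuous_on_sum continuous_on_mult continuous_on_const continuous_on_plan)+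

lemma continuous_on_total_right: "continuous_on S (\<lambda>d. total n c d)"
  unfolding total_def stage_def
  by (rule continuous_on_sum continuous_on_mult continuous_on_const continuous_on_plan)+

text \<open>
  Exchanging the players and the sign of the payoff gives a game of the same kind, so each fact about
  Player 2 is the corresponding fact about Player 1.
\<close>

lemma swap: "game sel2 sel1 N M (\<lambda>l k e. - g k l e)"
proof
  have "bij ((\<lambda>(a, b). (b, a)) \<circ> (\<lambda>e. (sel1 e, sel2 e)))"
    using sel by (rule bij_comp) (rule bij_betw_byWitness[where f' = "\<lambda>(a, b). (b, a)"], auto)
  then show "bij (\<lambda>e. (sel2 e, sel1 e))" by (simp add: o_def)
qed (use M N g_bound in auto)

lemma total_swap: "game.total sel2 sel1 (\<lambda>l k e. - g k l e) n d c = - total n c d"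
proof -
  interpret sw: game sel2 sel1 N M "\<lambda>l k e. - g k l e" by (rule swap)
  have "sw.stage d c h = - stage c d h" for h
  proof -
    have "sw.stage d c h = (\<Sum>e\<in>UNIV. \<Sum>k\<in>UNIV. \<Sum>l\<in>UNIV. d h (sel2 e) l * c h (sel1 e) k * - g k l e)"
      unfolding sw.stage_def by (intro sum.cong refl sum.swap)
    then show ?thesis by (simp add: stage_def sum_negf mult.commute)
  qed
  then show ?thesis by (simp add: sw.total_def total_def sum_negf)
qed

lemma saddle_point:
  assumes p: "nonneg p" and q: "nonneg q"
  shows "\<exists>c\<in>A p. \<exists>d\<in>B q. (\<forall>c'\<in>A p. total n c' d \<le> total n c d) \<and> (\<forall>d'\<in>B q. total n c d \<le> total n c d')"
proof (rule saddle_point_exists)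
  show "compact (A p)" "A p \<noteq> {}" using M p by (rule compact_plans plans_nonempty)+
  show "compact (B q)" "B q \<noteq> {}" using N q by (rule compact_plans plans_nonempty)+
  show "affinelike (A p) (B q) (total n)"
    unfolding affinelike_def
  proof (intro ballI)
    fix c c' u assume c: "c \<in> A p" "c' \<in> A p" and u: "u \<in> {0..1::real}"
    let ?z = "\<lambda>h a k. u * c h a k + (1 - u) * c' h a k"
    have "?z \<in> A (\<lambda>k. u * p k + (1 - u) * p k)"
      using c u by (intro plans_add plans_scale) auto
    moreover have "(\<lambda>k. u * p k + (1 - u) * p k) = p" by (simp add: algebra_simps)
    ultimately show "\<exists>z\<in>A p. \<forall>d\<in>B q. total n z d = u * total n c d + (1 - u) * total n c' d"
      by (intro bexI[of _ ?z]) (simp_all add: total_add_left total_scale_left)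
  qed
  show "affinelike (B q) (A p) (\<lambda>d c. total n c d)"
    unfolding affinelike_def
  proof (intro ballI)
    fix d d' u assume d: "d \<in> B q" "d' \<in> B q" and u: "u \<in> {0..1::real}"
    let ?z = "\<lambda>h a k. u * d h a k + (1 - u) * d' h a k"
    have "?z \<in> B (\<lambda>k. u * q k + (1 - u) * q k)"
      using d u by (intro plans_add plans_scale) auto
    moreover have "(\<lambda>k. u * q k + (1 - u) * q k) = q" by (simp add: algebra_simps)
    ultimately show "\<exists>z\<in>B q. \<forall>c\<in>A p. total n c z = u * total n c d + (1 - u) * total n c d'"
      by (intro bexI[of _ ?z]) (simp_all add: total_add_right total_scale_right)
  qed
qed (rule continuous_on_total_left continuous_on_total_right)+

text \<open>
  A number that both players can guarantee is unique, and one exists by \<open>saddle_point\<close>.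
\<close>

definition val :: "nat \<Rightarrow> ('k \<Rightarrow> real) \<Rightarrow> ('l \<Rightarrow> real) \<Rightarrow> real" where
  "val n p q = (SOME v. (\<exists>c\<in>A p. \<forall>d\<in>B q. v \<le> total n c d) \<and> (\<exists>d\<in>B q. \<forall>c\<in>A p. total n c d \<le> v))"

lemma val_props:
  assumes "nonneg p" "nonneg q"
  shows "(\<exists>c\<in>A p. \<forall>d\<in>B q. val n p q \<le> total n c d) \<and> (\<exists>d\<in>B q. \<forall>c\<in>A p. total n c d \<le> val n p q)"
proof -
  obtain c d where "c \<in> A p" "d \<in> B q" "\<forall>c'\<in>A p. total n c' d \<le> total n c d"
    "\<forall>d'\<in>B q. total n c d \<le> total n c d'"
    using saddle_point[where n = n, OF assms] by blast
  then have "\<exists>v. (\<exists>c\<in>A p. \<forall>d\<in>B q. v \<le> total n c d) \<and> (\<exists>d\<in>B q. \<forall>c\<in>A p. total n c d \<le> v)"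
    by (intro exI[of _ "total n c d"]) blast
  then show ?thesis unfolding val_def by (rule someI_ex)
qed

lemma optimal1:
  assumes "nonneg p" "nonneg q"
  obtains c where "c \<in> A p" "\<And>d. d \<in> B q \<Longrightarrow> val n p q \<le> total n c d"
  using val_props[where n = n, OF assms] by blast

lemma optimal2:
  assumes "nonneg p" "nonneg q"
  obtains d where "d \<in> B q" "\<And>c. c \<in> A p \<Longrightarrow> total n c d \<le> val n p q"
  using val_props[where n = n, OF assms] by blast

lemma val_leI:
  assumes "nonneg p" "nonneg q" "d \<in> B q" "\<And>c. c \<in> A p \<Longrightarrow> total n c d \<le> s"
  shows "val n p q \<le> s"
proof -
  obtain c where c: "c \<in> A p" "\<And>d. d \<in> B q \<Longrightarrow> val n p q \<le> total n c d"
    using optimal1[where n = n, OF assms(1,2)] by blast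
  then show ?thesis using c(2)[OF assms(3)] assms(4)[OF c(1)] by linarith
qed

lemma val_geI:
  assumes "nonneg p" "nonneg q" "c \<in> A p" "\<And>d. d \<in> B q \<Longrightarrow> s \<le> total n c d"
  shows "s \<le> val n p q"
proof -
  obtain d where d: "d \<in> B q" "\<And>c. c \<in> A p \<Longrightarrow> total n c d \<le> val n p q"
    using optimal2[where n = n, OF assms(1,2)] by blast
  then show ?thesis using d(2)[OF assms(3)] assms(4)[OF d(1)] by linarith
qed

lemma val_swap:
  assumes "nonneg p" "nonneg q"
  shows "game.val sel2 sel1 N M (\<lambda>l k e. - g k l e) n q p = - val n p q"
proof -
  interpret sw: game sel2 sel1 N M "\<lambda>l k e. - g k l e" by (rule swap)
  show ?thesis
  proof (rule antisym)
    obtain c where c: "c \<in> A p" "\<And>d. d \<in> B q \<Longrightarrow> val n p q \<le> total n c d"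
      using optimal1[where n = "n", OF assms] by blast
    show "sw.val n q p \<le> - val n p q"
      by (rule sw.val_leI[OF assms(2,1) c(1)]) (simp add: total_swap c(2))
    obtain d where d: "d \<in> B q" "\<And>c. c \<in> A p \<Longrightarrow> total n c d \<le> val n p q"
      using optimal2[where n = "n", OF assms] by blast
    show "- val n p q \<le> sw.val n q p"
      by (rule sw.val_geI[OF assms(2,1) d(1)]) (simp add: total_swap d(2))
  qed
qed

lemma val_bound:
  assumes "nonneg p" "nonneg q"
  shows "\<bar>val n p q\<bar> \<le> real n * mass p * mass q"
proof -
  obtain c where c: "c \<in> A p" "\<And>d. d \<in> B q \<Longrightarrow> val n p q \<le> total n c d"
    using optimal1[where n = "n", OF assms] by blast
  obtain d where d: "d \<in> B q" "\<And>c. c \<in> A p \<Longrightarrow> total n c d \<le> val n p q"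
    using optimal2[where n = "n", OF assms] by blast
  show ?thesis using c(2)[OF d(1)] d(2)[OF c(1)] total_bound[where n = n, OF c(1) d(1)] by linarith
qed

lemma val_scale_left:
  assumes p: "nonneg p" and q: "nonneg q" and s: "0 \<le> s"
  shows "val n (\<lambda>k. s * p k) q = s * val n p q"
proof -
  have ge: "s * val n p q \<le> val n (\<lambda>k. s * p k) q" if p: "nonneg p" and s: "0 \<le> s" for p s
  proof -
    obtain c where c: "c \<in> A p" "\<And>d. d \<in> B q \<Longrightarrow> val n p q \<le> total n c d"
      using optimal1[where n = n, OF p q] by blast
    show ?thesis
      using c s
      by (intro val_geI[OF nonneg_scale[OF s p] q plans_scale[OF c(1) s]]) (simp add: total_scale_left mult_left_mono)
  qed
  show ?thesis
  proof (cases "s = 0")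
    case True
    then show ?thesis using val_bound[of "\<lambda>k. 0" q n] q by simp
  next
    case False
    then have "0 < s" using s by simp
    then have "(1 / s) * val n (\<lambda>k. s * p k) q \<le> val n p q"
      using ge[of "\<lambda>k. s * p k" "1 / s"] nonneg_scale[OF s p] by simp
    then have "val n (\<lambda>k. s * p k) q \<le> s * val n p q"
      using \<open>0 < s\<close> by (simp add: field_simps)
    then show ?thesis using ge[of p s] p s by simp
  qed
qed

text \<open>
  Plans for the two parts add up to a plan for the sum. With homogeneity this is concavity in \<open>p\<close>:
  Player 1 does not gain if information about his own state is made public.
\<close>

lemma val_superadd:
  assumes p: "nonneg p" "nonneg p'" and q: "nonneg q"
  shows "val n p q + val n p' q \<le> val n (\<lambda>k. p k + p' k) q"
proof -
  obtain c where c: "c \<in> A p" "\<And>d. d \<in> B q \<Longrightarrow> val n p q \<le> total n c d"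
    using optimal1[where n = "n", OF p(1) q] by blast
  obtain c' where c': "c' \<in> A p'" "\<And>d. d \<in> B q \<Longrightarrow> val n p' q \<le> total n c' d"
    using optimal1[where n = "n", OF p(2) q] by blast
  show ?thesis
  proof (rule val_geI[OF _ q plans_add[OF c(1) c'(1)]])
    show "val n p q + val n p' q \<le> total n (\<lambda>h a k. c h a k + c' h a k) d" if "d \<in> B q" for d
      using c(2)[OF that] c'(2)[OF that] by (simp add: total_add_left)
  qed (rule nonneg_add[OF p])
qed

lemma val_sum_left:
  assumes "finite X" "\<And>x. x \<in> X \<Longrightarrow> nonneg (f x)" and q: "nonneg q"
  shows "(\<Sum>x\<in>X. val n (f x) q) \<le> val n (\<lambda>k. \<Sum>x\<in>X. f x k) q"
  using assms(1,2)
proof (induction X rule: finite_induct)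
  case empty
  then show ?case using val_bound[of "\<lambda>k. 0" q n] q by simp
next
  case (insert x X)
  have *: "nonneg (\<lambda>k. \<Sum>x\<in>X. f x k)"
    by (rule nonneg_sum) (simp add: insert.prems)
  have "val n (f x) q + val n (\<lambda>k. \<Sum>x\<in>X. f x k) q \<le> val n (\<lambda>k. f x k + (\<Sum>x\<in>X. f x k)) q"
    using insert.prems by (intro val_superadd * q) simp
  then show ?case using insert by simp
qed

lemma val_add_bound_left:
  assumes p: "nonneg p" "nonneg r" and q: "nonneg q"
  shows "\<bar>val n (\<lambda>k. p k + r k) q - val n p q\<bar> \<le> real n * mass r * mass q"
proof -
  have "val n p q - real n * mass r * mass q \<le> val n (\<lambda>k. p k + r k) q"
    using val_superadd[where n = n, OF p q] val_bound[where n = n, OF p(2) q] by linarith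
  moreover have "val n (\<lambda>k. p k + r k) q \<le> val n p q + real n * mass r * mass q"
  proof -
    obtain d where d: "d \<in> B q" "\<And>c. c \<in> A p \<Longrightarrow> total n c d \<le> val n p q"
      using optimal2[where n = "n", OF p(1) q] by blast
    show ?thesis
    proof (rule val_leI[OF _ q d(1)])
      fix c assume "c \<in> A (\<lambda>k. p k + r k)"
      then obtain c1 c2 where c: "c1 \<in> A p" "c2 \<in> A r" "c = (\<lambda>h a k. c1 h a k + c2 h a k)"
        using plan_split[OF M _ p] by blast
      have "total n c d = total n c1 d + total n c2 d" unfolding c(3) by (rule total_add_left)
      also have "\<dots> \<le> val n p q + real n * mass r * mass q"
        using d(2)[OF c(1)] total_bound[where n = n, OF c(2) d(1)] by linarith
      finally show "total n c d \<le> val n p q + real n * mass r * mass q" .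
    qed (rule nonneg_add[OF p])
  qed
  ultimately show ?thesis by linarith
qed

lemma val_lipschitz_left:
  assumes p: "nonneg p" "nonneg p'" and q: "nonneg q"
  shows "\<bar>val n p q - val n p' q\<bar> \<le> real n * (\<Sum>k\<in>UNIV. \<bar>p k - p' k\<bar>) * mass q"
proof -
  let ?m = "\<lambda>k. min (p k) (p' k)"
  have "\<bar>val n (\<lambda>k. ?m k + (p k - ?m k)) q - val n ?m q\<bar> \<le> real n * (\<Sum>k\<in>UNIV. p k - ?m k) * mass q"
    by (rule val_add_bound_left) (use p q in \<open>auto simp: nonneg_def\<close>)
  moreover have "\<bar>val n (\<lambda>k. ?m k + (p' k - ?m k)) q - val n ?m q\<bar> \<le> real n * (\<Sum>k\<in>UNIV. p' k - ?m k) * mass q"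
    by (rule val_add_bound_left) (use p q in \<open>auto simp: nonneg_def\<close>)
  ultimately have "\<bar>val n p q - val n p' q\<bar>
      \<le> real n * (\<Sum>k\<in>UNIV. p k - ?m k) * mass q + real n * (\<Sum>k\<in>UNIV. p' k - ?m k) * mass q"
    by simp
  also have "\<dots> = real n * (\<Sum>k\<in>UNIV. (p k - ?m k) + (p' k - ?m k)) * mass q"
    by (simp only: sum.distrib ring_distribs)
  also have "(\<lambda>k. (p k - ?m k) + (p' k - ?m k)) = (\<lambda>k. \<bar>p k - p' k\<bar>)"
    by (auto simp: fun_eq_iff)
  finally show ?thesis .
qed

text \<open>
  An optimal plan \<open>c\<close> for \<open>n + m\<close> stages: after \<open>n\<close> stages Player 2 may switch to an optimal plan of the game
  of length \<open>m\<close> that starts at the current pair of weights.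
\<close>

lemma val_block1:
  assumes p: "nonneg p" and q: "nonneg q"
  obtains c where "c \<in> A p"
    "\<And>d. d \<in> B q \<Longrightarrow> val (n + m) p q \<le> total n c d + (\<Sum>h\<in>hist n. val m (wA p c h) (wB q d h))"
proof -
  obtain c where c: "c \<in> A p" "\<And>d. d \<in> B q \<Longrightarrow> val (n + m) p q \<le> total (n + m) c d"
    using optimal1[where n = "n + m", OF p q] by blast
  have "val (n + m) p q \<le> total n c d + (\<Sum>h\<in>hist n. val m (wA p c h) (wB q d h))" if d: "d \<in> B q" for d
  proof -
    have "\<forall>h. \<exists>d'. d' \<in> B (wB q d h) \<and> (\<forall>c'\<in>A (wA p c h). total m c' d' \<le> val m (wA p c h) (wB q d h))"
    proof
      fix h
      obtain d' where "d' \<in> B (wB q d h)" "\<And>c'. c' \<in> A (wA p c h) \<Longrightarrow> total m c' d' \<le> val m (wA p c h) (wB q d h)"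
        using optimal2[where n = m, OF weights_nonneg[OF c(1)] weights_nonneg[OF d]] by blast
      then show "\<exists>d'. d' \<in> B (wB q d h) \<and> (\<forall>c'\<in>A (wA p c h). total m c' d' \<le> val m (wA p c h) (wB q d h))"
        by blast
    qed
    from choice[OF this] obtain D where D: "\<And>h. D h \<in> B (wB q d h)"
      "\<And>h c'. c' \<in> A (wA p c h) \<Longrightarrow> total m c' (D h) \<le> val m (wA p c h) (wB q d h)" by blast
    let ?d = "paste n d D"
    have "?d \<in> B q" using d D(1) by (intro paste_in_plans)
    then have "val (n + m) p q \<le> total (n + m) c ?d" by (rule c(2))
    also have "\<dots> = total n c ?d + (\<Sum>h\<in>hist n. total m (\<lambda>h'. c (h @ h')) (\<lambda>h'. ?d (h @ h')))"
      by (rule total_append)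
    also have "total n c ?d = total n c d"
      by (rule total_cong) (simp_all add: paste_def)
    also have "(\<Sum>h\<in>hist n. total m (\<lambda>h'. c (h @ h')) (\<lambda>h'. ?d (h @ h')))
        = (\<Sum>h\<in>hist n. total m (\<lambda>h'. c (h @ h')) (D h))"
      by (intro sum.cong refl) (simp add: paste_def hist_length)
    also have "\<dots> \<le> (\<Sum>h\<in>hist n. val m (wA p c h) (wB q d h))"
      by (intro sum_mono D(2) subplan c(1))
    finally show ?thesis by simp
  qed
  then show ?thesis using that c(1) by blast
qed

lemma val_block2:
  assumes p: "nonneg p" and q: "nonneg q"
  obtains d where "d \<in> B q"
    "\<And>c. c \<in> A p \<Longrightarrow> total n c d + (\<Sum>h\<in>hist n. val m (wA p c h) (wB q d h)) \<le> val (n + m) p q"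
proof -
  interpret sw: game sel2 sel1 N M "\<lambda>l k e. - g k l e" by (rule swap)
  obtain d where d: "d \<in> B q" "\<And>c. c \<in> A p \<Longrightarrow>
      sw.val (n + m) q p \<le> sw.total n d c + (\<Sum>h\<in>hist n. sw.val m (wB q d h) (wA p c h))"
    using sw.val_block1[where n = n and m = m, OF q p] by blast
  show ?thesis
  proof (rule that[OF d(1)])
    fix c assume c: "c \<in> A p"
    have "sw.val m (wB q d h) (wA p c h) = - val m (wA p c h) (wB q d h)" for h
      by (rule val_swap[OF weights_nonneg[OF c] weights_nonneg[OF d(1)]])
    then show "total n c d + (\<Sum>h\<in>hist n. val m (wA p c h) (wB q d h)) \<le> val (n + m) p q"
      using d(2)[OF c] by (simp add: val_swap[OF p q] total_swap sum_negf)
  qed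
qed

lemma val_scale_right:
  assumes p: "nonneg p" and q: "nonneg q" and s: "0 \<le> s"
  shows "val n p (\<lambda>l. s * q l) = s * val n p q"
proof -
  interpret sw: game sel2 sel1 N M "\<lambda>l k e. - g k l e" by (rule swap)
  show ?thesis
    using sw.val_scale_left[where n = n, OF q p s] val_swap[where n = n, OF p q] val_swap[where n = n, OF p nonneg_scale[OF s q]]
    by simp
qed

lemma val_lipschitz_right:
  assumes p: "nonneg p" and q: "nonneg q" "nonneg q'"
  shows "\<bar>val n p q - val n p q'\<bar> \<le> real n * (\<Sum>l\<in>UNIV. \<bar>q l - q' l\<bar>) * mass p"
proof -
  interpret sw: game sel2 sel1 N M "\<lambda>l k e. - g k l e" by (rule swap)
  show ?thesis
    using sw.val_lipschitz_left[where n = n, OF q p] val_swap[where n = n, OF p q(1)] val_swap[where n = n, OF p q(2)]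
    by simp
qed

text \<open>
  If the continuation uses the same law \<open>z\<close> of Player 2 after every history, then whatever Player 1 has
  revealed during the block can only have hurt him: on average his continuation is worth at most the one
  where he has revealed nothing.
\<close>

lemma val_gather:
  assumes c: "c \<in> A p" and d: "d \<in> B q" and z: "nonneg z"
  shows "(\<Sum>h\<in>hist n. mass (wB q d h) * val m (wA p c h) z) \<le> val m (\<lambda>k. mass q * (step M ^^ n) p k) z"
proof -
  have "(\<Sum>h\<in>hist n. mass (wB q d h) * val m (wA p c h) z)
      = (\<Sum>h\<in>hist n. val m (\<lambda>k. mass (wB q d h) * wA p c h k) z)"
    by (intro sum.cong refl val_scale_left[symmetric] z mass_weights_nonneg[OF d] weights_nonneg[OF c])
  also have "\<dots> \<le> val m (\<lambda>k. \<Sum>h\<in>hist n. mass (wB q d h) * wA p c h k) z"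
    by (intro val_sum_left nonneg_scale z mass_weights_nonneg[OF d] weights_nonneg[OF c]) simp
  also have "(\<lambda>k. \<Sum>h\<in>hist n. mass (wB q d h) * wA p c h k) = (\<lambda>k. mass q * (step M ^^ n) p k)"
    using sum_weights_state[where t = n, OF c d] by (simp add: mult.commute)
  finally show ?thesis .
qed

lemma val_extend:
  assumes p: "nonneg p" and q: "nonneg q"
  shows "\<bar>val (m + n) p q - val m p q\<bar> \<le> real n * mass p * mass q"
proof -
  have tail: "\<bar>total (m + n) c d - total m c d\<bar> \<le> real n * mass p * mass q" if c: "c \<in> A p" and d: "d \<in> B q" for c d
  proof -
    have "\<bar>total (m + n) c d - total m c d\<bar>
        \<le> (\<Sum>h\<in>hist m. \<bar>total n (\<lambda>h'. c (h @ h')) (\<lambda>h'. d (h @ h'))\<bar>)"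
      unfolding total_append by simp
    also have "\<dots> \<le> (\<Sum>h\<in>hist m. real n * mass (wA p c h) * mass (wB q d h))"
      by (intro sum_mono total_bound subplan c d)
    also have "\<dots> = real n * mass p * mass q"
      using sum_weights_mass[OF c d, of m] by (simp add: sum_distrib_left[symmetric] mult.assoc)
    finally show ?thesis .
  qed
  obtain c where c: "c \<in> A p" "\<And>d. d \<in> B q \<Longrightarrow> val m p q \<le> total m c d"
    using optimal1[where n = "m", OF p q] by blast
  obtain d where d: "d \<in> B q" "\<And>c. c \<in> A p \<Longrightarrow> total m c d \<le> val m p q"
    using optimal2[where n = "m", OF p q] by blast
  have "val m p q - real n * mass p * mass q \<le> val (m + n) p q"
  proof (rule val_geI[OF p q c(1)])
    fix d assume "d \<in> B q"
    then show "val m p q - real n * mass p * mass q \<le> total (m + n) c d"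
      using c(2) tail[OF c(1), of d] by force
  qed
  moreover have "val (m + n) p q \<le> val m p q + real n * mass p * mass q"
  proof (rule val_leI[OF p q d(1)])
    fix c assume "c \<in> A p"
    then show "total (m + n) c d \<le> val m p q + real n * mass p * mass q"
      using d(2) tail[OF _ d(1), of c] by force
  qed
  ultimately show ?thesis by linarith
qed

text \<open>
  Player 2 can play the first \<open>n\<close> stages without using his information.
\<close>

lemma val_run_le:
  assumes p: "nonneg p" and q: "nonneg q"
  shows "val (n + m) p q \<le> val m ((step M ^^ n) p) ((step N ^^ n) q) + real n * mass p * mass q"
proof (cases "mass q = 0")
  case True
  then have "mass ((step N ^^ n) q) = 0" by (simp add: mass_steps[OF N])
  then show ?thesis
    using val_bound[where n = "n + m", OF p q] True
      val_bound[of "(step M ^^ n) p" "(step N ^^ n) q" m] steps_nonneg[where n = n, OF M p] steps_nonneg[where n = n, OF N q]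
    by simp
next
  case False
  then have mq: "0 < mass q" using mass_nonneg[OF q] by simp
  let ?p = "(step M ^^ n) p" and ?q = "(step N ^^ n) q"
  have p': "nonneg ?p" by (rule steps_nonneg[OF M p])
  have q': "nonneg ?q" by (rule steps_nonneg[OF N q])
  let ?L = "(1 / real CARD('b)) ^ n"
  obtain d where d: "d \<in> B q"
    "\<And>h. wB q d h = (\<lambda>l. (1 / real CARD('b)) ^ length h * (step N ^^ length h) q l)"
    by (rule uniform_plan[where sel = sel2, OF N q], rule that)
  obtain c where c: "c \<in> A p"
    "\<And>d. d \<in> B q \<Longrightarrow> val (n + m) p q \<le> total n c d + (\<Sum>h\<in>hist n. val m (wA p c h) (wB q d h))"
    by (rule val_block1[where n = n and m = m, OF p q], rule that)
  have "mass q * (\<Sum>h\<in>hist n. val m (wA p c h) (wB q d h)) = (\<Sum>h\<in>hist n. mass (wB q d h) * val m (wA p c h) ?q)"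
  proof -
    have "mass q * val m (wA p c h) (wB q d h) = mass (wB q d h) * val m (wA p c h) ?q" if "h \<in> hist n" for h
    proof -
      have w: "wB q d h = (\<lambda>l. ?L * ?q l)" using d(2)[of h] that by (simp add: hist_length)
      have "val m (wA p c h) (wB q d h) = ?L * val m (wA p c h) ?q"
        unfolding w by (rule val_scale_right[OF weights_nonneg[OF c(1)] q']) simp
      moreover have "mass (wB q d h) = ?L * mass q"
        unfolding w by (simp add: sum_distrib_left[symmetric] mass_steps[OF N])
      ultimately show ?thesis by simp
    qed
    then show ?thesis by (simp add: sum_distrib_left)
  qed
  also have "\<dots> \<le> val m (\<lambda>k. mass q * ?p k) ?q"
    by (rule val_gather[OF c(1) d(1) q'])
  also have "\<dots> = mass q * val m ?p ?q"
    using mq by (intro val_scale_left p' q') simp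
  finally have "(\<Sum>h\<in>hist n. val m (wA p c h) (wB q d h)) \<le> val m ?p ?q" using mq by simp
  then show ?thesis
    using c(2)[OF d(1)] total_bound[where n = n, OF c(1) d(1)] by linarith
qed

lemma val_run:
  assumes p: "nonneg p" and q: "nonneg q"
  shows "\<bar>val (n + m) p q - val m ((step M ^^ n) p) ((step N ^^ n) q)\<bar> \<le> real n * mass p * mass q"
proof -
  interpret sw: game sel2 sel1 N M "\<lambda>l k e. - g k l e" by (rule swap)
  have "- val (n + m) p q \<le> - val m ((step M ^^ n) p) ((step N ^^ n) q) + real n * mass q * mass p"
    using sw.val_run_le[where n = n and m = m, OF q p] steps_nonneg[where n = n, OF M p] steps_nonneg[where n = n, OF N q]
    by (simp add: val_swap[OF p q] val_swap)
  then show ?thesis using val_run_le[where n = n and m = m, OF p q] by (simp add: mult_ac abs_le_iff)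
qed

end

section \<open>Powers of a stochastic matrix and classes of states\<close>

definition pw :: "('s::finite \<Rightarrow> 's \<Rightarrow> real) \<Rightarrow> nat \<Rightarrow> 's \<Rightarrow> 's \<Rightarrow> real" where
  "pw M n k = (step M ^^ n) (\<lambda>x. if x = k then 1 else 0)"

lemma steps_eq_pw: "(step M ^^ n) p k' = (\<Sum>k\<in>UNIV. p k * pw M n k k')"
proof (induction n arbitrary: k')
  case 0
  have "p k * pw M 0 k k' = (if k' = k then p k else 0)" for k by (simp add: pw_def)
  then show ?case by simp
next
  case (Suc n)
  have "(step M ^^ Suc n) p k' = step M (\<lambda>x. \<Sum>k\<in>UNIV. p k * pw M n k x) k'"
    by (simp flip: Suc)
  also have "\<dots> = (\<Sum>k\<in>UNIV. p k * step M (pw M n k) k')"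
    by (simp add: step_sum step_scale)
  finally show ?case by (simp add: pw_def)
qed

lemma pw_add: "pw M (m + n) k k' = (\<Sum>x\<in>UNIV. pw M m k x * pw M n x k')"
proof -
  have "pw M (m + n) k k' = (step M ^^ n) (pw M m k) k'"
    unfolding pw_def by (simp add: funpow_add add.commute[of m])
  then show ?thesis by (simp add: steps_eq_pw)
qed

lemma pw_nonneg: "stochastic M \<Longrightarrow> 0 \<le> pw M n k k'"
  unfolding pw_def by (rule nonnegD, rule steps_nonneg) (simp_all add: nonneg_def)

lemma mass_pw: "stochastic M \<Longrightarrow> mass (pw M n k) = 1"
  unfolding pw_def by (simp add: mass_steps)

definition reach :: "('s::finite \<Rightarrow> 's \<Rightarrow> real) \<Rightarrow> nat \<Rightarrow> ('s \<times> 's) set" where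
  "reach M n = {(k, k'). 0 < pw M n k k'}"

lemma reach_add:
  assumes "stochastic M"
  shows "reach M (m + n) = reach M m O reach M n"
proof -
  have "0 < pw M (m + n) k k' \<longleftrightarrow> (\<exists>x. 0 < pw M m k x \<and> 0 < pw M n x k')" for k k'
  proof -
    have nn: "0 \<le> pw M m k x * pw M n x k'" for x using pw_nonneg[OF assms] by simp
    have "pw M (m + n) k k' = 0 \<longleftrightarrow> (\<forall>x. pw M m k x * pw M n x k' = 0)"
      unfolding pw_add using nn by (subst sum_nonneg_eq_0_iff) auto
    moreover have "0 < a \<longleftrightarrow> a \<noteq> 0" if "0 \<le> a" for a :: real using that by auto
    ultimately show ?thesis using pw_nonneg[OF assms] by (simp add: less_le)
  qed
  then show ?thesis unfolding reach_def by auto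
qed

text \<open>
  The supports of the powers of \<open>M\<close> form a finite semigroup, which contains an idempotent. Passing to
  this power removes all periodicity.
\<close>

lemma reach_idempotent:
  fixes M :: "'s::finite \<Rightarrow> 's \<Rightarrow> real"
  assumes "stochastic M"
  obtains D where "0 < D" "reach M D O reach M D = reach M D"
proof -
  have "\<not> inj_on (reach M) {1..}"
  proof
    assume "inj_on (reach M) {1::nat..}"
    then have "finite {1::nat..}" by (rule inj_on_finite[where B = UNIV]) auto
    then show False using infinite_Ici by blast
  qed
  then obtain i0 j0 where ij0: "1 \<le> i0" "1 \<le> j0" "i0 \<noteq> j0" "reach M i0 = reach M j0"
    unfolding inj_on_def by auto
  define i where "i = min i0 j0"
  define c where "c = max i0 j0 - i"
  have i: "1 \<le> i" "1 \<le> c" and eq: "reach M i = reach M (i + c)"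
    using ij0 by (auto simp: i_def c_def min_def max_def)
  have per: "reach M (m + c) = reach M m" if im: "i \<le> m" for m
  proof -
    obtain d where d: "m = i + d" using le_Suc_ex[OF im] by blast
    have "m + c = (i + c) + d" using d by simp
    then have "reach M (m + c) = reach M ((i + c) + d)" by (rule arg_cong)
    also have "\<dots> = reach M (i + c) O reach M d" by (rule reach_add[OF assms])
    also have "reach M (i + c) = reach M i" using eq by (rule sym)
    also have "reach M i O reach M d = reach M m" unfolding d by (rule reach_add[OF assms, symmetric])
    finally show ?thesis .
  qed
  have per': "reach M (m + j * c) = reach M m" if "i \<le> m" for m j
  proof (induction j)
    case (Suc j)
    have "reach M (m + Suc j * c) = reach M ((m + j * c) + c)" by (simp add: algebra_simps)
    also have "\<dots> = reach M m" using per[of "m + j * c"] that Suc by simp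
    finally show ?case .
  qed simp
  have "i \<le> i * c" using i by simp
  then have "reach M (i * c + i * c) = reach M (i * c)" by (rule per')
  then have "reach M (i * c) O reach M (i * c) = reach M (i * c)"
    by (simp add: reach_add[OF assms])
  moreover have "0 < i * c" using i by simp
  ultimately show ?thesis by (rule that[rotated])
qed

lemma reach_mult:
  assumes "stochastic M" "reach M D O reach M D = reach M D" "0 < j"
  shows "reach M (j * D) = reach M D"
  using assms(3)
proof (induction j rule: nat_induct_non_zero)
  case (Suc j)
  then show ?case using assms(2) by (simp add: reach_add[OF assms(1)])
qed simp

text \<open>
  \<open>D\<close> stages of the chain are regarded as one step. Its support is transitive, and \<open>\<alpha>\<close> is a lower bound for its
  positive entries.
\<close>

locale mixing =
  fixes M :: "'s::finite \<Rightarrow> 's \<Rightarrow> real" and D :: nat and \<alpha> :: real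
  assumes stoch: "stochastic M" and D: "0 < D"
    and idem: "reach M D O reach M D = reach M D"
    and \<alpha>: "0 < \<alpha>" "\<alpha> \<le> 1" and lower: "0 < pw M D k k' \<Longrightarrow> \<alpha> \<le> pw M D k k'"
begin

abbreviation "T \<equiv> reach M D"

text \<open>
  \<open>R\<close> is the set of recurrent states. On it the support \<open>T\<close> is an equivalence relation, whose classes are
  represented by the values of \<open>rep\<close>.
\<close>

definition R :: "'s set" where
  "R = {k. \<forall>k'. (k, k') \<in> T \<longrightarrow> (k', k) \<in> T}"

definition rep :: "'s \<Rightarrow> 's" where
  "rep k = (SOME x. x \<in> T `` {k})"

lemma T_trans: "(k, k') \<in> T \<Longrightarrow> (k', k'') \<in> T \<Longrightarrow> (k, k'') \<in> T"
  using idem by blast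

lemma T_succ: "\<exists>k'. (k, k') \<in> T"
proof (rule ccontr)
  assume "\<not> ?thesis"
  then have "pw M D k k' = 0" for k'
    using pw_nonneg[OF stoch, of D k k'] by (auto simp: reach_def not_less intro: antisym)
  then show False using mass_pw[OF stoch, of D k] by simp
qed

lemma R_sym: "k \<in> R \<Longrightarrow> (k, k') \<in> T \<Longrightarrow> (k', k) \<in> T"
  by (simp add: R_def)

lemma R_closed: "k \<in> R \<Longrightarrow> (k, k') \<in> T \<Longrightarrow> k' \<in> R"
  unfolding R_def using T_trans by blast

lemma R_image: "k \<in> R \<Longrightarrow> (k, k') \<in> T \<Longrightarrow> T `` {k'} = T `` {k}"
  using R_sym T_trans by blast

lemma R_reached: "\<exists>k'\<in>R. (k, k') \<in> T"
proof -
  \<comment> \<open>A successor with as few successors as possible leads only to states with the same successors.\<close>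
  obtain y where y: "(k, y) \<in> T" "\<And>z. (k, z) \<in> T \<Longrightarrow> card (T `` {y}) \<le> card (T `` {z})"
    using ex_has_least_nat[of "\<lambda>y. (k, y) \<in> T" _ "\<lambda>y. card (T `` {y})"] T_succ by blast
  have eq: "T `` {z} = T `` {y}" if "(y, z) \<in> T" for z
  proof (rule card_subset_eq)
    show "T `` {z} \<subseteq> T `` {y}" using that T_trans by blast
    then have "card (T `` {z}) \<le> card (T `` {y})" by (intro card_mono) auto
    moreover have "card (T `` {y}) \<le> card (T `` {z})" using y(2)[OF T_trans[OF y(1) that]] .
    ultimately show "card (T `` {z}) = card (T `` {y})" by simp
  qed simp
  obtain x where x: "(y, x) \<in> T" using T_succ by blast
  have "x \<in> R"
    unfolding R_def
  proof (intro CollectI allI impI)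
    fix z assume "(x, z) \<in> T"
    then have "(y, z) \<in> T" using x T_trans by blast
    then have "T `` {z} = T `` {y}" by (rule eq)
    then show "(z, x) \<in> T" using x by blast
  qed
  then show ?thesis using T_trans[OF y(1) x] by blast
qed

lemma rep_T: "(k, rep k) \<in> T"
  using T_succ[of k] unfolding rep_def by (metis Image_singleton_iff someI)

lemma rep_eq: "k \<in> R \<Longrightarrow> (k, k') \<in> T \<Longrightarrow> rep k' = rep k"
  unfolding rep_def using R_image[of k k'] by simp

lemma rep_R: "k \<in> R \<Longrightarrow> rep k \<in> R"
  using R_closed[OF _ rep_T] .

lemma rep_rep: "k \<in> R \<Longrightarrow> rep (rep k) = rep k"
  using rep_eq[OF _ rep_T] .

lemma same_class: "k \<in> R \<Longrightarrow> k' \<in> R \<Longrightarrow> rep k = rep k' \<Longrightarrow> (k, k') \<in> T"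
  using T_trans[OF rep_T[of k], of k'] rep_T[of k'] R_sym[of k' "rep k'"] by simp

lemma pw_class:
  assumes "k \<in> R" "pw M (j * D) k k' \<noteq> 0"
  shows "k' \<in> R \<and> rep k' = rep k"
proof (cases "j = 0")
  case True
  then have "pw M 0 k k' \<noteq> 0" using assms(2) by simp
  then have "k' = k" by (cases "k' = k") (simp_all add: pw_def)
  then show ?thesis using assms(1) by simp
next
  case False
  then have "(k, k') \<in> reach M (j * D)"
    using assms(2) pw_nonneg[OF stoch, of "j * D" k k'] by (simp add: reach_def)
  then have "(k, k') \<in> T" using reach_mult[OF stoch idem] False by simp
  then show ?thesis using R_closed[OF assms(1)] rep_eq[OF assms(1)] by simp
qed

definition recurrent :: "('s \<Rightarrow> real) \<Rightarrow> bool" where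
  "recurrent p \<longleftrightarrow> (\<forall>k. k \<notin> R \<longrightarrow> p k = 0)"

text \<open>
  \<open>proj p\<close> has the same class masses as the part of \<open>p\<close> on recurrent states, each of them concentrated in the
  representative of the class.
\<close>

definition proj :: "('s \<Rightarrow> real) \<Rightarrow> 's \<Rightarrow> real" where
  "proj p x = (\<Sum>k | k \<in> R \<and> rep k = x. p k)"

lemma proj_alt: "proj p x = (\<Sum>k\<in>UNIV. if k \<in> R \<and> rep k = x then p k else 0)"
  unfolding proj_def by (rule sum.mono_neutral_cong_left) auto

lemma proj_nonneg: "nonneg p \<Longrightarrow> nonneg (proj p)"
  by (simp add: nonneg_def proj_def sum_nonneg)

lemma proj_sum: "proj (\<lambda>k. \<Sum>x\<in>X. s x * f x k) k' = (\<Sum>x\<in>X. s x * proj (f x) k')"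
  unfolding proj_def by (subst sum.swap) (simp add: sum_distrib_left)

lemma mass_proj: "mass (proj p) = (\<Sum>k\<in>R. p k)"
proof -
  have "mass (proj p) = (\<Sum>k\<in>UNIV. \<Sum>x\<in>UNIV. if k \<in> R \<and> rep k = x then p k else 0)"
    unfolding proj_alt by (rule sum.swap)
  also have "\<dots> = (\<Sum>k\<in>UNIV. if k \<in> R then p k else 0)"
  proof (rule sum.cong[OF refl])
    show "(\<Sum>x\<in>UNIV. if k \<in> R \<and> rep k = x then p k else 0) = (if k \<in> R then p k else 0)" for k
      by (cases "k \<in> R") simp_all
  qed
  also have "\<dots> = (\<Sum>k\<in>R. p k)" by (simp add: sum.If_cases)
  finally show ?thesis .
qed

lemma mass_proj_recurrent: "recurrent p \<Longrightarrow> mass (proj p) = mass p"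
  unfolding mass_proj recurrent_def by (rule sum.mono_neutral_left) auto

lemma proj_support:
  assumes "proj p k \<noteq> 0"
  shows "k \<in> R \<and> rep k = k"
proof -
  obtain k' where "k' \<in> {k'. k' \<in> R \<and> rep k' = k}"
    using assms unfolding proj_def by (rule sum.not_neutral_contains_not_neutral)
  then have "k' \<in> R" "k = rep k'" by auto
  then show ?thesis using rep_R[of k'] rep_rep[of k'] by simp
qed

lemma proj_recurrent: "recurrent (proj p)"
  unfolding recurrent_def
proof (intro allI impI)
  fix k assume "k \<notin> R"
  then show "proj p k = 0" using proj_support[of p k] by auto
qed

lemma proj_proj: "proj (proj p) = proj p"
proof
  fix x
  have "proj (proj p) x = (\<Sum>k\<in>UNIV. if k \<in> R \<and> rep k = x then proj p k else 0)" by (rule proj_alt)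
  also have "\<dots> = (\<Sum>k\<in>UNIV. if k = x then proj p x else 0)"
  proof (rule sum.cong[OF refl])
    show "(if k \<in> R \<and> rep k = x then proj p k else 0) = (if k = x then proj p x else 0)" for k
      using proj_support[of p k] by (cases "proj p k = 0") auto
  qed
  finally show "proj (proj p) x = proj p x" by simp
qed

lemma recurrent_steps:
  assumes "recurrent p"
  shows "recurrent ((step M ^^ (j * D)) p)"
  unfolding recurrent_def
proof (intro allI impI)
  fix k' assume k': "k' \<notin> R"
  have *: "p k * pw M (j * D) k k' = 0" for k
    using assms k' pw_class[of k j k'] by (cases "k \<in> R") (auto simp: recurrent_def)
  show "(step M ^^ (j * D)) p k' = 0" by (simp only: steps_eq_pw * sum.neutral_const)
qed

text \<open>
  Every class is closed under a step, hence its mass is preserved.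
\<close>

lemma proj_steps:
  assumes "recurrent p"
  shows "proj ((step M ^^ (j * D)) p) = proj p"
proof
  fix x
  let ?E = "{k. k \<in> R \<and> rep k = x}"
  have "proj ((step M ^^ (j * D)) p) x = (\<Sum>k\<in>UNIV. p k * (\<Sum>k'\<in>?E. pw M (j * D) k k'))"
    unfolding proj_def steps_eq_pw by (subst sum.swap) (simp add: sum_distrib_left)
  also have "\<dots> = (\<Sum>k\<in>UNIV. if k \<in> R \<and> rep k = x then p k else 0)"
  proof (intro sum.cong refl)
    fix k
    show "p k * (\<Sum>k'\<in>?E. pw M (j * D) k k') = (if k \<in> R \<and> rep k = x then p k else 0)"
    proof (cases "k \<in> R")
      case False
      then show ?thesis using assms by (simp add: recurrent_def)
    next
      case True
      show ?thesis
      proof (cases "rep k = x")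
        case True
        have "(\<Sum>k'\<in>?E. pw M (j * D) k k') = mass (pw M (j * D) k)"
          using pw_class[OF \<open>k \<in> R\<close>] True by (intro sum.mono_neutral_left) auto
        then show ?thesis using True \<open>k \<in> R\<close> by (simp add: mass_pw[OF stoch])
      next
        case False
        have "pw M (j * D) k k' = 0" if "k' \<in> ?E" for k'
          using pw_class[OF \<open>k \<in> R\<close>, of j k'] False that by auto
        then show ?thesis using False by simp
      qed
    qed
  qed
  finally show "proj ((step M ^^ (j * D)) p) x = proj p x" by (simp add: proj_alt)
qed

lemma transient_mass_block:
  assumes "nonneg p"
  shows "(\<Sum>k\<in>-R. (step M ^^ D) p k) \<le> (1 - \<alpha>) * (\<Sum>k\<in>-R. p k)"
proof -
  have "(\<Sum>k\<in>-R. (step M ^^ D) p k) = (\<Sum>k\<in>UNIV. p k * (\<Sum>k'\<in>-R. pw M D k k'))"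
    unfolding steps_eq_pw by (subst sum.swap) (simp add: sum_distrib_left)
  also have "\<dots> \<le> (\<Sum>k\<in>UNIV. if k \<in> - R then (1 - \<alpha>) * p k else 0)"
  proof (rule sum_mono)
    fix k
    show "p k * (\<Sum>k'\<in>-R. pw M D k k') \<le> (if k \<in> - R then (1 - \<alpha>) * p k else 0)"
    proof (cases "k \<in> R")
      case True
      have "pw M D k k' = 0" if "k' \<in> - R" for k'
        using pw_class[of k 1 k'] True that by auto
      then show ?thesis using True by simp
    next
      case False
      obtain k1 where k1: "k1 \<in> R" "(k, k1) \<in> T" using R_reached by blast
      have "1 = (\<Sum>k'\<in>-R. pw M D k k') + (\<Sum>k'\<in>R. pw M D k k')"
        using mass_pw[OF stoch, of D k] sum.subset_diff[of R UNIV "pw M D k"] by (simp add: Compl_eq_Diff_UNIV)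
      moreover have "pw M D k k1 \<le> (\<Sum>k'\<in>R. pw M D k k')"
        using k1 pw_nonneg[OF stoch] by (intro member_le_sum) auto
      moreover have "\<alpha> \<le> pw M D k k1" using k1(2) lower by (simp add: reach_def)
      ultimately have "(\<Sum>k'\<in>-R. pw M D k k') \<le> 1 - \<alpha>" by linarith
      then have "p k * (\<Sum>k'\<in>-R. pw M D k k') \<le> p k * (1 - \<alpha>)"
        using nonnegD[OF assms] by (rule mult_left_mono)
      then show ?thesis using False by (simp add: mult.commute)
    qed
  qed
  also have "\<dots> = (1 - \<alpha>) * (\<Sum>k\<in>-R. p k)"
  proof -
    have "{k. k \<notin> R} = - R" by auto
    then show ?thesis by (simp add: sum.If_cases sum_distrib_left)
  qed
  finally show ?thesis .
qed

lemma transient_mass: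
  assumes "nonneg p"
  shows "(\<Sum>k\<in>-R. (step M ^^ (j * D)) p k) \<le> (1 - \<alpha>) ^ j * mass p"
proof (induction j)
  case 0
  show ?case using nonnegD[OF assms] by (auto intro: sum_mono2)
next
  case (Suc j)
  have "(step M ^^ (Suc j * D)) p = (step M ^^ D) ((step M ^^ (j * D)) p)"
    by (simp add: funpow_add)
  then have "(\<Sum>k\<in>-R. (step M ^^ (Suc j * D)) p k) \<le> (1 - \<alpha>) * (\<Sum>k\<in>-R. (step M ^^ (j * D)) p k)"
    using transient_mass_block[OF steps_nonneg[OF stoch assms]] by simp
  also have "\<dots> \<le> (1 - \<alpha>) * ((1 - \<alpha>) ^ j * mass p)"
    using Suc \<alpha> by (intro mult_left_mono) auto
  finally show ?case by simp
qed

end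

lemma mixing_exists:
  fixes M :: "'s::finite \<Rightarrow> 's \<Rightarrow> real" and N :: "'t::finite \<Rightarrow> 't \<Rightarrow> real"
  assumes M: "stochastic M" and N: "stochastic N"
  shows "\<exists>D \<alpha>. mixing M D \<alpha> \<and> mixing N D \<alpha>"
proof -
  obtain D1 where D1: "0 < D1" "reach M D1 O reach M D1 = reach M D1"
    using reach_idempotent[OF M] by blast
  obtain D2 where D2: "0 < D2" "reach N D2 O reach N D2 = reach N D2"
    using reach_idempotent[OF N] by blast
  define D where "D = D1 * D2"
  have eq: "reach M D = reach M D1" "reach N D = reach N D2"
    using reach_mult[OF M D1(2) D2(1)] reach_mult[OF N D2(2) D1(1)] by (simp_all add: D_def mult.commute)
  define S where "S = {1} \<union> {x. 0 < x \<and> x \<in> (\<lambda>(k, k'). pw M D k k') ` UNIV} \<union> {x. 0 < x \<and> x \<in> (\<lambda>(k, k'). pw N D k k') ` UNIV}"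
  have S: "finite S" "1 \<in> S" "\<And>x. x \<in> S \<Longrightarrow> 0 < x"
    unfolding S_def by (auto intro: finite_subset[of _ "range _"])
  define \<alpha> where "\<alpha> = Min S"
  have \<alpha>: "0 < \<alpha>" "\<alpha> \<le> 1" "\<And>x. x \<in> S \<Longrightarrow> \<alpha> \<le> x"
  proof -
    \<comment> \<open>The element \<open>1\<close> makes \<open>S\<close> nonempty and yields \<open>\<alpha> \<le> 1\<close>.\<close>
    have "\<alpha> \<in> S" unfolding \<alpha>_def using S(1,2) by (intro Min_in) auto
    then show "0 < \<alpha>" by (rule S(3))
    show le: "\<alpha> \<le> x" if "x \<in> S" for x using that S(1) by (simp add: \<alpha>_def)
    show "\<alpha> \<le> 1" by (rule le[OF S(2)])
  qed
  have lower: "\<alpha> \<le> pw M D k k'" if "0 < pw M D k k'" for k k'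
    using that by (intro \<alpha>(3)) (auto simp: S_def)
  have lower': "\<alpha> \<le> pw N D k k'" if "0 < pw N D k k'" for k k'
    using that by (intro \<alpha>(3)) (auto simp: S_def)
  have "0 < D" using D1 D2 by (simp add: D_def)
  then have "mixing M D \<alpha>"
    using M D1(2) eq \<alpha>(1,2) lower by (intro mixing.intro) simp_all
  moreover have "mixing N D \<alpha>"
    using \<open>0 < D\<close> N D2(2) eq \<alpha>(1,2) lower' by (intro mixing.intro) simp_all
  ultimately show ?thesis by blast
qed

section \<open>Only the class masses matter, up to a bounded error\<close>

locale mixing_game = game sel1 sel2 M N g + mM: mixing M D \<alpha> + mN: mixing N D \<alpha>
  for sel1 :: "'e::finite \<Rightarrow> 'a::finite" and sel2 :: "'e \<Rightarrow> 'b::finite"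
    and M :: "'k::finite \<Rightarrow> 'k \<Rightarrow> real" and N :: "'l::finite \<Rightarrow> 'l \<Rightarrow> real"
    and g :: "'k \<Rightarrow> 'l \<Rightarrow> 'e \<Rightarrow> real" and D :: nat and \<alpha> :: real
begin

lemma mixing_swap: "mixing_game sel2 sel1 N M (\<lambda>l k e. - g k l e) D \<alpha>"
  using swap mN.mixing_axioms mM.mixing_axioms by (rule mixing_game.intro)

text \<open>
  The bound of the merging argument: every block of \<open>D\<close> stages costs at most \<open>2 D\<close> times the mass that is not
  yet merged, and each block merges the fraction \<open>\<alpha>\<close> of that mass.
\<close>

definition C :: real where
  "C = 2 * real D / \<alpha>"

lemma C_nonneg: "0 \<le> C"
  using mM.\<alpha> by (simp add: C_def)

text \<open>
  Player 2 starts from \<open>b + r\<close> and pretends to start from \<open>b + r'\<close>, where \<open>r\<close> and \<open>r'\<close> live in one class \<open>E\<close>. On the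
  part \<open>r\<close> of his law he ignores his state and imitates the actions which an optimal plan prescribes on
  the part \<open>r'\<close>; this costs at most \<open>2 D\<close> times the mass of \<open>r'\<close> during one block. After the block his true
  state on this part has been distributed by the chain alone, so by mixing its law \<open>\<rho>\<close> dominates \<open>\<alpha>\<close> times the
  pretended law \<open>\<rho>'\<close>. The common part \<open>\<alpha> \<rho>'\<close> joins \<open>b\<close>, and the induction hypothesis applies to the rest,
  whose mass has decreased by the factor \<open>1 - \<alpha>\<close>. Carrying an arbitrary \<open>b\<close> through the induction is what
  keeps the error proportional to the mass that differs.
\<close>

lemma merge_class:
  assumes E: "\<And>l l'. l \<in> E \<Longrightarrow> l' \<in> E \<Longrightarrow> \<alpha> \<le> pw N D l l'"
    "\<And>l l'. l \<in> E \<Longrightarrow> pw N D l l' \<noteq> 0 \<Longrightarrow> l' \<in> E"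
    and p: "nonneg p" and b: "nonneg b" and r: "nonneg r" and r': "nonneg r'"
    and supp: "\<And>l. l \<notin> E \<Longrightarrow> r l = 0" "\<And>l. l \<notin> E \<Longrightarrow> r' l = 0" and mass: "mass r = mass r'"
  shows "val n p (\<lambda>l. b l + r l) \<le> val n p (\<lambda>l. b l + r' l) + C * mass p * mass r'"
  using p b r r' supp mass
proof (induction n arbitrary: p b r r' rule: less_induct)
  case (less n)
  note p = less.prems(1) and b = less.prems(2) and r = less.prems(3) and r' = less.prems(4)
    and supp = less.prems(5,6) and mass = less.prems(7)
  have mp: "0 \<le> mass p" and mr: "0 \<le> mass r'" using p r' by (auto intro: mass_nonneg)
  show ?case
  proof (cases "n < D")
    case True
    have "(\<Sum>l\<in>UNIV. \<bar>(b l + r l) - (b l + r' l)\<bar>) \<le> (\<Sum>l\<in>UNIV. r l + r' l)"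
      using nonnegD[OF r] nonnegD[OF r'] by (intro sum_mono) (simp add: abs_le_iff)
    also have "\<dots> = 2 * mass r'" using mass by (simp add: sum.distrib)
    finally have "real n * (\<Sum>l\<in>UNIV. \<bar>(b l + r l) - (b l + r' l)\<bar>) * mass p \<le> real n * (2 * mass r') * mass p"
      using mp by (intro mult_right_mono mult_left_mono) auto
    also have "\<dots> \<le> C * mass p * mass r'"
    proof -
      have "real D * \<alpha> \<le> real D * 1" using mM.\<alpha> by (intro mult_left_mono) auto
      then have "2 * real D \<le> C" using mM.\<alpha> by (simp add: C_def field_simps)
      then have "2 * real n \<le> C" using True by simp
      then have "(2 * real n) * (mass p * mass r') \<le> C * (mass p * mass r')"
        using mp mr by (intro mult_right_mono) auto
      then show ?thesis by (simp add: mult_ac)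
    qed
    finally show ?thesis
      using val_lipschitz_right[where n = n, OF p nonneg_add[OF b r] nonneg_add[OF b r']] by linarith
  next
    case False
    define m where "m = n - D"
    have n: "n = D + m" "m < n" using False mM.D by (auto simp: m_def)
    show ?thesis
    proof (cases "mass r' = 0")
      case True
      then have "r = r'"
        using mass nonnegD[OF r] nonnegD[OF r'] by (auto simp: fun_eq_iff sum_nonneg_eq_0_iff)
      then show ?thesis using True by simp
    next
      case False
      then have mr: "0 < mass r'" using mr by simp
      obtain d' where d': "d' \<in> B (\<lambda>l. b l + r' l)"
        "\<And>c. c \<in> A p \<Longrightarrow> total D c d' + (\<Sum>h\<in>hist D. val m (wA p c h) (wB (\<lambda>l. b l + r' l) d' h))
           \<le> val (D + m) p (\<lambda>l. b l + r' l)"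
        by (rule val_block2[where n = D and m = m, OF p nonneg_add[OF b r']], rule that)
      obtain d1 d2 where d1: "d1 \<in> B b" and d2: "d2 \<in> B r'" and d'_eq: "d' = (\<lambda>h a k. d1 h a k + d2 h a k)"
        using plan_split[OF N d'(1) b r'] by blast
      let ?s = "\<lambda>h a. mass (d2 h a) / mass r'" and ?S = "\<lambda>h. mass (wB r' d2 h) / mass r'"
      \<comment> \<open>The lottery imitates \<open>d2\<close>, scaled so that its total mass is one.\<close>
      have S: "?s h a \<ge> 0" "(\<Sum>a\<in>UNIV. ?s h a) = ?S h" "?S (h @ [e]) = ?s h (sel2 e)" for h a e
        using mass_plan_nonneg[OF d2] mr plan_mass[OF d2] mass_weights_snoc[OF N, of sel2 r' d2 h e]
        by (simp_all add: sum_divide_distrib[symmetric])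
      define d3 where "d3 = (\<lambda>h a l. ?s h a * (step N ^^ length h) r l)"
      have S0: "(\<lambda>l. ?S [] * r l) = r" using mr by simp
      have d3: "d3 \<in> B r" "\<And>h. wB r d3 h = (\<lambda>l. ?S h * (step N ^^ length h) r l)"
        using signal_plan(1)[of N r ?s ?S sel2, OF N r S] signal_plan(2)[of N r ?s ?S sel2, OF N r S]
        unfolding d3_def S0 by simp_all
      let ?d = "\<lambda>h a k. d1 h a k + d3 h a k"
      have d: "?d \<in> B (\<lambda>l. b l + r l)" by (rule plans_add[OF d1 d3(1)])
      obtain c where c: "c \<in> A p"
        "\<And>d. d \<in> B (\<lambda>l. b l + r l) \<Longrightarrow>
          val (D + m) p (\<lambda>l. b l + r l) \<le> total D c d + (\<Sum>h\<in>hist D. val m (wA p c h) (wB (\<lambda>l. b l + r l) d h))"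
        by (rule val_block1[where n = D and m = m, OF p nonneg_add[OF b r]], rule that)
      have tot: "total D c ?d \<le> total D c d' + 2 * real D * mass p * mass r'"
        using total_bound[where n = D, OF c(1) d3(1), unfolded mass] total_bound[where n = D, OF c(1) d2]
        unfolding d'_eq total_add_right by linarith
      have tail: "val m (wA p c h) (wB (\<lambda>l. b l + r l) ?d h)
          \<le> val m (wA p c h) (wB (\<lambda>l. b l + r' l) d' h) + C * (1 - \<alpha>) * (mass (wA p c h) * mass (wB r' d2 h))"
        if h: "h \<in> hist D" for h
      proof -
        define \<beta> \<rho> \<rho>' where "\<beta> = wB b d1 h" and "\<rho> = wB r d3 h" and "\<rho>' = wB r' d2 h"
        have nn: "nonneg \<beta>" "nonneg \<rho>" "nonneg \<rho>'"
          using d1 d2 d3(1) by (simp_all add: \<beta>_def \<rho>_def \<rho>'_def weights_nonneg)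
        have \<rho>_eq: "\<rho> = (\<lambda>l. (mass \<rho>' / mass r') * (step N ^^ D) r l)"
          unfolding \<rho>_def \<rho>'_def d3(2) using h by (simp add: hist_length)
        have "mass \<rho> = (mass \<rho>' / mass r') * mass ((step N ^^ D) r)"
          unfolding \<rho>_eq by (rule sum_distrib_left[symmetric])
        then have m\<rho>: "mass \<rho> = mass \<rho>'" using mr mass by (simp add: mass_steps[OF N])
        have supp': "l \<in> E" if "s l' * pw N D l' l \<noteq> 0" "\<And>l. l \<notin> E \<Longrightarrow> s l = 0" for s :: "'l \<Rightarrow> real" and l l'
          using that E(2)[of l' l] by (cases "l' \<in> E") auto
        have off: "\<rho> l = 0" "\<rho>' l = 0" if l: "l \<notin> E" for l
        proof -
          have z: "(step N ^^ D) s l = 0" if "\<And>l. l \<notin> E \<Longrightarrow> s l = 0" for s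
            unfolding steps_eq_pw using supp'[of s _ l] that l by (intro sum.neutral) blast
          show "\<rho> l = 0" unfolding \<rho>_eq using z[of r] supp(1) by simp
          have "\<rho>' l \<le> (step N ^^ D) r' l"
            using weights_le_steps[OF N d2, of h l] h by (simp add: \<rho>'_def hist_length)
          then show "\<rho>' l = 0" using z[of r'] supp(2) nonnegD[OF nn(3), of l] by simp
        qed
        have overlap: "\<alpha> * \<rho>' l \<le> \<rho> l" for l
        proof (cases "l \<in> E")
          case True
          have "r l' * \<alpha> \<le> r l' * pw N D l' l" for l'
          proof (cases "l' \<in> E")
            case True
            then show ?thesis using E(1) \<open>l \<in> E\<close> nonnegD[OF r] by (intro mult_left_mono) auto
          qed (simp add: supp(1))
          then have "\<alpha> * mass r' \<le> (step N ^^ D) r l"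
            unfolding steps_eq_pw mass[symmetric] sum_distrib_left
            by (intro sum_mono) (simp add: mult.commute)
          then have "(mass \<rho>' / mass r') * (\<alpha> * mass r') \<le> \<rho> l"
            unfolding \<rho>_eq using mr mass_nonneg[OF nn(3)] by (intro mult_left_mono) auto
          then have "\<alpha> * mass \<rho>' \<le> \<rho> l" using mr by (simp add: mult.commute)
          moreover have "\<alpha> * \<rho>' l \<le> \<alpha> * mass \<rho>'"
            using mM.\<alpha> nonnegD[OF nn(3)] by (intro mult_left_mono member_le_sum) auto
          ultimately show ?thesis by linarith
        qed (simp add: off)
        have "val m (wA p c h) (\<lambda>l. (\<beta> l + \<alpha> * \<rho>' l) + (\<rho> l - \<alpha> * \<rho>' l))
            \<le> val m (wA p c h) (\<lambda>l. (\<beta> l + \<alpha> * \<rho>' l) + (1 - \<alpha>) * \<rho>' l)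
              + C * mass (wA p c h) * mass (\<lambda>l. (1 - \<alpha>) * \<rho>' l)"
        proof (rule less.IH[OF n(2)])
          show "nonneg (wA p c h)" by (rule weights_nonneg[OF c(1)])
          show "nonneg (\<lambda>l. \<beta> l + \<alpha> * \<rho>' l)" "nonneg (\<lambda>l. (1 - \<alpha>) * \<rho>' l)"
            using mM.\<alpha> by (intro nonneg_add nonneg_scale nn; simp)+
          show "nonneg (\<lambda>l. \<rho> l - \<alpha> * \<rho>' l)" using overlap by (simp add: nonneg_def)
          show "mass (\<lambda>l. \<rho> l - \<alpha> * \<rho>' l) = mass (\<lambda>l. (1 - \<alpha>) * \<rho>' l)"
            using m\<rho> by (simp add: sum_subtractf sum_distrib_left[symmetric] algebra_simps)
        qed (simp_all add: off)
        moreover have "(\<lambda>l. (\<beta> l + \<alpha> * \<rho>' l) + (\<rho> l - \<alpha> * \<rho>' l)) = wB (\<lambda>l. b l + r l) ?d h"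
          by (simp add: weights_add \<beta>_def \<rho>_def fun_eq_iff)
        moreover have "(\<lambda>l. (\<beta> l + \<alpha> * \<rho>' l) + (1 - \<alpha>) * \<rho>' l) = wB (\<lambda>l. b l + r' l) d' h"
          by (simp add: d'_eq weights_add \<beta>_def \<rho>'_def fun_eq_iff algebra_simps)
        moreover have "mass (\<lambda>l. (1 - \<alpha>) * \<rho>' l) = (1 - \<alpha>) * mass (wB r' d2 h)"
          by (simp add: sum_distrib_left[symmetric] \<rho>'_def)
        ultimately show ?thesis by (simp add: mult_ac)
      qed
      have "(\<Sum>h\<in>hist D. val m (wA p c h) (wB (\<lambda>l. b l + r l) ?d h))
          \<le> (\<Sum>h\<in>hist D. val m (wA p c h) (wB (\<lambda>l. b l + r' l) d' h)
              + C * (1 - \<alpha>) * (mass (wA p c h) * mass (wB r' d2 h)))"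
        by (rule sum_mono[OF tail])
      also have "\<dots> = (\<Sum>h\<in>hist D. val m (wA p c h) (wB (\<lambda>l. b l + r' l) d' h)) + C * (1 - \<alpha>) * (mass p * mass r')"
        by (simp add: sum.distrib sum_distrib_left[symmetric] sum_weights_mass[OF c(1) d2])
      finally have "val n p (\<lambda>l. b l + r l) \<le> val n p (\<lambda>l. b l + r' l)
          + (2 * real D * mass p * mass r' + C * (1 - \<alpha>) * (mass p * mass r'))"
        using c(2)[OF d] d'(2)[OF c(1)] tot n(1) by simp
      also have "2 * real D * mass p * mass r' + C * (1 - \<alpha>) * (mass p * mass r') = C * mass p * mass r'"
        using mM.\<alpha> by (simp add: C_def field_simps)
      finally show ?thesis .
    qed
  qed
qed

text \<open>
  The law is changed in one class at a time.
\<close>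

lemma merge_right_le:
  assumes p: "nonneg p" and q: "nonneg q" "nonneg q'" and rec: "mN.recurrent q" "mN.recurrent q'"
    and eq: "mN.proj q = mN.proj q'"
  shows "val n p q \<le> val n p q' + C * mass p * mass q'"
proof -
  let ?r = "\<lambda>s x l. if l \<in> mN.R \<and> mN.rep l = x then s l else 0"
  have nn: "nonneg (?r s x)" if "nonneg s" for s x using that by (simp add: nonneg_def)
  have mass_r: "mass (?r s x) = mN.proj s x" for s x by (simp add: mN.proj_alt)
  have main: "val n p (\<lambda>l. b l + (\<Sum>x\<in>F. ?r q x l))
      \<le> val n p (\<lambda>l. b l + (\<Sum>x\<in>F. ?r q' x l)) + C * mass p * (\<Sum>x\<in>F. mN.proj q' x)"
    if "finite F" "nonneg b" for F b
    using that
  proof (induction F arbitrary: b rule: finite_induct)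
    case empty
    then show ?case by simp
  next
    case (insert x F)
    let ?E = "{l \<in> mN.R. mN.rep l = x}"
    have "val n p (\<lambda>l. (b l + (\<Sum>x\<in>F. ?r q x l)) + ?r q x l)
        \<le> val n p (\<lambda>l. (b l + (\<Sum>x\<in>F. ?r q x l)) + ?r q' x l) + C * mass p * mass (?r q' x)"
    proof (rule merge_class[where E = ?E])
      show "\<alpha> \<le> pw N D l l'" if "l \<in> ?E" "l' \<in> ?E" for l l'
        using mN.same_class[of l l'] mN.lower[of l l'] that by (auto simp: reach_def)
      show "l' \<in> ?E" if "l \<in> ?E" "pw N D l l' \<noteq> 0" for l l'
        using mN.pw_class[of l 1 l'] that by simp
      show "nonneg (\<lambda>l. b l + (\<Sum>x\<in>F. ?r q x l))"
        by (rule nonneg_add[OF insert.prems nonneg_sum[OF nn[OF q(1)]]])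
      show "mass (?r q x) = mass (?r q' x)" unfolding mass_r eq ..
    qed (use p nn q in auto)
    also have "(\<lambda>l. (b l + (\<Sum>x\<in>F. ?r q x l)) + ?r q' x l) = (\<lambda>l. (b l + ?r q' x l) + (\<Sum>x\<in>F. ?r q x l))"
      by (simp add: fun_eq_iff)
    also have "val n p \<dots> \<le> val n p (\<lambda>l. (b l + ?r q' x l) + (\<Sum>x\<in>F. ?r q' x l)) + C * mass p * (\<Sum>x\<in>F. mN.proj q' x)"
      by (rule insert.IH[OF nonneg_add[OF insert.prems nn[OF q(2)]]])
    finally show ?case
      using insert.hyps by (simp add: mass_r ring_distribs add_ac del: mult_eq_0_iff)
  qed
  have whole: "(\<lambda>l. 0 + (\<Sum>x\<in>UNIV. ?r s x l)) = s" if "mN.recurrent s" for s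
  proof
    fix l
    show "0 + (\<Sum>x\<in>UNIV. ?r s x l) = s l"
      using that by (cases "l \<in> mN.R") (simp_all add: mN.recurrent_def)
  qed
  show ?thesis
    using main[of UNIV "\<lambda>l. 0"] mN.mass_proj_recurrent[OF rec(2)]
    unfolding whole[OF rec(1)] whole[OF rec(2)] by simp
qed

lemma merge_right:
  assumes p: "nonneg p" and q: "nonneg q" "nonneg q'" and rec: "mN.recurrent q" "mN.recurrent q'"
    and eq: "mN.proj q = mN.proj q'"
  shows "\<bar>val n p q - val n p q'\<bar> \<le> C * mass p * mass q"
proof -
  have "mass q = mass q'" using mN.mass_proj_recurrent[OF rec(1)] mN.mass_proj_recurrent[OF rec(2)] eq by simp
  then show ?thesis
    using merge_right_le[OF p q rec eq, of n] merge_right_le[OF p q(2,1) rec(2,1) eq[symmetric], of n] by simp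
qed

lemma merge_left:
  assumes p: "nonneg p" "nonneg p'" and q: "nonneg q" and rec: "mM.recurrent p" "mM.recurrent p'"
    and eq: "mM.proj p = mM.proj p'"
  shows "\<bar>val n p q - val n p' q\<bar> \<le> C * mass p * mass q"
proof -
  interpret sw: mixing_game sel2 sel1 N M "\<lambda>l k e. - g k l e" D \<alpha> by (rule mixing_swap)
  have "\<bar>sw.val n q p - sw.val n q p'\<bar> \<le> sw.C * mass q * mass p"
    by (rule sw.merge_right[OF q p rec eq])
  then show ?thesis
    by (simp add: val_swap[OF p(1) q] val_swap[OF p(2) q] sw.C_def C_def mult_ac abs_minus_commute)
qed

end

section \<open>Two facts about sequences\<close>

lemma bounded_subseq:
  fixes x :: "nat \<Rightarrow> 'i::countable \<Rightarrow> real"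
  assumes "\<And>n i. x n i \<in> {-b..b}"
  obtains l r where "strict_mono (r :: nat \<Rightarrow> nat)" "\<And>i. (\<lambda>n. x (r n) i) \<longlonglongrightarrow> l i"
proof -
  have "compact {f :: 'i \<Rightarrow> real. \<forall>i. f i \<in> {-b..b}}"
    by (rule compact_functions, rule compact_Icc)
  then have "seq_compact {f :: 'i \<Rightarrow> real. \<forall>i. f i \<in> {-b..b}}" by (rule compact_imp_seq_compact)
  moreover have "\<forall>n. x n \<in> {f. \<forall>i. f i \<in> {-b..b}}" using assms by blast
  ultimately obtain l r where r: "strict_mono r" and l: "(x \<circ> r) \<longlonglongrightarrow> l"
    unfolding seq_compact_def by meson
  have "(\<lambda>n. x (r n) i) \<longlonglongrightarrow> l i" for i
    using continuous_on_tendsto_compose[OF continuous_on_product_coordinates[of i] l] by simp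
  then show ?thesis using that r by blast
qed

text \<open>
  If the conclusion failed, then going down from \<open>T1\<close> in steps of \<open>n\<close> would increase \<open>\<phi>\<close> by at least \<open>\<epsilon> n / T1\<close> each
  time, hence by \<open>\<epsilon> / 2\<close> in total before \<open>T0\<close> is reached, which exceeds the upper bound \<open>u\<close>.
\<close>

lemma descent:
  fixes \<phi> :: "nat \<Rightarrow> real"
  assumes n: "0 < n" and \<epsilon>: "0 < \<epsilon>" and T1: "2 * (T0 + n) \<le> T1"
    and up: "\<And>T. T0 \<le> T \<Longrightarrow> \<phi> T \<le> u" and u: "u < \<phi> T1 + \<epsilon> / 2"
  shows "\<exists>T\<ge>T0 + n. \<phi> T1 \<le> \<phi> T \<and> \<phi> (T - n) \<le> \<phi> T + \<epsilon> * real n / real T"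
proof (rule ccontr)
  assume "\<not> ?thesis"
  then have inc: "\<phi> T + \<epsilon> * real n / real T < \<phi> (T - n)" if "T0 + n \<le> T" "\<phi> T1 \<le> \<phi> T" for T
    using that by force
  have T1pos: "0 < T1" using n T1 by simp
  have "\<phi> T1 + real i * (\<epsilon> * real n / real T1) \<le> \<phi> (T1 - i * n)" if "i * n \<le> T1 - T0" for i
    using that
  proof (induction i)
    case (Suc i)
    let ?T = "T1 - i * n"
    have T: "T0 + n \<le> ?T" "?T \<le> T1" using Suc.prems T1 by auto
    have IH: "\<phi> T1 + real i * (\<epsilon> * real n / real T1) \<le> \<phi> ?T" using Suc by simp
    moreover have "0 \<le> real i * (\<epsilon> * real n / real T1)" using \<epsilon> by simp
    ultimately have "\<phi> T1 \<le> \<phi> ?T" by linarith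
    then have "\<phi> ?T + \<epsilon> * real n / real ?T < \<phi> (?T - n)" by (rule inc[OF T(1)])
    moreover have "\<epsilon> * real n / real T1 \<le> \<epsilon> * real n / real ?T"
    proof -
      have "0 < ?T" using T(1) n by linarith
      then have "0 < real ?T" "0 < real T1" using T1pos by (simp_all only: of_nat_0_less_iff)
      moreover have "real ?T \<le> real T1" using T(2) by (simp only: of_nat_le_iff)
      ultimately show ?thesis using \<epsilon> by (intro divide_left_mono mult_pos_pos mult_nonneg_nonneg; (assumption | simp))
    qed
    moreover have "\<phi> (?T - n) = \<phi> (T1 - Suc i * n)" by (simp add: add.commute)
    moreover have "real (Suc i) * (\<epsilon> * real n / real T1) = \<epsilon> * real n / real T1 + real i * (\<epsilon> * real n / real T1)"
      by (simp only: of_nat_Suc distrib_right mult_1_left)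
    ultimately show ?case using IH by linarith
  qed simp
  moreover define i where "i = (T1 - T0) div n"
  moreover have "i * n \<le> T1 - T0" by (simp add: i_def)
  ultimately have "\<phi> T1 + real i * (\<epsilon> * real n / real T1) \<le> \<phi> (T1 - i * n)" by blast
  moreover have "T0 \<le> T1 - i * n" using \<open>i * n \<le> T1 - T0\<close> T1 by simp
  then have "\<phi> (T1 - i * n) \<le> u" by (rule up)
  moreover have "\<epsilon> / 2 \<le> real i * (\<epsilon> * real n / real T1)"
  proof -
    have half: "b - a < x + n \<Longrightarrow> 2 * (a + n) \<le> b \<Longrightarrow> b \<le> 2 * x" for a b x :: nat by arith
    have "T1 - T0 < i * n + n"
      using dividend_less_div_times[OF n, of "T1 - T0"] by (simp add: i_def add.commute)
    then have "T1 \<le> 2 * (i * n)" using T1 by (rule half)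
    then have "real T1 \<le> 2 * (real i * real n)" by (metis of_nat_le_iff of_nat_mult of_nat_numeral)
    then have "\<epsilon> * real T1 \<le> \<epsilon> * (2 * (real i * real n))" using \<epsilon> by (intro mult_left_mono) auto
    then show ?thesis using T1pos by (simp add: field_simps)
  qed
  ultimately show False using u by linarith
qed

section \<open>Non-revealing play and convergence\<close>

definition sq :: "('s::finite \<Rightarrow> real) \<Rightarrow> real" where
  "sq p = (\<Sum>k\<in>UNIV. (p k)\<^sup>2)"

lemma sq_bound:
  assumes "nonneg p" "mass p = 1"
  shows "0 \<le> sq p" "sq p \<le> 1"
proof -
  show "0 \<le> sq p" by (simp add: sq_def sum_nonneg)
  have "(p k)\<^sup>2 \<le> p k" for k
  proof -
    have "p k \<le> 1" using member_le_sum[of k UNIV p] nonnegD[OF assms(1)] assms(2) by simp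
    then show ?thesis using nonnegD[OF assms(1), of k] by (simp add: power2_eq_square mult_left_le)
  qed
  then have "sq p \<le> mass p" unfolding sq_def by (rule sum_mono)
  then show "sq p \<le> 1" using assms(2) by simp
qed

context mixing
begin

text \<open>
  The probabilities on representatives of classes: a copy of the simplex of all class masses.
\<close>

definition canon :: "('s \<Rightarrow> real) set" where
  "canon = {p. nonneg p \<and> mass p = 1 \<and> proj p = p}"

lemma canonD:
  assumes "p \<in> canon"
  shows "nonneg p" "mass p = 1" "proj p = p" "recurrent p"
  using assms proj_recurrent[of p] by (auto simp: canon_def)

lemma proj_scale: "proj (\<lambda>k. s * p k) = (\<lambda>k. s * proj p k)"
  by (simp add: proj_def sum_distrib_left fun_eq_iff)

lemma normalize_canon:
  assumes "nonneg z" "proj z = z" "mass z \<noteq> 0"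
  shows "(\<lambda>k. z k / mass z) \<in> canon"
proof -
  have "proj (\<lambda>k. (1 / mass z) * z k) = (\<lambda>k. (1 / mass z) * z k)"
    unfolding proj_scale assms(2) ..
  then show ?thesis
    using assms mass_nonneg[OF assms(1)] by (simp add: canon_def nonneg_def sum_divide_distrib[symmetric])
qed

lemma recurrent_weights:
  assumes "c \<in> plans sel M p" "recurrent p" "length h = j * D"
  shows "recurrent (weights sel M p c h)"
  unfolding recurrent_def
proof (intro allI impI)
  fix k assume "k \<notin> R"
  then have "(step M ^^ (j * D)) p k = 0" using recurrent_steps[OF assms(2), of j] by (simp add: recurrent_def)
  then show "weights sel M p c h k = 0"
    using weights_le_steps[OF stoch assms(1), of h k] nonnegD[OF weights_nonneg[OF assms(1)], of h k] assms(3)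
    by simp
qed

lemma recurrent_scale: "recurrent p \<Longrightarrow> recurrent (\<lambda>k. s * p k)"
  by (simp add: recurrent_def)

lemma canon_subseq:
  assumes "\<And>i. x i \<in> canon"
  obtains l r where "strict_mono (r :: nat \<Rightarrow> nat)" "\<And>k. (\<lambda>i. x (r i) k) \<longlonglongrightarrow> l k" "l \<in> canon"
proof -
  have "x i k \<in> {-1..1}" for i k
  proof -
    have "0 \<le> x i k" using nonnegD[OF canonD(1)[OF assms]] .
    moreover have "x i k \<le> mass (x i)"
      using nonnegD[OF canonD(1)[OF assms]] by (intro member_le_sum) auto
    ultimately show ?thesis using canonD(2)[OF assms, of i] by simp
  qed
  from bounded_subseq[of x 1, OF this]
  obtain l r where r: "strict_mono (r :: nat \<Rightarrow> nat)" and l: "\<And>k. (\<lambda>i. x (r i) k) \<longlonglongrightarrow> l k"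
    by blast
  have "nonneg l"
    by (intro nonnegI LIMSEQ_le_const[OF l]) (auto intro: nonnegD[OF canonD(1)[OF assms]])
  moreover have "mass l = 1"
  proof (rule LIMSEQ_unique)
    show "(\<lambda>i. mass (x (r i))) \<longlonglongrightarrow> mass l" by (intro tendsto_sum l)
    show "(\<lambda>i. mass (x (r i))) \<longlonglongrightarrow> 1" by (simp add: canonD(2)[OF assms])
  qed
  moreover have "proj l = l"
  proof
    fix k
    have "(\<lambda>i. proj (x (r i)) k) \<longlonglongrightarrow> proj l k" unfolding proj_def by (intro tendsto_sum l)
    moreover have "(\<lambda>i. proj (x (r i)) k) \<longlonglongrightarrow> l k" unfolding canonD(3)[OF assms] by (rule l)
    ultimately show "proj l k = l k" by (rule LIMSEQ_unique)
  qed
  ultimately have "l \<in> canon" by (simp add: canon_def)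
  then show ?thesis using that r l by blast
qed

end

context mixing_game
begin

text \<open>
  After \<open>n\<close> stages, no history has changed the posterior law of the class. The plan may well reveal something
  about the state inside the class.
\<close>

definition nonrevealing :: "nat \<Rightarrow> ('k \<Rightarrow> real) \<Rightarrow> ('e, 'a, 'k) plan \<Rightarrow> bool" where
  "nonrevealing n p c \<longleftrightarrow> (\<forall>h\<in>hist n. \<forall>k. mM.proj (wA p c h) k = mass (wA p c h) * p k)"

text \<open>
  A prime marks the notion for Player 2.
\<close>

definition nonrevealing' :: "nat \<Rightarrow> ('l \<Rightarrow> real) \<Rightarrow> ('e, 'b, 'l) plan \<Rightarrow> bool" where
  "nonrevealing' n q d \<longleftrightarrow> (\<forall>h\<in>hist n. \<forall>l. mN.proj (wB q d h) l = mass (wB q d h) * q l)"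

text \<open>
  The property of an optimal plan of the game of length \<open>n + m\<close> that concerns its first \<open>n\<close> stages only.
\<close>

definition block_optimal :: "nat \<Rightarrow> nat \<Rightarrow> ('k \<Rightarrow> real) \<Rightarrow> ('l \<Rightarrow> real) \<Rightarrow> ('e, 'a, 'k) plan \<Rightarrow> bool" where
  "block_optimal n m p q c \<longleftrightarrow> c \<in> A p \<and>
     (\<forall>d\<in>B q. val (n + m) p q \<le> total n c d + (\<Sum>h\<in>hist n. val m (wA p c h) (wB q d h)))"

definition block_optimal' :: "nat \<Rightarrow> nat \<Rightarrow> ('k \<Rightarrow> real) \<Rightarrow> ('l \<Rightarrow> real) \<Rightarrow> ('e, 'b, 'l) plan \<Rightarrow> bool" where
  "block_optimal' n m p q d \<longleftrightarrow> d \<in> B q \<and>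
     (\<forall>c\<in>A p. total n c d + (\<Sum>h\<in>hist n. val m (wA p c h) (wB q d h)) \<le> val (n + m) p q)"

lemma block_optimal_swap:
  assumes "nonneg p" "nonneg q"
  shows "mixing_game.block_optimal sel2 sel1 N M (\<lambda>l k e. - g k l e) n m q p d = block_optimal' n m p q d"
proof -
  interpret sw: mixing_game sel2 sel1 N M "\<lambda>l k e. - g k l e" D \<alpha> by (rule mixing_swap)
  have "(\<forall>c\<in>A p. sw.val (n + m) q p \<le> sw.total n d c + (\<Sum>h\<in>hist n. sw.val m (wB q d h) (wA p c h)))
      \<longleftrightarrow> (\<forall>c\<in>A p. total n c d + (\<Sum>h\<in>hist n. val m (wA p c h) (wB q d h)) \<le> val (n + m) p q)"
    if d: "d \<in> B q"
  proof (intro ball_cong refl)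
    fix c assume c: "c \<in> A p"
    have "sw.val m (wB q d h) (wA p c h) = - val m (wA p c h) (wB q d h)" for h
      by (rule val_swap[OF weights_nonneg[OF c] weights_nonneg[OF d]])
    then show "(sw.val (n + m) q p \<le> sw.total n d c + (\<Sum>h\<in>hist n. sw.val m (wB q d h) (wA p c h)))
        \<longleftrightarrow> (total n c d + (\<Sum>h\<in>hist n. val m (wA p c h) (wB q d h)) \<le> val (n + m) p q)"
      by (simp add: val_swap[OF assms] total_swap sum_negf) linarith
  qed
  then show ?thesis unfolding sw.block_optimal_def block_optimal'_def by blast
qed

text \<open>
  Let Player 2 play uniformly during the block, so that he reveals nothing and every history of his actions
  occurs. The continuation values \<open>val m\<close> at the posteriors are bounded through \<open>up\<close> by those of \<open>val S\<close>, whose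
  mean is at most \<open>val S p q\<close> by concavity, minus \<open>\<theta>\<close> times the mean square norm of the posteriors. Comparing
  with \<open>lo\<close>, the mean of the squared norms of the posteriors exceeds the squared norm of their mean \<open>p\<close> only
  slightly, and the difference of the two is their variance.
\<close>

lemma variance_bound:
  assumes p: "p \<in> mM.canon" and q: "q \<in> mN.canon" and n: "n = j * D" and m: "0 < m"
    and c: "block_optimal n m p q c" and \<theta>: "0 \<le> \<theta>"
    and up: "\<And>p'. p' \<in> mM.canon \<Longrightarrow> val m p' q / real m \<le> val S p' q / real S + w - \<theta> * sq p'"
    and lo: "val S p q / real S + w' - \<theta> * sq p \<le> val (n + m) p q / real (n + m)"
    and h: "h \<in> hist n"
  shows "\<theta> * (1 / real CARD('b)) ^ n * (\<Sum>k\<in>UNIV. (mM.proj (wA p c h) k - mass (wA p c h) * p k)\<^sup>2)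
    \<le> w - w' + (2 * real n + 2 * C) / real m"
proof -
  note p' = mM.canonD[OF p] and q' = mN.canonD[OF q]
  have cA: "c \<in> A p" using c by (simp add: block_optimal_def)
  let ?L = "(1 / real CARD('b)) ^ n"
  let ?q = "(step N ^^ n) q"
  define z where "z h = mM.proj (wA p c h)" for h
  define \<mu> where "\<mu> h = mass (wA p c h)" for h
  have rec: "mM.recurrent (wA p c h)" if "h \<in> hist n" for h
    using mM.recurrent_weights[OF cA p'(4), of h j] hist_length[OF that] n by simp
  have z: "nonneg (z h)" "mass (z h) = \<mu> h" "mM.proj (z h) = z h" "mM.recurrent (z h)" if "h \<in> hist n" for h
    using mM.proj_nonneg[OF weights_nonneg[OF cA]] mM.mass_proj_recurrent[OF rec[OF that]]
    by (simp_all add: z_def \<mu>_def mM.proj_proj mM.proj_recurrent)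
  have \<mu>: "0 \<le> \<mu> h" "\<mu> h \<le> 1" if "h \<in> hist n" for h
  proof -
    show "0 \<le> \<mu> h" unfolding \<mu>_def by (rule mass_weights_nonneg[OF cA])
    have "\<mu> h \<le> mass ((step M ^^ length h) p)"
      unfolding \<mu>_def by (intro sum_mono weights_le_steps[OF M cA])
    then show "\<mu> h \<le> 1" by (simp add: mass_steps[OF M] p'(2))
  qed
  obtain d where d: "d \<in> B q" "\<And>h. wB q d h = (\<lambda>l. (1 / real CARD('b)) ^ length h * (step N ^^ length h) q l)"
    by (rule uniform_plan[where sel = sel2, OF N q'(1)], rule that)
  have wd: "wB q d h = (\<lambda>l. ?L * ?q l)" "mass (wB q d h) = ?L" if "h \<in> hist n" for h
  proof -
    show "wB q d h = (\<lambda>l. ?L * ?q l)" using d(2)[of h] that by (simp add: hist_length)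
    then show "mass (wB q d h) = ?L" by (simp add: sum_distrib_left[symmetric] mass_steps[OF N] q'(2))
  qed
  have sum\<mu>: "(\<Sum>h\<in>hist n. ?L * \<mu> h) = 1"
  proof -
    have "(\<Sum>h\<in>hist n. ?L * \<mu> h) = (\<Sum>h\<in>hist n. mass (wA p c h) * mass (wB q d h))"
      by (intro sum.cong refl) (simp only: wd(2) \<mu>_def mult.commute)
    then show ?thesis by (simp add: sum_weights_mass[OF cA d(1)] p'(2) q'(2))
  qed
  have sumz: "(\<Sum>h\<in>hist n. ?L * z h k) = p k" for k
  proof -
    have "(\<lambda>k. \<Sum>h\<in>hist n. ?L * wA p c h k) = (\<lambda>k. \<Sum>h\<in>hist n. wA p c h k * mass (wB q d h))"
      by (intro ext sum.cong refl) (simp only: wd(2) mult.commute)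
    also have "\<dots> = (step M ^^ n) p"
      by (simp add: sum_weights_state[OF cA d(1)] q'(2))
    finally have "mM.proj (\<lambda>k. \<Sum>h\<in>hist n. ?L * wA p c h k) = p"
      using mM.proj_steps[OF p'(4), of j] n p'(3) by simp
    then show ?thesis unfolding mM.proj_sum z_def by (metis mM.proj_sum)
  qed
  have tail: "val m (wA p c h) (wB q d h) \<le> ?L * (real m * (val S (z h) q / real S + \<mu> h * w - \<theta> * (sq (z h) / \<mu> h)) + 2 * C * \<mu> h)"
    if h: "h \<in> hist n" for h
  proof -
    have nnq: "nonneg ?q" by (rule steps_nonneg[OF N q'(1)])
    have "\<bar>val m (wA p c h) ?q - val m (wA p c h) q\<bar> \<le> C * \<mu> h * mass ?q"
      unfolding \<mu>_def
      by (rule merge_right[OF weights_nonneg[OF cA] nnq q'(1)])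
        (use mN.recurrent_steps[OF q'(4), of j] mN.proj_steps[OF q'(4), of j] q'(4) n in simp_all)
    moreover have "\<bar>val m (wA p c h) q - val m (z h) q\<bar> \<le> C * \<mu> h * mass q"
      unfolding \<mu>_def
      by (rule merge_left[OF weights_nonneg[OF cA] z(1)[OF h] q'(1) rec[OF h] z(4)[OF h]])
        (simp add: z_def mM.proj_proj)
    ultimately have 1: "val m (wA p c h) ?q \<le> val m (z h) q + 2 * C * \<mu> h"
      by (simp add: mass_steps[OF N] q'(2) abs_le_iff)
    have 2: "val m (z h) q \<le> real m * (val S (z h) q / real S + \<mu> h * w - \<theta> * (sq (z h) / \<mu> h))"
    proof (cases "\<mu> h = 0")
      case True
      then have "z h k = 0" for k
        using z(1,2)[OF h] by (simp add: nonneg_def sum_nonneg_eq_0_iff)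
      then have "z h = (\<lambda>k. 0)" by blast
      then show ?thesis
        using val_bound[of "\<lambda>k. 0" q m] val_bound[of "\<lambda>k. 0" q S] q'(1) True by simp
    next
      case False
      then have \<mu>pos: "0 < \<mu> h" using \<mu>(1)[OF h] by simp
      define x where "x k = z h k / \<mu> h" for k
      have x: "x \<in> mM.canon"
        using mM.normalize_canon[OF z(1,3)[OF h]] z(2)[OF h] False unfolding x_def by simp
      have zx: "z h = (\<lambda>k. \<mu> h * x k)" using False by (simp add: x_def)
      have v: "val t (z h) q = \<mu> h * val t x q" for t
        unfolding zx using \<mu>pos by (intro val_scale_left mM.canonD(1)[OF x] q'(1)) simp
      have s: "sq (z h) / \<mu> h = \<mu> h * sq x"
      proof -
        have "sq (z h) = (\<mu> h)\<^sup>2 * sq x"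
          unfolding zx by (simp add: sq_def power_mult_distrib sum_distrib_left)
        then show ?thesis by (simp add: power2_eq_square)
      qed
      have "val m x q \<le> real m * (val S x q / real S + w - \<theta> * sq x)"
        using up[OF x] m by (simp add: pos_divide_le_eq mult.commute)
      then have "\<mu> h * val m x q \<le> \<mu> h * (real m * (val S x q / real S + w - \<theta> * sq x))"
        using \<mu>pos by (intro mult_left_mono) auto
      then show ?thesis unfolding v s by (simp add: algebra_simps)
    qed
    have "val m (wA p c h) (wB q d h) = ?L * val m (wA p c h) ?q"
      unfolding wd(1)[OF h] by (rule val_scale_right[OF weights_nonneg[OF cA] nnq]) simp
    also have "\<dots> \<le> ?L * (real m * (val S (z h) q / real S + \<mu> h * w - \<theta> * (sq (z h) / \<mu> h)) + 2 * C * \<mu> h)"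
      using 1 2 by (intro mult_left_mono) auto
    finally show ?thesis .
  qed
  have sumS: "(\<Sum>h\<in>hist n. ?L * val S (z h) q) \<le> val S p q"
  proof -
    have "(\<Sum>h\<in>hist n. ?L * val S (z h) q) = (\<Sum>h\<in>hist n. val S (\<lambda>k. ?L * z h k) q)"
      by (intro sum.cong refl val_scale_left[symmetric] z(1) q'(1)) auto
    also have "\<dots> \<le> val S (\<lambda>k. \<Sum>h\<in>hist n. ?L * z h k) q"
      by (intro val_sum_left nonneg_scale z(1) q'(1)) auto
    finally show ?thesis by (simp only: sumz)
  qed
  define Q where "Q = (\<Sum>h\<in>hist n. ?L * (sq (z h) / \<mu> h))"
  have "(\<Sum>h\<in>hist n. val m (wA p c h) (wB q d h))
      \<le> (\<Sum>h\<in>hist n. ?L * (real m * (val S (z h) q / real S + \<mu> h * w - \<theta> * (sq (z h) / \<mu> h)) + 2 * C * \<mu> h))"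
    by (rule sum_mono[OF tail])
  also have "\<dots> = real m * ((\<Sum>h\<in>hist n. ?L * val S (z h) q) / real S + (\<Sum>h\<in>hist n. ?L * \<mu> h) * w - \<theta> * Q)
      + 2 * C * (\<Sum>h\<in>hist n. ?L * \<mu> h)"
    unfolding Q_def
    by (simp add: sum.distrib sum_subtractf sum_distrib_left sum_distrib_right sum_divide_distrib algebra_simps)
  also have "\<dots> \<le> real m * (val S p q / real S + w - \<theta> * Q) + 2 * C"
    unfolding sum\<mu> using sumS \<theta> by (intro add_mono mult_left_mono diff_mono divide_right_mono) auto
  finally have tail_sum: "(\<Sum>h\<in>hist n. val m (wA p c h) (wB q d h)) \<le> real m * (val S p q / real S + w - \<theta> * Q) + 2 * C" .
  have "val (n + m) p q \<le> total n c d + (\<Sum>h\<in>hist n. val m (wA p c h) (wB q d h))"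
    using c d(1) by (simp add: block_optimal_def)
  moreover have "\<bar>total n c d\<bar> \<le> real n"
    using total_bound[where n = n, OF cA d(1)] p'(2) q'(2) by simp
  ultimately have upper: "val (n + m) p q \<le> real n + (real m * (val S p q / real S + w - \<theta> * Q) + 2 * C)"
    using tail_sum by linarith
  define F where "F = val (n + m) p q / real (n + m)"
  have "real (n + m) \<noteq> 0" using m by simp
  then have "real (n + m) * F = val (n + m) p q" unfolding F_def times_divide_eq_right by (rule nonzero_mult_div_cancel_left)
  then have vF: "val (n + m) p q = real n * F + real m * F"
    by (simp add: ring_distribs)
  have "\<bar>F\<bar> \<le> 1"
    using val_bound[where n = "n + m", OF p'(1) q'(1)] p'(2) q'(2) m by (simp add: F_def abs_divide field_simps)
  then have "- real n \<le> real n * F" using mult_left_mono[of "-1" F "real n"] by (simp add: abs_le_iff)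
  moreover have "real m * (val S p q / real S + w' - \<theta> * sq p) \<le> real m * F"
    using lo unfolding F_def by (intro mult_left_mono) auto
  ultimately have "real m * (val S p q / real S + w' - \<theta> * sq p) \<le> 2 * real n + 2 * C + real m * (val S p q / real S + w - \<theta> * Q)"
    using upper vF by linarith
  then have "real m * (\<theta> * (Q - sq p)) \<le> real m * (w - w') + (2 * real n + 2 * C)"
    by (simp add: algebra_simps)
  then have key: "\<theta> * (Q - sq p) \<le> w - w' + (2 * real n + 2 * C) / real m"
    using m by (simp add: field_simps)
  have term_le: "(\<Sum>k\<in>UNIV. (z h k - \<mu> h * p k)\<^sup>2) \<le> sq (z h) / \<mu> h - 2 * (\<Sum>k\<in>UNIV. z h k * p k) + \<mu> h * sq p"
    if h: "h \<in> hist n" for h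
  proof -
    \<comment> \<open>If \<open>\<mu> h = 0\<close>, then \<open>z h = 0\<close> and the quotient is \<open>0\<close> as well.\<close>
    have "(z h k - \<mu> h * p k)\<^sup>2 \<le> (z h k)\<^sup>2 / \<mu> h - 2 * (z h k * p k) + \<mu> h * (p k)\<^sup>2" for k
    proof (cases "\<mu> h = 0")
      case True
      then have "z h k = 0" using z(1,2)[OF h] by (simp add: nonneg_def sum_nonneg_eq_0_iff)
      then show ?thesis using True by simp
    next
      case False
      then have \<mu>pos: "0 < \<mu> h" using \<mu>(1)[OF h] by simp
      have "(z h k - \<mu> h * p k)\<^sup>2 * \<mu> h \<le> (z h k - \<mu> h * p k)\<^sup>2 * 1"
        using \<mu>(2)[OF h] by (intro mult_left_mono) auto
      then have "(z h k - \<mu> h * p k)\<^sup>2 \<le> (z h k - \<mu> h * p k)\<^sup>2 / \<mu> h"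
        using \<mu>pos by (simp add: pos_le_divide_eq)
      also have "\<dots> = (z h k)\<^sup>2 / \<mu> h - 2 * (z h k * p k) + \<mu> h * (p k)\<^sup>2"
        using \<mu>pos by (simp add: field_simps power2_eq_square)
      finally show ?thesis .
    qed
    then have "(\<Sum>k\<in>UNIV. (z h k - \<mu> h * p k)\<^sup>2)
        \<le> (\<Sum>k\<in>UNIV. (z h k)\<^sup>2 / \<mu> h - 2 * (z h k * p k) + \<mu> h * (p k)\<^sup>2)"
      by (rule sum_mono)
    then show ?thesis
      by (simp add: sq_def sum.distrib sum_subtractf sum_distrib_left sum_divide_distrib)
  qed
  have "?L * (\<Sum>k\<in>UNIV. (z h k - \<mu> h * p k)\<^sup>2) \<le> (\<Sum>h\<in>hist n. ?L * (\<Sum>k\<in>UNIV. (z h k - \<mu> h * p k)\<^sup>2))"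
    using h by (intro member_le_sum[of h "hist n" "\<lambda>h. ?L * (\<Sum>k\<in>UNIV. (z h k - \<mu> h * p k)\<^sup>2)"])
      (auto intro!: sum_nonneg mult_nonneg_nonneg)
  also have "\<dots> \<le> (\<Sum>h\<in>hist n. ?L * (sq (z h) / \<mu> h - 2 * (\<Sum>k\<in>UNIV. z h k * p k) + \<mu> h * sq p))"
    using term_le by (intro sum_mono mult_left_mono) auto
  also have "\<dots> = Q - 2 * (\<Sum>h\<in>hist n. \<Sum>k\<in>UNIV. ?L * z h k * p k) + (\<Sum>h\<in>hist n. ?L * \<mu> h) * sq p"
    unfolding Q_def by (simp add: sum.distrib sum_subtractf sum_distrib_left sum_distrib_right algebra_simps)
  also have "(\<Sum>h\<in>hist n. \<Sum>k\<in>UNIV. ?L * z h k * p k) = sq p"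
    by (subst sum.swap) (simp add: sum_distrib_right[symmetric] sumz sq_def power2_eq_square)
  finally have "?L * (\<Sum>k\<in>UNIV. (z h k - \<mu> h * p k)\<^sup>2) \<le> Q - sq p" by (simp add: sum\<mu>)
  then have "\<theta> * (?L * (\<Sum>k\<in>UNIV. (z h k - \<mu> h * p k)\<^sup>2)) \<le> \<theta> * (Q - sq p)"
    using \<theta> by (rule mult_left_mono)
  then show ?thesis using key unfolding z_def \<mu>_def by (simp add: mult.assoc)
qed

text \<open>
  Since \<open>d\<close> does not reveal the class, all posteriors of Player 2 may be replaced by \<open>q\<close> at the price of \<open>C\<close>.
  Then whatever Player 1 reveals does not help him, so the continuation is worth at most
  \<open>val m p q\<close> up to \<open>2 C\<close>, and by \<open>slow\<close> the difference \<open>val (n + m) p q - val m p q\<close> is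
  almost \<open>n\<close> times the mean value. Taking \<open>n\<close> large makes \<open>C / n\<close> negligible.
\<close>

lemma nonrevealing_upper:
  assumes p: "p \<in> mM.canon" and q: "q \<in> mN.canon" and n: "n = j * D" "0 < n" and m: "0 < m"
    and c: "block_optimal n m p q c" and d: "d \<in> B q" "nonrevealing' n q d"
    and slow: "val m p q / real m \<le> val (n + m) p q / real (n + m) + \<epsilon> * real n / real (n + m)"
    and \<epsilon>: "0 < \<epsilon>" "2 * C \<le> \<epsilon> * real n"
  shows "val (n + m) p q / real (n + m) \<le> total n c d / real n + 2 * \<epsilon>"
proof -
  note p' = mM.canonD[OF p] and q' = mN.canonD[OF q]
  have cA: "c \<in> A p" using c by (simp add: block_optimal_def)
  have tail: "val m (wA p c h) (wB q d h) \<le> mass (wB q d h) * val m (wA p c h) q + C * (mass (wA p c h) * mass (wB q d h))"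
    if h: "h \<in> hist n" for h
  proof -
    have nn: "nonneg (\<lambda>l. mass (wB q d h) * q l)"
      by (rule nonneg_scale[OF mass_weights_nonneg[OF d(1)] q'(1)])
    have "mN.proj (wB q d h) = (\<lambda>l. mass (wB q d h) * q l)"
      using d(2) h by (auto simp: nonrevealing'_def fun_eq_iff)
    also have "\<dots> = mN.proj (\<lambda>l. mass (wB q d h) * q l)"
      unfolding mN.proj_scale q'(3) ..
    finally have eq: "mN.proj (wB q d h) = mN.proj (\<lambda>l. mass (wB q d h) * q l)" .
    have "mN.recurrent (wB q d h)"
      using mN.recurrent_weights[OF d(1) q'(4)] h n by (simp add: hist_length)
    then have "\<bar>val m (wA p c h) (wB q d h) - val m (wA p c h) (\<lambda>l. mass (wB q d h) * q l)\<bar>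
        \<le> C * mass (wA p c h) * mass (wB q d h)"
      by (rule merge_right[OF weights_nonneg[OF cA] weights_nonneg[OF d(1)] nn _ mN.recurrent_scale[OF q'(4)] eq])
    moreover have "val m (wA p c h) (\<lambda>l. mass (wB q d h) * q l) = mass (wB q d h) * val m (wA p c h) q"
      by (rule val_scale_right[OF weights_nonneg[OF cA] q'(1) mass_weights_nonneg[OF d(1)]])
    ultimately show ?thesis by (simp add: abs_le_iff mult.assoc)
  qed
  have "(\<Sum>h\<in>hist n. val m (wA p c h) (wB q d h))
      \<le> (\<Sum>h\<in>hist n. mass (wB q d h) * val m (wA p c h) q + C * (mass (wA p c h) * mass (wB q d h)))"
    by (rule sum_mono[OF tail])
  also have "\<dots> = (\<Sum>h\<in>hist n. mass (wB q d h) * val m (wA p c h) q) + C"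
    by (simp add: sum.distrib sum_distrib_left[symmetric] sum_weights_mass[OF cA d(1)] p'(2) q'(2))
  also have "\<dots> \<le> val m ((step M ^^ n) p) q + C"
    using val_gather[where n = n and m = m, OF cA d(1) q'(1)] q'(2) by simp
  also have "\<dots> \<le> val m p q + 2 * C"
  proof -
    have "\<bar>val m ((step M ^^ n) p) q - val m p q\<bar> \<le> C * mass ((step M ^^ n) p) * mass q"
      by (rule merge_left[OF steps_nonneg[OF M p'(1)] p'(1) q'(1)])
        (use mM.recurrent_steps[OF p'(4), of j] mM.proj_steps[OF p'(4), of j] p'(4) n in simp_all)
    then show ?thesis by (simp add: mass_steps[OF M] p'(2) q'(2))
  qed
  finally have "val (n + m) p q \<le> total n c d + val m p q + 2 * C"
    using c d(1) unfolding block_optimal_def by force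
  moreover define F where "F = val (n + m) p q / real (n + m)"
  moreover have "val (n + m) p q = real n * F + real m * F"
  proof -
    have "real (n + m) \<noteq> 0" using m by simp
    then have "real (n + m) * F = val (n + m) p q"
      unfolding F_def times_divide_eq_right by (rule nonzero_mult_div_cancel_left)
    then show ?thesis by (simp add: ring_distribs)
  qed
  moreover have "val m p q \<le> real m * F + \<epsilon> * real n"
  proof -
    have "val m p q \<le> real m * (F + \<epsilon> * real n / real (n + m))"
      using slow m by (simp add: F_def pos_divide_le_eq mult.commute)
    also have "\<dots> = real m * F + (\<epsilon> * real n) * (real m / real (n + m))" by (simp add: algebra_simps)
    also have "\<dots> \<le> real m * F + (\<epsilon> * real n) * 1"
      using \<epsilon>(1) m by (intro add_left_mono mult_left_mono) auto
    finally show ?thesis by simp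
  qed
  ultimately have "real n * F \<le> total n c d + 2 * \<epsilon> * real n" using \<epsilon>(2) by linarith
  then have "F \<le> (total n c d + 2 * \<epsilon> * real n) / real n"
    using n(2) by (simp add: pos_le_divide_eq mult.commute)
  also have "\<dots> = total n c d / real n + 2 * \<epsilon>" using n(2) by (simp add: add_divide_distrib)
  finally show ?thesis by (simp add: F_def)
qed

lemma variance_bound':
  assumes p: "p \<in> mM.canon" and q: "q \<in> mN.canon" and n: "n = j * D" and m: "0 < m"
    and d: "block_optimal' n m p q d" and \<theta>: "0 \<le> \<theta>"
    and up: "\<And>q'. q' \<in> mN.canon \<Longrightarrow> val S p q' / real S - w + \<theta> * sq q' \<le> val m p q' / real m"
    and lo: "val (n + m) p q / real (n + m) \<le> val S p q / real S - w' + \<theta> * sq q"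
    and h: "h \<in> hist n"
  shows "\<theta> * (1 / real CARD('a)) ^ n * (\<Sum>l\<in>UNIV. (mN.proj (wB q d h) l - mass (wB q d h) * q l)\<^sup>2)
    \<le> w - w' + (2 * real n + 2 * C) / real m"
proof -
  interpret sw: mixing_game sel2 sel1 N M "\<lambda>l k e. - g k l e" D \<alpha> by (rule mixing_swap)
  note p' = mM.canonD[OF p] and q' = mN.canonD[OF q]
  have "sw.C = C" by (simp add: sw.C_def C_def)
  moreover have "\<theta> * (1 / real CARD('a)) ^ n * (\<Sum>l\<in>UNIV. (mN.proj (wB q d h) l - mass (wB q d h) * q l)\<^sup>2)
    \<le> w - w' + (2 * real n + 2 * sw.C) / real m"
  proof (rule sw.variance_bound[OF q p n m _ \<theta> _ _ h])
    show "sw.block_optimal n m q p d" using d by (simp add: block_optimal_swap[OF p'(1) q'(1)])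
    show "sw.val m x p / real m \<le> sw.val S x p / real S + w - \<theta> * sq x" if "x \<in> mN.canon" for x
      using up[OF that] by (simp add: val_swap[OF p'(1) mN.canonD(1)[OF that]])
    show "sw.val S q p / real S + w' - \<theta> * sq q \<le> sw.val (n + m) q p / real (n + m)"
      using lo by (simp add: val_swap[OF p'(1) q'(1)])
  qed
  ultimately show ?thesis by simp
qed

lemma nonrevealing_lower:
  assumes p: "p \<in> mM.canon" and q: "q \<in> mN.canon" and n: "n = j * D" "0 < n" and m: "0 < m"
    and d: "block_optimal' n m p q d" and c: "c \<in> A p" "nonrevealing n p c"
    and slow: "val (n + m) p q / real (n + m) - \<epsilon> * real n / real (n + m) \<le> val m p q / real m"
    and \<epsilon>: "0 < \<epsilon>" "2 * C \<le> \<epsilon> * real n"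
  shows "total n c d / real n - 2 * \<epsilon> \<le> val (n + m) p q / real (n + m)"
proof -
  interpret sw: mixing_game sel2 sel1 N M "\<lambda>l k e. - g k l e" D \<alpha> by (rule mixing_swap)
  note p' = mM.canonD[OF p] and q' = mN.canonD[OF q]
  have "sw.val (n + m) q p / real (n + m) \<le> sw.total n d c / real n + 2 * \<epsilon>"
  proof (rule sw.nonrevealing_upper[OF q p n m _ c(1) _ _ \<epsilon>(1)])
    show "sw.block_optimal n m q p d" using d by (simp add: block_optimal_swap[OF p'(1) q'(1)])
    show "sw.nonrevealing' n p c" using c(2) by (simp add: sw.nonrevealing'_def nonrevealing_def)
    show "sw.val m q p / real m \<le> sw.val (n + m) q p / real (n + m) + \<epsilon> * real n / real (n + m)"
      using slow by (simp add: val_swap[OF p'(1) q'(1)])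
    show "2 * sw.C \<le> \<epsilon> * real n" using \<epsilon>(2) by (simp add: sw.C_def C_def)
  qed
  then show ?thesis by (simp add: val_swap[OF p'(1) q'(1)] total_swap)
qed

end

lemma tendsto_weights:
  assumes "\<And>h a k. (\<lambda>i. c i h a k) \<longlonglongrightarrow> c' h a k"
  shows "(\<lambda>i. weights sel M p (c i) h k) \<longlonglongrightarrow> weights sel M p c' h k"
proof (cases h rule: rev_cases)
  case (snoc h' e)
  have "(\<lambda>i. \<Sum>k'\<in>UNIV. c i h' (sel e) k' * M k' k) \<longlonglongrightarrow> (\<Sum>k'\<in>UNIV. c' h' (sel e) k' * M k' k)"
    by (intro tendsto_sum tendsto_mult assms tendsto_const)
  then show ?thesis by (simp add: snoc step_def)
qed simp

lemma plans_limit: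
  assumes lim: "\<And>h a k. (\<lambda>i. c i h a k) \<longlonglongrightarrow> c' h a k" and c: "\<And>i. c i \<in> plans sel M p"
  shows "c' \<in> plans sel M p"
proof -
  have "0 \<le> c' h a k" for h a k
    by (rule LIMSEQ_le_const[OF lim]) (auto intro: plan_nonneg[OF c])
  moreover have "(\<Sum>a\<in>UNIV. c' h a k) = weights sel M p c' h k" for h k
  proof (rule LIMSEQ_unique)
    show "(\<lambda>i. \<Sum>a\<in>UNIV. c i h a k) \<longlonglongrightarrow> (\<Sum>a\<in>UNIV. c' h a k)" by (intro tendsto_sum lim)
    show "(\<lambda>i. \<Sum>a\<in>UNIV. c i h a k) \<longlonglongrightarrow> weights sel M p c' h k"
      unfolding plan_sum[OF c] by (rule tendsto_weights[OF lim])
  qed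
  ultimately show ?thesis by (simp add: plans_def)
qed

lemma plans_subseq:
  fixes c :: "nat \<Rightarrow> ('e::finite, 'a::finite, 's::finite) plan"
  assumes M: "stochastic M" and p: "nonneg p" and c: "\<And>i. c i \<in> plans sel M p"
  obtains r c' where "strict_mono (r :: nat \<Rightarrow> nat)" "\<And>h a k. (\<lambda>i. c (r i) h a k) \<longlonglongrightarrow> c' h a k"
    "c' \<in> plans sel M p"
proof -
  have bnd: "(\<lambda>(h, a, k). c i h a k) x \<in> {- mass p..mass p}" for i x
  proof (cases x)
    case (fields h a k)
    then show ?thesis
      using plan_nonneg[OF c, of i h a k] plan_le_mass[OF M c p, of i h a k] by simp
  qed
  from bounded_subseq[of "\<lambda>i (h, a, k). c i h a k" "mass p", OF bnd]
  obtain l r where r: "strict_mono (r :: nat \<Rightarrow> nat)"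
    and l: "\<And>x. (\<lambda>i. (\<lambda>(h, a, k). c (r i) h a k) x) \<longlonglongrightarrow> l x" by blast
  have lim: "(\<lambda>i. c (r i) h a k) \<longlonglongrightarrow> l (h, a, k)" for h a k
    using l[of "(h, a, k)"] by simp
  have "(\<lambda>h a k. l (h, a, k)) \<in> plans sel M p" by (rule plans_limit[OF lim c])
  then show ?thesis using that[OF r lim] by blast
qed

context mixing_game
begin

abbreviation "f t p q \<equiv> val t p q / real t"

text \<open>
  The lengths \<open>t\<close> and \<open>s\<close> come from the descent lemma, applied first to \<open>t\<close> and then to \<open>s\<close>; neither step decreases
  the gap between the two mean values. The last two conjuncts say that both optimal plans reveal
  little about the class.
\<close>

lemma near_optimal_play:
  assumes p: "p \<in> mM.canon" and q: "q \<in> mN.canon" and n: "n = j * D" "0 < n"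
    and \<epsilon>: "0 < \<epsilon>" "2 * C \<le> \<epsilon> * real n" and \<theta>: "0 < \<theta>"
    and up: "\<And>\<eta>. 0 < \<eta> \<Longrightarrow> \<exists>n0. \<forall>p'\<in>mM.canon. \<forall>q'\<in>mN.canon. \<forall>t\<ge>n0. \<forall>s\<ge>n0.
        f t p' q' - f s p' q' + \<theta> * (sq p' + sq q') \<le> \<delta> + \<eta>"
    and lo: "\<And>\<eta> n0. 0 < \<eta> \<Longrightarrow> \<exists>t\<ge>n0. \<exists>s\<ge>n0. \<delta> - \<eta> \<le> f t p q - f s p q + \<theta> * (sq p + sq q)"
    and \<eta>: "0 < \<eta>" "\<eta> \<le> \<epsilon> / 8"
  shows "\<exists>t s c d. c \<in> A p \<and> d \<in> B q \<and> \<delta> - \<eta> \<le> f t p q - f s p q + \<theta> * (sq p + sq q)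
    \<and> (\<forall>d'\<in>B q. nonrevealing' n q d' \<longrightarrow> f t p q \<le> total n c d' / real n + 2 * \<epsilon>)
    \<and> (\<forall>c'\<in>A p. nonrevealing n p c' \<longrightarrow> total n c' d / real n - 2 * \<epsilon> \<le> f s p q)
    \<and> (\<forall>h\<in>hist n. \<theta> * (1 / real CARD('b)) ^ n * (\<Sum>k\<in>UNIV. (mM.proj (wA p c h) k - mass (wA p c h) * p k)\<^sup>2) \<le> 3 * \<eta>)
    \<and> (\<forall>h\<in>hist n. \<theta> * (1 / real CARD('a)) ^ n * (\<Sum>l\<in>UNIV. (mN.proj (wB q d h) l - mass (wB q d h) * q l)\<^sup>2) \<le> 3 * \<eta>)"
proof -
  note p' = mM.canonD[OF p] and q' = mN.canonD[OF q]
  obtain n1 where "\<forall>p'\<in>mM.canon. \<forall>q'\<in>mN.canon. \<forall>t\<ge>n1. \<forall>s\<ge>n1.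
        f t p' q' - f s p' q' + \<theta> * (sq p' + sq q') \<le> \<delta> + \<eta>"
    using up[OF \<eta>(1)] ..
  note n1 = this[rule_format]
  \<comment> \<open>Past \<open>n0\<close> the error term of \<open>variance_bound\<close> is below \<open>\<eta>\<close>.\<close>
  obtain K :: nat where K: "(2 * real n + 2 * C) / \<eta> \<le> real K" using real_arch_simple by blast
  define n0 where "n0 = n1 + K + 1"
  have n0: "n1 \<le> n0" "K \<le> n0" "0 < n0" by (simp_all add: n0_def)
  have small: "(2 * real n + 2 * C) / real m \<le> \<eta>" if "n0 \<le> m" for m
  proof -
    have "real K \<le> real m" "0 < real m" using that n0 by simp_all
    have "2 * real n + 2 * C \<le> real K * \<eta>" using K \<eta>(1) by (simp add: pos_divide_le_eq)
    also have "\<dots> \<le> real m * \<eta>" using \<open>real K \<le> real m\<close> \<eta>(1) by (intro mult_right_mono) auto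
    finally show ?thesis using \<open>0 < real m\<close> by (simp add: pos_divide_le_eq mult.commute)
  qed
  let ?s = "\<theta> * (sq p + sq q)"
  obtain t1 s1 where ts1: "2 * (n0 + n) \<le> t1" "2 * (n0 + n) \<le> s1" "\<delta> - \<eta> \<le> f t1 p q - f s1 p q + ?s"
    using lo[OF \<eta>(1), of "2 * (n0 + n)"] by blast
  \<comment> \<open>At \<open>(p, q)\<close> the gap can exceed its value at \<open>t1\<close>, \<open>s1\<close> by at most \<open>2 \<eta>\<close>, which is less than \<open>\<epsilon> / 2\<close>.\<close>
  have "\<exists>t\<ge>n0 + n. f t1 p q \<le> f t p q \<and> f (t - n) p q \<le> f t p q + \<epsilon> * real n / real t"
  proof (rule descent[where \<phi> = "\<lambda>t. f t p q" and u = "\<delta> + \<eta> + f s1 p q - ?s", OF n(2) \<epsilon>(1) ts1(1)])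
    show "f t p q \<le> \<delta> + \<eta> + f s1 p q - ?s" if "n0 \<le> t" for t
      using n1[OF p q, of t s1] that n0 ts1(2) by simp
    show "\<delta> + \<eta> + f s1 p q - ?s < f t1 p q + \<epsilon> / 2"
      using ts1(3) \<eta> by linarith
  qed
  then obtain t where t: "n0 + n \<le> t" "f t1 p q \<le> f t p q" "f (t - n) p q \<le> f t p q + \<epsilon> * real n / real t" by blast
  have "\<exists>s\<ge>n0 + n. - f s1 p q \<le> - f s p q \<and> - f (s - n) p q \<le> - f s p q + \<epsilon> * real n / real s"
  proof (rule descent[where \<phi> = "\<lambda>s. - f s p q" and u = "\<delta> + \<eta> - f t p q - ?s", OF n(2) \<epsilon>(1) ts1(2)])
    show "- f s p q \<le> \<delta> + \<eta> - f t p q - ?s" if "n0 \<le> s" for s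
      using n1[OF p q, of t s] that n0 t(1) by simp
    show "\<delta> + \<eta> - f t p q - ?s < - f s1 p q + \<epsilon> / 2"
      using ts1(3) t(2) \<eta> by linarith
  qed
  then obtain s where s: "n0 + n \<le> s" "- f s1 p q \<le> - f s p q" "- f (s - n) p q \<le> - f s p q + \<epsilon> * real n / real s" by blast
  have gap: "\<delta> - \<eta> \<le> f t p q - f s p q + ?s" using ts1(3) t(2) s(2) by linarith
  define m m' where "m = t - n" and "m' = s - n"
  have m: "t = n + m" "n0 \<le> m" "0 < m" using t(1) n0 by (auto simp: m_def)
  have m': "s = n + m'" "n0 \<le> m'" "0 < m'" using s(1) n0 by (auto simp: m'_def)
  obtain c where "c \<in> A p"
    "\<And>d. d \<in> B q \<Longrightarrow> val (n + m) p q \<le> total n c d + (\<Sum>h\<in>hist n. val m (wA p c h) (wB q d h))"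
    by (rule val_block1[where n = n and m = m, OF p'(1) q'(1)], rule that)
  then have c: "block_optimal n m p q c" by (simp add: block_optimal_def)
  obtain d where "d \<in> B q"
    "\<And>c. c \<in> A p \<Longrightarrow> total n c d + (\<Sum>h\<in>hist n. val m' (wA p c h) (wB q d h)) \<le> val (n + m') p q"
    by (rule val_block2[where n = n and m = m', OF p'(1) q'(1)], rule that)
  then have d: "block_optimal' n m' p q d" by (simp add: block_optimal'_def)
  have "f t p q \<le> total n c d' / real n + 2 * \<epsilon>" if "d' \<in> B q" "nonrevealing' n q d'" for d'
    using nonrevealing_upper[OF p q n m(3) c that _ \<epsilon>] t(3) by (simp add: m)
  moreover have "total n c' d / real n - 2 * \<epsilon> \<le> f s p q" if "c' \<in> A p" "nonrevealing n p c'" for c'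
    using nonrevealing_lower[OF p q n m'(3) d that _ \<epsilon>] s(3) by (simp add: m')
  moreover have "\<theta> * (1 / real CARD('b)) ^ n * (\<Sum>k\<in>UNIV. (mM.proj (wA p c h) k - mass (wA p c h) * p k)\<^sup>2) \<le> 3 * \<eta>"
    if h: "h \<in> hist n" for h
  proof -
    have "\<theta> * (1 / real CARD('b)) ^ n * (\<Sum>k\<in>UNIV. (mM.proj (wA p c h) k - mass (wA p c h) * p k)\<^sup>2)
        \<le> (\<delta> + \<eta> - \<theta> * sq q) - (\<delta> - \<eta> - \<theta> * sq q) + (2 * real n + 2 * C) / real m"
    proof (rule variance_bound[OF p q n(1) m(3) c _ _ _ h, where S = s])
      show "f m p' q \<le> f s p' q + (\<delta> + \<eta> - \<theta> * sq q) - \<theta> * sq p'" if "p' \<in> mM.canon" for p'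
        using n1[OF that q, of m s] m(2) s(1) n0(1) by (simp add: algebra_simps)
      show "f s p q + (\<delta> - \<eta> - \<theta> * sq q) - \<theta> * sq p \<le> f (n + m) p q"
        using gap by (simp add: m(1) algebra_simps)
    qed (use \<theta> in simp)
    then show ?thesis using small[OF m(2)] by linarith
  qed
  moreover have "\<theta> * (1 / real CARD('a)) ^ n * (\<Sum>l\<in>UNIV. (mN.proj (wB q d h) l - mass (wB q d h) * q l)\<^sup>2) \<le> 3 * \<eta>"
    if h: "h \<in> hist n" for h
  proof -
    have "\<theta> * (1 / real CARD('a)) ^ n * (\<Sum>l\<in>UNIV. (mN.proj (wB q d h) l - mass (wB q d h) * q l)\<^sup>2)
        \<le> (\<delta> + \<eta> - \<theta> * sq p) - (\<delta> - \<eta> - \<theta> * sq p) + (2 * real n + 2 * C) / real m'"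
    proof (rule variance_bound'[OF p q n(1) m'(3) d _ _ _ h, where S = t])
      show "f t p q' - (\<delta> + \<eta> - \<theta> * sq p) + \<theta> * sq q' \<le> f m' p q'" if "q' \<in> mN.canon" for q'
        using n1[OF p that, of t m'] m'(2) t(1) n0(1) by (simp add: algebra_simps)
      show "f (n + m') p q \<le> f t p q - (\<delta> - \<eta> - \<theta> * sq p) + \<theta> * sq q"
        using gap by (simp add: m'(1) algebra_simps)
    qed (use \<theta> in simp)
    then show ?thesis using small[OF m'(2)] by linarith
  qed
  moreover have "c \<in> A p" "d \<in> B q" using c d by (auto simp: block_optimal_def block_optimal'_def)
  ultimately show ?thesis using gap by blast
qed

lemma limit_of_squares_zero:
  fixes x :: "nat \<Rightarrow> 's::finite \<Rightarrow> real"
  assumes lim: "\<And>k. (\<lambda>i. x i k) \<longlonglongrightarrow> y k" and e: "e \<longlonglongrightarrow> 0" and s: "0 < s"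
    and le: "\<And>i. s * (\<Sum>k\<in>UNIV. (x i k)\<^sup>2) \<le> e i"
  shows "y k = 0"
proof -
  have "(\<lambda>i. s * (\<Sum>k\<in>UNIV. (x i k)\<^sup>2)) \<longlonglongrightarrow> s * (\<Sum>k\<in>UNIV. (y k)\<^sup>2)"
    by (intro tendsto_mult tendsto_const tendsto_sum tendsto_power lim)
  then have "s * (\<Sum>k\<in>UNIV. (y k)\<^sup>2) \<le> 0"
    using e by (rule LIMSEQ_le) (use le in auto)
  then have "(\<Sum>k\<in>UNIV. (y k)\<^sup>2) \<le> 0" using s by (simp add: mult_le_0_iff)
  moreover have "(y k)\<^sup>2 \<le> (\<Sum>k\<in>UNIV. (y k)\<^sup>2)" by (intro member_le_sum) auto
  ultimately have "(y k)\<^sup>2 \<le> 0" by linarith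
  then show ?thesis by simp
qed

text \<open>
  The optimal plans for the first \<open>n\<close> stages of longer and longer games have limits \<open>c'\<close> and \<open>d'\<close> along a
  subsequence, and these are exactly non-revealing. So the optimal plans of Player 1 can be confronted
  with \<open>d'\<close> and those of Player 2 with \<open>c'\<close>. Both block payoffs converge to the payoff of \<open>c'\<close> against \<open>d'\<close>.
\<close>

lemma gap_at_maximiser:
  assumes p: "p \<in> mM.canon" and q: "q \<in> mN.canon" and \<epsilon>: "0 < \<epsilon>" and \<theta>: "0 < \<theta>"
    and up: "\<And>\<eta>. 0 < \<eta> \<Longrightarrow> \<exists>n0. \<forall>p'\<in>mM.canon. \<forall>q'\<in>mN.canon. \<forall>t\<ge>n0. \<forall>s\<ge>n0.
        f t p' q' - f s p' q' + \<theta> * (sq p' + sq q') \<le> \<delta> + \<eta>"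
    and lo: "\<And>\<eta> n0. 0 < \<eta> \<Longrightarrow> \<exists>t\<ge>n0. \<exists>s\<ge>n0. \<delta> - \<eta> \<le> f t p q - f s p q + \<theta> * (sq p + sq q)"
  shows "\<delta> \<le> \<theta> * (sq p + sq q) + 4 * \<epsilon>"
proof -
  note p' = mM.canonD[OF p] and q' = mN.canonD[OF q]
  obtain j0 :: nat where j0: "2 * C / \<epsilon> \<le> real j0" using real_arch_simple by blast
  \<comment> \<open>A block length that is a multiple of \<open>D\<close> and makes \<open>2 C / n\<close> at most \<open>\<epsilon>\<close>.\<close>
  define n where "n = Suc j0 * D"
  have n: "n = Suc j0 * D" "0 < n" using mM.D by (simp_all add: n_def)
  have "j0 \<le> n" using mM.D unfolding n_def by (cases D) auto
  then have "2 * C / \<epsilon> \<le> real n" using j0 by linarith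
  then have \<epsilon>n: "2 * C \<le> \<epsilon> * real n" using \<epsilon> by (simp add: pos_divide_le_eq mult.commute)
  define \<eta> where "\<eta> i = (\<epsilon> / 8) * inverse (real (Suc i))" for i
  have \<eta>: "0 < \<eta> i" "\<eta> i \<le> \<epsilon> / 8" for i
    using \<epsilon> by (simp_all add: \<eta>_def field_simps)
  have \<eta>0: "\<eta> \<longlonglongrightarrow> 0"
    using tendsto_mult[OF tendsto_const LIMSEQ_inverse_real_of_nat, of "\<epsilon> / 8"] by (simp add: \<eta>_def[abs_def])
  define P where "P i x \<longleftrightarrow> (case x of (t, s, c, d) \<Rightarrow>
      c \<in> A p \<and> d \<in> B q \<and> \<delta> - \<eta> i \<le> f t p q - f s p q + \<theta> * (sq p + sq q)
    \<and> (\<forall>d'\<in>B q. nonrevealing' n q d' \<longrightarrow> f t p q \<le> total n c d' / real n + 2 * \<epsilon>)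
    \<and> (\<forall>c'\<in>A p. nonrevealing n p c' \<longrightarrow> total n c' d / real n - 2 * \<epsilon> \<le> f s p q)
    \<and> (\<forall>h\<in>hist n. \<theta> * (1 / real CARD('b)) ^ n * (\<Sum>k\<in>UNIV. (mM.proj (wA p c h) k - mass (wA p c h) * p k)\<^sup>2) \<le> 3 * \<eta> i)
    \<and> (\<forall>h\<in>hist n. \<theta> * (1 / real CARD('a)) ^ n * (\<Sum>l\<in>UNIV. (mN.proj (wB q d h) l - mass (wB q d h) * q l)\<^sup>2) \<le> 3 * \<eta> i))" for i x
  have "\<forall>i. \<exists>x. P i x"
  proof
    fix i
    show "\<exists>x. P i x"
      using near_optimal_play[OF p q n \<epsilon> \<epsilon>n \<theta> up lo \<eta>] unfolding P_def by simp
  qed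
  from choice[OF this] obtain x where x: "\<And>i. P i (x i)" by blast
  define t s c d where "t i = fst (x i)" and "s i = fst (snd (x i))" and "c i = fst (snd (snd (x i)))"
    and "d i = snd (snd (snd (x i)))" for i
  have "x i = (t i, s i, c i, d i)" for i by (simp add: t_def s_def c_def d_def)
  then have P: "P i (t i, s i, c i, d i)" for i using x[of i] by simp
  have c: "c i \<in> A p" and d: "d i \<in> B q"
    and gap: "\<delta> - \<eta> i \<le> f (t i) p q - f (s i) p q + \<theta> * (sq p + sq q)" for i
    using P[of i] by (simp_all add: P_def)
  have upper: "f (t i) p q \<le> total n (c i) d' / real n + 2 * \<epsilon>" if "d' \<in> B q" "nonrevealing' n q d'" for i d'
    using P[of i] that by (simp add: P_def)
  have lower: "total n c' (d i) / real n - 2 * \<epsilon> \<le> f (s i) p q" if "c' \<in> A p" "nonrevealing n p c'" for i c'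
    using P[of i] that by (simp add: P_def)
  have var1: "\<theta> * (1 / real CARD('b)) ^ n * (\<Sum>k\<in>UNIV. (mM.proj (wA p (c i) h) k - mass (wA p (c i) h) * p k)\<^sup>2) \<le> 3 * \<eta> i"
    if "h \<in> hist n" for i h
    using P[of i] that by (simp add: P_def)
  have var2: "\<theta> * (1 / real CARD('a)) ^ n * (\<Sum>l\<in>UNIV. (mN.proj (wB q (d i) h) l - mass (wB q (d i) h) * q l)\<^sup>2) \<le> 3 * \<eta> i"
    if "h \<in> hist n" for i h
    using P[of i] that by (simp add: P_def)
  obtain r1 c' where r1: "strict_mono (r1 :: nat \<Rightarrow> nat)" and c1: "\<And>h a k. (\<lambda>i. c (r1 i) h a k) \<longlonglongrightarrow> c' h a k"
    and c': "c' \<in> A p"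
    by (rule plans_subseq[where c = c, OF M p'(1) c], rule that)
  obtain r2 d' where r2: "strict_mono (r2 :: nat \<Rightarrow> nat)" and d1: "\<And>h a k. (\<lambda>i. d (r1 (r2 i)) h a k) \<longlonglongrightarrow> d' h a k"
    and d': "d' \<in> B q"
    by (rule plans_subseq[where c = "\<lambda>i. d (r1 i)", OF N q'(1) d], rule that)
  define r where "r i = r1 (r2 i)" for i
  have r: "strict_mono r" using r1 r2 by (simp add: r_def strict_mono_def)
  have clim: "(\<lambda>i. c (r i) h a k) \<longlonglongrightarrow> c' h a k" for h a k
    using LIMSEQ_subseq_LIMSEQ[OF c1 r2] by (simp add: r_def o_def)
  have dlim: "(\<lambda>i. d (r i) h a k) \<longlonglongrightarrow> d' h a k" for h a k
    using d1 by (simp add: r_def)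
  have \<eta>r: "(\<lambda>i. \<eta> (r i)) \<longlonglongrightarrow> 0"
    using LIMSEQ_subseq_LIMSEQ[OF \<eta>0 r] by (simp add: o_def)
  have \<eta>r3: "(\<lambda>i. 3 * \<eta> (r i)) \<longlonglongrightarrow> 0"
    using tendsto_mult[OF tendsto_const \<eta>r, of 3] by simp
  have "nonrevealing n p c'"
    unfolding nonrevealing_def
  proof (intro ballI allI)
    fix h k assume h: "h \<in> (hist n :: 'e list set)"
    have w: "(\<lambda>i. wA p (c (r i)) h k) \<longlonglongrightarrow> wA p c' h k" for k by (rule tendsto_weights[OF clim])
    have "mM.proj (wA p c' h) k - mass (wA p c' h) * p k = 0"
    proof (rule limit_of_squares_zero[where s = "\<theta> * (1 / real CARD('b)) ^ n", OF _ \<eta>r3])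
      show "(\<lambda>i. mM.proj (wA p (c (r i)) h) k - mass (wA p (c (r i)) h) * p k)
          \<longlonglongrightarrow> mM.proj (wA p c' h) k - mass (wA p c' h) * p k" for k
        unfolding mM.proj_def by (intro tendsto_diff tendsto_sum tendsto_mult tendsto_const w)
      show "0 < \<theta> * (1 / real CARD('b)) ^ n" using \<theta> by simp
    qed (rule var1[OF h])
    then show "mM.proj (wA p c' h) k = mass (wA p c' h) * p k" by simp
  qed
  note nr1 = this
  have "nonrevealing' n q d'"
    unfolding nonrevealing'_def
  proof (intro ballI allI)
    fix h k assume h: "h \<in> (hist n :: 'e list set)"
    have w: "(\<lambda>i. wB q (d (r i)) h k) \<longlonglongrightarrow> wB q d' h k" for k by (rule tendsto_weights[OF dlim])
    have "mN.proj (wB q d' h) k - mass (wB q d' h) * q k = 0"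
    proof (rule limit_of_squares_zero[where s = "\<theta> * (1 / real CARD('a)) ^ n", OF _ \<eta>r3])
      show "(\<lambda>i. mN.proj (wB q (d (r i)) h) k - mass (wB q (d (r i)) h) * q k)
          \<longlonglongrightarrow> mN.proj (wB q d' h) k - mass (wB q d' h) * q k" for k
        unfolding mN.proj_def by (intro tendsto_diff tendsto_sum tendsto_mult tendsto_const w)
      show "0 < \<theta> * (1 / real CARD('a)) ^ n" using \<theta> by simp
    qed (rule var2[OF h])
    then show "mN.proj (wB q d' h) k = mass (wB q d' h) * q k" by simp
  qed
  note nr2 = this
  have le: "\<delta> - \<eta> (r i) - \<theta> * (sq p + sq q)
      \<le> total n (c (r i)) d' / real n - total n c' (d (r i)) / real n + 4 * \<epsilon>" for i
    using gap[of "r i"] upper[OF d' nr2, of "r i"] lower[OF c' nr1, of "r i"] by linarith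
  have "(\<lambda>i. total n (c (r i)) d' / real n - total n c' (d (r i)) / real n + 4 * \<epsilon>)
      \<longlonglongrightarrow> total n c' d' / real n - total n c' d' / real n + 4 * \<epsilon>"
    using n(2) by (intro tendsto_add tendsto_diff tendsto_divide tendsto_total tendsto_const clim dlim) simp_all
  moreover have "(\<lambda>i. \<delta> - \<eta> (r i) - \<theta> * (sq p + sq q)) \<longlonglongrightarrow> \<delta> - 0 - \<theta> * (sq p + sq q)"
    by (intro tendsto_diff tendsto_const \<eta>r)
  ultimately have "\<delta> - 0 - \<theta> * (sq p + sq q) \<le> total n c' d' / real n - total n c' d' / real n + 4 * \<epsilon>"
    using le by (intro LIMSEQ_le) blast+
  then show ?thesis by simp
qed

lemma f_bound:
  assumes "nonneg p" "nonneg q" "mass p = 1" "mass q = 1"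
  shows "\<bar>f t p q\<bar> \<le> 1"
  using val_bound[where n = t, OF assms(1,2)] assms(3,4) by (cases "t = 0") (simp_all add: abs_divide field_simps)

lemma f_lipschitz:
  assumes "nonneg p" "nonneg q" "mass p = 1" "mass q = 1" "nonneg p'" "nonneg q'" "mass p' = 1" "mass q' = 1"
  shows "\<bar>f t p q - f t p' q'\<bar> \<le> (\<Sum>k\<in>UNIV. \<bar>p k - p' k\<bar>) + (\<Sum>l\<in>UNIV. \<bar>q l - q' l\<bar>)"
proof (cases "t = 0")
  case True
  then show ?thesis by (simp add: sum_nonneg)
next
  case False
  have "\<bar>val t p q - val t p' q\<bar> \<le> real t * (\<Sum>k\<in>UNIV. \<bar>p k - p' k\<bar>)"
    using val_lipschitz_left[where n = t, OF assms(1,5,2)] assms(4) by simp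
  moreover have "\<bar>val t p' q - val t p' q'\<bar> \<le> real t * (\<Sum>l\<in>UNIV. \<bar>q l - q' l\<bar>)"
    using val_lipschitz_right[where n = t, OF assms(5,2,6)] assms(7) by simp
  ultimately have "\<bar>val t p q - val t p' q'\<bar> \<le> real t * ((\<Sum>k\<in>UNIV. \<bar>p k - p' k\<bar>) + (\<Sum>l\<in>UNIV. \<bar>q l - q' l\<bar>))"
    by (simp add: ring_distribs)
  moreover have "\<bar>f t p q - f t p' q'\<bar> = \<bar>val t p q - val t p' q'\<bar> / real t"
    by (simp add: diff_divide_distrib[symmetric])
  ultimately show ?thesis using False by (simp add: pos_divide_le_eq mult.commute)
qed

text \<open>
  \<open>\<delta>\<close> is the upper limit, over all pairs of laws and all long games, of the gap perturbed by \<open>\<theta>\<close>. It is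
  approached along laws that converge to a pair \<open>(p, q)\<close>, and since the mean values are Lipschitz
  uniformly in the length, it is approached at this pair itself.
\<close>

lemma uniform_convergence_canon:
  assumes \<zeta>: "0 < \<zeta>"
  shows "\<exists>n0. \<forall>p\<in>mM.canon. \<forall>q\<in>mN.canon. \<forall>t\<ge>n0. \<forall>s\<ge>n0. f t p q - f s p q \<le> \<zeta>"
proof (cases "mM.canon = {} \<or> mN.canon = {}")
  case True
  then show ?thesis by blast
next
  case False
  then obtain p0 q0 where p0: "p0 \<in> mM.canon" "q0 \<in> mN.canon" by blast
  define \<theta> where "\<theta> = \<zeta> / 4"
  have \<theta>: "0 < \<theta>" using \<zeta> by (simp add: \<theta>_def)
  define H where "H x = (case x of (p, q, t, s) \<Rightarrow> f t p q - f s p q + \<theta> * (sq p + sq q))" for x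
  define X where "X n = mM.canon \<times> mN.canon \<times> {n..} \<times> {n..}" for n :: nat
  have Hb: "\<bar>H x\<bar> \<le> 2 + 2 * \<theta>" if x: "x \<in> X n" for x n
  proof -
    obtain p q t s where x_eq: "x = (p, q, t, s)" and pq: "p \<in> mM.canon" "q \<in> mN.canon"
      using x by (auto simp: X_def)
    note p' = mM.canonD[OF pq(1)] and q' = mN.canonD[OF pq(2)]
    have "0 \<le> \<theta> * (sq p + sq q)" "\<theta> * (sq p + sq q) \<le> \<theta> * 2"
      using sq_bound[OF p'(1,2)] sq_bound[OF q'(1,2)] \<theta> by (auto intro!: mult_nonneg_nonneg mult_left_mono)
    moreover have "H x = f t p q - f s p q + \<theta> * (sq p + sq q)" by (simp add: H_def x_eq)
    ultimately show ?thesis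
      using f_bound[OF p'(1) q'(1) p'(2) q'(2), of t] f_bound[OF p'(1) q'(1) p'(2) q'(2), of s]
      by linarith
  qed
  have ne: "X n \<noteq> {}" for n using p0 by (auto simp: X_def)
  have bdd: "bdd_above (H ` X n)" for n
    by (rule bdd_aboveI2[of _ _ "2 + 2 * \<theta>"]) (use Hb[of _ n] in \<open>auto simp: abs_le_iff\<close>)
  define G where "G n = Sup (H ` X n)" for n
  have HG: "H x \<le> G n" if "x \<in> X n" for x n
    unfolding G_def using that bdd by (intro cSup_upper) auto
  have Gb: "bdd_below (range G)"
  proof (rule bdd_belowI2)
    show "- (2 + 2 * \<theta>) \<le> G n" for n
    proof -
      obtain x where x: "x \<in> X n" using ne by blast
      show ?thesis using HG[OF x] Hb[OF x] by (simp add: abs_le_iff)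
    qed
  qed
  define \<delta> where "\<delta> = Inf (range G)"
  have up: "\<exists>n0. \<forall>p'\<in>mM.canon. \<forall>q'\<in>mN.canon. \<forall>t\<ge>n0. \<forall>s\<ge>n0.
        f t p' q' - f s p' q' + \<theta> * (sq p' + sq q') \<le> \<delta> + \<eta>" if "0 < \<eta>" for \<eta>
  proof -
    have "Inf (range G) < \<delta> + \<eta>" using that by (simp add: \<delta>_def)
    then obtain n where n: "G n < \<delta> + \<eta>" using cInf_lessD[of "range G" "\<delta> + \<eta>"] by blast
    have "f t p' q' - f s p' q' + \<theta> * (sq p' + sq q') \<le> \<delta> + \<eta>"
      if "p' \<in> mM.canon" "q' \<in> mN.canon" "n \<le> t" "n \<le> s" for p' q' t s
      using HG[of "(p', q', t, s)" n] that n by (simp add: X_def H_def)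
    then show ?thesis by blast
  qed
  have "\<exists>x\<in>X i. \<delta> - inverse (real (Suc i)) < H x" for i
  proof -
    have "\<delta> \<le> G i" unfolding \<delta>_def using Gb by (intro cInf_lower) auto
    moreover have "0 < inverse (real (Suc i))" by simp
    ultimately have "\<delta> - inverse (real (Suc i)) < Sup (H ` X i)" unfolding G_def by linarith
    then show ?thesis using less_cSupD[of "H ` X i"] ne by blast
  qed
  then have "\<forall>i. \<exists>x. x \<in> X i \<and> \<delta> - inverse (real (Suc i)) < H x" by blast
  from choice[OF this] obtain x where x: "\<And>i. x i \<in> X i" "\<And>i. \<delta> - inverse (real (Suc i)) < H (x i)" by blast
  define P Q t s where "P i = fst (x i)" and "Q i = fst (snd (x i))" and "t i = fst (snd (snd (x i)))"
    and "s i = snd (snd (snd (x i)))" for i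
  have x_eq: "x i = (P i, Q i, t i, s i)" for i by (simp add: P_def Q_def t_def s_def)
  have P: "P i \<in> mM.canon" and Q: "Q i \<in> mN.canon" and ts: "i \<le> t i" "i \<le> s i" for i
    using x(1)[of i] by (simp_all add: x_eq X_def)
  obtain r1 p where r1: "strict_mono (r1 :: nat \<Rightarrow> nat)" and p1: "\<And>k. (\<lambda>i. P (r1 i) k) \<longlonglongrightarrow> p k" and p: "p \<in> mM.canon"
    by (rule mM.canon_subseq[where x = P, OF P], rule that)
  obtain r2 q where r2: "strict_mono (r2 :: nat \<Rightarrow> nat)" and q1: "\<And>k. (\<lambda>i. Q (r1 (r2 i)) k) \<longlonglongrightarrow> q k" and q: "q \<in> mN.canon"
    by (rule mN.canon_subseq[where x = "\<lambda>i. Q (r1 i)", OF Q], rule that)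
  define r where "r i = r1 (r2 i)" for i
  have r: "strict_mono r" using r1 r2 by (simp add: r_def strict_mono_def)
  have plim: "(\<lambda>i. P (r i) k) \<longlonglongrightarrow> p k" for k
    using LIMSEQ_subseq_LIMSEQ[OF p1 r2] by (simp add: r_def o_def)
  have qlim: "(\<lambda>i. Q (r i) k) \<longlonglongrightarrow> q k" for k
    using q1 by (simp add: r_def)
  define e where "e i = 2 * ((\<Sum>k\<in>UNIV. \<bar>P (r i) k - p k\<bar>) + (\<Sum>l\<in>UNIV. \<bar>Q (r i) l - q l\<bar>))
      + \<theta> * (\<bar>sq (P (r i)) - sq p\<bar> + \<bar>sq (Q (r i)) - sq q\<bar>) + inverse (real (Suc (r i)))" for i
  have e: "e \<longlonglongrightarrow> 0"
  proof -
    have "(\<lambda>i. \<bar>P (r i) k - p k\<bar>) \<longlonglongrightarrow> 0" for k using tendsto_rabs[OF tendsto_diff[OF plim[of k] tendsto_const[of "p k"]]] by simp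
    then have 1: "(\<lambda>i. \<Sum>k\<in>UNIV. \<bar>P (r i) k - p k\<bar>) \<longlonglongrightarrow> 0" by (rule tendsto_null_sum)
    have "(\<lambda>i. \<bar>Q (r i) k - q k\<bar>) \<longlonglongrightarrow> 0" for k using tendsto_rabs[OF tendsto_diff[OF qlim[of k] tendsto_const[of "q k"]]] by simp
    then have 2: "(\<lambda>i. \<Sum>k\<in>UNIV. \<bar>Q (r i) k - q k\<bar>) \<longlonglongrightarrow> 0" by (rule tendsto_null_sum)
    have "(\<lambda>i. sq (P (r i))) \<longlonglongrightarrow> sq p" unfolding sq_def by (intro tendsto_sum tendsto_power plim)
    then have 3: "(\<lambda>i. \<bar>sq (P (r i)) - sq p\<bar>) \<longlonglongrightarrow> 0" using tendsto_rabs[OF tendsto_diff[OF \<open>(\<lambda>i. sq (P (r i))) \<longlonglongrightarrow> sq p\<close> tendsto_const[of "sq p"]]] by simp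
    have "(\<lambda>i. sq (Q (r i))) \<longlonglongrightarrow> sq q" unfolding sq_def by (intro tendsto_sum tendsto_power qlim)
    then have 4: "(\<lambda>i. \<bar>sq (Q (r i)) - sq q\<bar>) \<longlonglongrightarrow> 0" using tendsto_rabs[OF tendsto_diff[OF \<open>(\<lambda>i. sq (Q (r i))) \<longlonglongrightarrow> sq q\<close> tendsto_const[of "sq q"]]] by simp
    have 5: "(\<lambda>i. inverse (real (Suc (r i)))) \<longlonglongrightarrow> 0"
      using LIMSEQ_subseq_LIMSEQ[OF LIMSEQ_inverse_real_of_nat r] by (simp add: o_def)
    have "(\<lambda>i. 2 * ((\<Sum>k\<in>UNIV. \<bar>P (r i) k - p k\<bar>) + (\<Sum>l\<in>UNIV. \<bar>Q (r i) l - q l\<bar>))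
      + \<theta> * (\<bar>sq (P (r i)) - sq p\<bar> + \<bar>sq (Q (r i)) - sq q\<bar>) + inverse (real (Suc (r i)))) \<longlonglongrightarrow> 2 * (0 + 0) + \<theta> * (0 + 0) + 0"
      by (intro tendsto_add tendsto_mult tendsto_const 1 2 3 4 5)
    then show ?thesis by (simp add: e_def[abs_def])
  qed
  have lo: "\<exists>t\<ge>n0. \<exists>s\<ge>n0. \<delta> - \<eta> \<le> f t p q - f s p q + \<theta> * (sq p + sq q)" if \<eta>: "0 < \<eta>" for \<eta> n0
  proof -
    have "eventually (\<lambda>i. e i < \<eta>) sequentially" using order_tendstoD(2)[OF e \<eta>] .
    moreover have "eventually (\<lambda>i. n0 \<le> i) sequentially" by (rule eventually_ge_at_top)
    ultimately have "eventually (\<lambda>i. e i < \<eta> \<and> n0 \<le> i) sequentially" by (rule eventually_conj)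
    then obtain i where i: "e i < \<eta>" "n0 \<le> i" unfolding eventually_sequentially by blast
    have ri: "n0 \<le> r i" using seq_suble[OF r, of i] i(2) by simp
    note p' = mM.canonD[OF p] and q' = mN.canonD[OF q] and Pi = mM.canonD[OF P[of "r i"]] and Qi = mN.canonD[OF Q[of "r i"]]
    let ?t = "t (r i)" and ?s = "s (r i)"
    define a where "a = (\<Sum>k\<in>UNIV. \<bar>P (r i) k - p k\<bar>) + (\<Sum>l\<in>UNIV. \<bar>Q (r i) l - q l\<bar>)"
    define b where "b = \<theta> * (\<bar>sq (P (r i)) - sq p\<bar> + \<bar>sq (Q (r i)) - sq q\<bar>)"
    have e_eq: "e i = 2 * a + b + inverse (real (Suc (r i)))" by (simp add: e_def a_def b_def)
    have "\<bar>f ?t (P (r i)) (Q (r i)) - f ?t p q\<bar> \<le> a"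
      unfolding a_def by (rule f_lipschitz[OF Pi(1) Qi(1) Pi(2) Qi(2) p'(1) q'(1) p'(2) q'(2)])
    moreover have "\<bar>f ?s (P (r i)) (Q (r i)) - f ?s p q\<bar> \<le> a"
      unfolding a_def by (rule f_lipschitz[OF Pi(1) Qi(1) Pi(2) Qi(2) p'(1) q'(1) p'(2) q'(2)])
    moreover have "\<theta> * (sq (P (r i)) + sq (Q (r i))) - \<theta> * (sq p + sq q) \<le> b"
      unfolding b_def right_diff_distrib[symmetric] using \<theta> by (intro mult_left_mono) auto
    moreover have "\<delta> - inverse (real (Suc (r i))) < f ?t (P (r i)) (Q (r i)) - f ?s (P (r i)) (Q (r i)) + \<theta> * (sq (P (r i)) + sq (Q (r i)))"
      using x(2)[of "r i"] by (simp add: H_def x_eq)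
    ultimately have "\<delta> - e i \<le> f ?t p q - f ?s p q + \<theta> * (sq p + sq q)"
      unfolding e_eq by linarith
    then have "\<delta> - \<eta> \<le> f ?t p q - f ?s p q + \<theta> * (sq p + sq q)" using i(1) by linarith
    moreover have "n0 \<le> ?t" "n0 \<le> ?s" using ts[of "r i"] ri by linarith+
    ultimately show ?thesis by blast
  qed
  have "\<delta> \<le> \<theta> * (sq p + sq q)"
  proof (rule field_le_epsilon)
    fix \<epsilon> :: real assume "0 < \<epsilon>"
    then show "\<delta> \<le> \<theta> * (sq p + sq q) + \<epsilon>"
      using gap_at_maximiser[OF p q, of "\<epsilon> / 4", OF _ \<theta> up lo] by simp
  qed
  also have "\<dots> \<le> \<theta> * 2"
    using sq_bound[OF mM.canonD(1,2)[OF p]] sq_bound[OF mN.canonD(1,2)[OF q]] \<theta> by (intro mult_left_mono) auto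
  finally have \<delta>: "\<delta> \<le> \<zeta> / 2" by (simp add: \<theta>_def)
  have "0 < \<zeta> / 2" using \<zeta> by simp
  from up[OF this] obtain n0 where "\<forall>p'\<in>mM.canon. \<forall>q'\<in>mN.canon. \<forall>t\<ge>n0. \<forall>s\<ge>n0.
      f t p' q' - f s p' q' + \<theta> * (sq p' + sq q') \<le> \<delta> + \<zeta> / 2" ..
  note n0 = this[rule_format]
  have "f t p' q' - f s p' q' \<le> \<zeta>" if "p' \<in> mM.canon" "q' \<in> mN.canon" "n0 \<le> t" "n0 \<le> s" for p' q' t s
  proof -
    have "0 \<le> \<theta> * (sq p' + sq q')"
      using sq_bound(1)[OF mM.canonD(1,2)[OF that(1)]] sq_bound(1)[OF mN.canonD(1,2)[OF that(2)]] \<theta> by simp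
    then show ?thesis using n0[OF that] \<delta> by linarith
  qed
  then show ?thesis by blast
qed

text \<open>
  Let both players ignore their information for \<open>j\<close> blocks. Then the transient states have mass at most
  \<open>(1 - \<alpha>)\<^sup>j\<close>, and what remains may be concentrated in the representatives of the classes.
\<close>

lemma f_near_canonical:
  assumes p: "nonneg p" "mass p = 1" and q: "nonneg q" "mass q = 1" and t: "j * D \<le> t"
  defines "z \<equiv> mM.proj ((step M ^^ (j * D)) p)" and "w \<equiv> mN.proj ((step N ^^ (j * D)) q)"
  shows "\<bar>val t p q - val t z w\<bar> \<le> 2 * real (j * D) + 2 * C + 2 * (1 - \<alpha>) ^ j * real t"
proof -
  define n where "n = j * D"
  define m where "m = t - n"
  have t_eq: "t = n + m" "t = m + n" using t by (simp_all add: n_def m_def)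
  define p1 q1 where "p1 = (step M ^^ n) p" and "q1 = (step N ^^ n) q"
  have p1: "nonneg p1" "mass p1 = 1" and q1: "nonneg q1" "mass q1 = 1"
    using p q by (simp_all add: p1_def q1_def steps_nonneg[OF M] steps_nonneg[OF N] mass_steps[OF M] mass_steps[OF N])
  define p2 where "p2 k = (if k \<in> mM.R then p1 k else 0)" for k
  define q2 where "q2 l = (if l \<in> mN.R then q1 l else 0)" for l
  have p2: "nonneg p2" "mM.recurrent p2" and q2: "nonneg q2" "mN.recurrent q2"
    using p1(1) q1(1) by (auto simp: p2_def q2_def nonneg_def mM.recurrent_def mN.recurrent_def)
  have pz: "mM.proj p2 = z" and qw: "mN.proj q2 = w"
    by (simp_all add: z_def w_def p1_def[symmetric] q1_def[symmetric] n_def[symmetric] mM.proj_alt mN.proj_alt p2_def q2_def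
        fun_eq_iff cong: if_cong)
  have p2m: "mass p2 \<le> 1"
  proof -
    have "mass p2 \<le> mass p1" using nonnegD[OF p1(1)] by (intro sum_mono) (simp add: p2_def)
    then show ?thesis using p1 by simp
  qed
  have q2m: "mass q2 \<le> 1"
  proof -
    have "mass q2 \<le> mass q1" using nonnegD[OF q1(1)] by (intro sum_mono) (simp add: q2_def)
    then show ?thesis using q1 by simp
  qed
  have z: "nonneg z" "mM.recurrent z" "mM.proj z = z" "mass z = mass p2"
    using mM.proj_nonneg[OF p2(1)] mM.mass_proj_recurrent[OF p2(2)] mM.proj_recurrent[of p2] mM.proj_proj[of p2]
    by (simp_all add: pz)
  have w: "nonneg w" "mN.recurrent w" "mN.proj w = w" "mass w = mass q2"
    using mN.proj_nonneg[OF q2(1)] mN.mass_proj_recurrent[OF q2(2)] mN.proj_recurrent[of q2] mN.proj_proj[of q2]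
    by (simp_all add: qw)
  have mass01: "0 \<le> mass p2" "0 \<le> mass q2" using p2 q2 by (simp_all add: mass_nonneg)
  let ?\<kappa> = "(1 - \<alpha>) ^ j"
  have tr1: "(\<Sum>k\<in>UNIV. \<bar>p1 k - p2 k\<bar>) \<le> ?\<kappa>"
  proof -
    have "(\<Sum>k\<in>UNIV. \<bar>p1 k - p2 k\<bar>) = (\<Sum>k\<in>- mM.R. p1 k)"
      using nonnegD[OF p1(1)] by (intro sum.mono_neutral_cong_right) (auto simp: p2_def)
    then show ?thesis using mM.transient_mass[OF p(1), of j] p(2) by (simp add: p1_def n_def)
  qed
  have tr2: "(\<Sum>k\<in>UNIV. \<bar>q1 k - q2 k\<bar>) \<le> ?\<kappa>"
  proof -
    have "(\<Sum>k\<in>UNIV. \<bar>q1 k - q2 k\<bar>) = (\<Sum>k\<in>- mN.R. q1 k)"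
      using nonnegD[OF q1(1)] by (intro sum.mono_neutral_cong_right) (auto simp: q2_def)
    then show ?thesis using mN.transient_mass[OF q(1), of j] q(2) by (simp add: q1_def n_def)
  qed
  have \<kappa>: "0 \<le> ?\<kappa>" using mM.\<alpha> by simp
  have 1: "\<bar>val t p q - val m p1 q1\<bar> \<le> real n"
    using val_run[where n = n and m = m, OF p(1) q(1)] p(2) q(2) by (simp add: t_eq(1) p1_def q1_def)
  have 2: "\<bar>val m p1 q1 - val m p2 q1\<bar> \<le> real m * ?\<kappa>"
    using val_lipschitz_left[where n = m, OF p1(1) p2(1) q1(1)] q1(2) mult_left_mono[OF tr1, of "real m"] by simp
  have 3: "\<bar>val m p2 q1 - val m p2 q2\<bar> \<le> real m * ?\<kappa>"
  proof -
    have "\<bar>val m p2 q1 - val m p2 q2\<bar> \<le> real m * (\<Sum>l\<in>UNIV. \<bar>q1 l - q2 l\<bar>) * mass p2"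
      by (rule val_lipschitz_right[OF p2(1) q1(1) q2(1)])
    also have "\<dots> \<le> (real m * ?\<kappa>) * 1"
      using tr2 p2m mass01 \<kappa> by (intro mult_mono mult_left_mono mult_nonneg_nonneg) auto
    finally show ?thesis by simp
  qed
  have CC: "C * mass p2 * mass q2 \<le> C"
  proof -
    have "mass p2 * mass q2 \<le> 1 * 1" using p2m q2m mass01 by (intro mult_mono) auto
    then have "C * (mass p2 * mass q2) \<le> C * 1" using C_nonneg by (intro mult_left_mono) auto
    then show ?thesis by (simp add: mult.assoc)
  qed
  have 4: "\<bar>val m p2 q2 - val m z q2\<bar> \<le> C"
    using merge_left[of p2 z q2 m, OF p2(1) z(1) q2(1) p2(2) z(2)] CC by (simp add: pz z(3))
  have 5: "\<bar>val m z q2 - val m z w\<bar> \<le> C"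
    using merge_right[of z q2 w m, OF z(1) q2(1) w(1) q2(2) w(2)] CC by (simp add: qw w(3) z(4))
  have 6: "\<bar>val t z w - val m z w\<bar> \<le> real n"
  proof -
    have "mass z * mass w \<le> 1 * 1" using p2m q2m mass01 by (intro mult_mono) (auto simp: z w)
    then have "real n * (mass z * mass w) \<le> real n * 1" by (intro mult_left_mono) auto
    then show ?thesis
      using val_extend[where m = m and n = n, OF z(1) w(1)] by (simp add: t_eq(2) mult.assoc)
  qed
  have "\<bar>val t p q - val t z w\<bar> \<le> 2 * real n + 2 * C + 2 * (real m * ?\<kappa>)"
    using 1 2 3 4 5 6 by linarith
  also have "\<dots> \<le> 2 * real n + 2 * C + 2 * (real t * ?\<kappa>)"
    using \<kappa> by (intro add_left_mono mult_left_mono mult_right_mono) (auto simp: t_eq)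
  finally show ?thesis by (simp add: n_def mult_ac)
qed

lemma val_canonical_scale:
  assumes "nonneg z" "mM.proj z = z" "nonneg w" "mN.proj w = w" "mass z \<le> 1" "mass w \<le> 1"
    and le: "\<And>p q. p \<in> mM.canon \<Longrightarrow> q \<in> mN.canon \<Longrightarrow> f t p q - f s p q \<le> \<zeta>" and \<zeta>: "0 \<le> \<zeta>"
  shows "f t z w - f s z w \<le> \<zeta>"
proof (cases "mass z = 0 \<or> mass w = 0")
  case True
  then show ?thesis
    using val_bound[where n = t, OF assms(1,3)] val_bound[where n = s, OF assms(1,3)] \<zeta> by auto
next
  case False
  define z' where "z' k = z k / mass z" for k
  define w' where "w' k = w k / mass w" for k
  have z': "z' \<in> mM.canon" and w': "w' \<in> mN.canon"
    using mM.normalize_canon[OF assms(1,2)] mN.normalize_canon[OF assms(3,4)] False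
    by (simp_all add: z'_def[abs_def] w'_def[abs_def])
  have eq: "z = (\<lambda>k. mass z * z' k)" "w = (\<lambda>k. mass w * w' k)" using False by (simp_all add: z'_def w'_def)
  have nn: "0 \<le> mass z" "0 \<le> mass w" using assms by (simp_all add: mass_nonneg)
  have v: "val n z w = mass z * mass w * val n z' w'" for n
  proof -
    have "val n z w = val n (\<lambda>k. mass z * z' k) w" using eq(1) by simp
    also have "\<dots> = mass z * val n z' w" by (rule val_scale_left[OF mM.canonD(1)[OF z'] assms(3) nn(1)])
    also have "val n z' w = val n z' (\<lambda>k. mass w * w' k)" using eq(2) by simp
    also have "\<dots> = mass w * val n z' w'" by (rule val_scale_right[OF mM.canonD(1)[OF z'] mN.canonD(1)[OF w'] nn(2)])
    finally show ?thesis by simp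
  qed
  have "f t z w - f s z w = (mass z * mass w) * (f t z' w' - f s z' w')"
    unfolding v by (simp add: algebra_simps)
  also have "\<dots> \<le> (mass z * mass w) * \<zeta>" using le[OF z' w'] nn by (intro mult_left_mono) auto
  also have "\<dots> \<le> 1 * \<zeta>"
    using assms(5,6) nn \<zeta> mult_mono[of "mass z" 1 "mass w" 1] by (intro mult_right_mono) auto
  finally show ?thesis by simp
qed

theorem val_average_convergent:
  assumes p: "nonneg p" "mass p = 1" and q: "nonneg q" "mass q = 1"
  shows "convergent (\<lambda>t. f t p q)"
proof -
  have one_sided: "\<exists>n0. \<forall>t\<ge>n0. \<forall>s\<ge>n0. f t p q - f s p q \<le> \<zeta>" if \<zeta>: "0 < \<zeta>" for \<zeta>
  proof -
    have "(\<lambda>j. (1 - \<alpha>) ^ j) \<longlonglongrightarrow> 0" using mM.\<alpha> by (intro LIMSEQ_power_zero) (simp add: abs_if)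
    moreover have "0 < \<zeta> / 8" using \<zeta> by simp
    ultimately have "eventually (\<lambda>j. (1 - \<alpha>) ^ j < \<zeta> / 8) sequentially" by (rule order_tendstoD(2))
    then obtain j where j: "(1 - \<alpha>) ^ j < \<zeta> / 8" unfolding eventually_sequentially by blast
    define z w where "z = mM.proj ((step M ^^ (j * D)) p)" and "w = mN.proj ((step N ^^ (j * D)) q)"
    have nn: "nonneg ((step M ^^ (j * D)) p)" "nonneg ((step N ^^ (j * D)) q)"
      using steps_nonneg[OF M p(1)] steps_nonneg[OF N q(1)] by auto
    have z: "nonneg z" "mM.proj z = z" "mass z \<le> 1"
    proof -
      show "nonneg z" "mM.proj z = z" by (simp_all add: z_def mM.proj_nonneg nn mM.proj_proj)
      have "mass z \<le> mass ((step M ^^ (j * D)) p)"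
        unfolding z_def mM.mass_proj using nonnegD[OF nn(1)] by (intro sum_mono2) auto
      then show "mass z \<le> 1" by (simp add: mass_steps[OF M] p(2))
    qed
    have w: "nonneg w" "mN.proj w = w" "mass w \<le> 1"
    proof -
      show "nonneg w" "mN.proj w = w" by (simp_all add: w_def mN.proj_nonneg nn mN.proj_proj)
      have "mass w \<le> mass ((step N ^^ (j * D)) q)"
        unfolding w_def mN.mass_proj using nonnegD[OF nn(2)] by (intro sum_mono2) auto
      then show "mass w \<le> 1" by (simp add: mass_steps[OF N] q(2))
    qed
    have "0 < \<zeta> / 4" using \<zeta> by simp
    from uniform_convergence_canon[OF this] obtain n1 where
      "\<forall>p\<in>mM.canon. \<forall>q\<in>mN.canon. \<forall>t\<ge>n1. \<forall>s\<ge>n1. f t p q - f s p q \<le> \<zeta> / 4" ..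
    note n1 = this[rule_format]
    obtain K :: nat where K: "(2 * real (j * D) + 2 * C) / (\<zeta> / 8) \<le> real K" using real_arch_simple by blast
    define n0 where "n0 = n1 + j * D + K + 1"
    have near: "\<bar>f t p q - f t z w\<bar> \<le> 3 * \<zeta> / 8" if t: "n0 \<le> t" for t
    proof -
      have tpos: "0 < real t" and jt: "j * D \<le> t" and Kt: "real K \<le> real t" using t by (auto simp: n0_def)
      have "2 * real (j * D) + 2 * C \<le> real K * (\<zeta> / 8)" using K \<zeta> by (simp add: pos_divide_le_eq)
      also have "\<dots> \<le> real t * (\<zeta> / 8)" using Kt \<zeta> by (intro mult_right_mono) auto
      finally have a: "2 * real (j * D) + 2 * C \<le> real t * (\<zeta> / 8)" .
      have b: "2 * (1 - \<alpha>) ^ j * real t \<le> 2 * (\<zeta> / 8) * real t" using j tpos by (intro mult_right_mono) auto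
      have "\<bar>val t p q - val t z w\<bar> \<le> real t * (3 * \<zeta> / 8)"
        using f_near_canonical[OF p q jt] a b unfolding z_def[symmetric] w_def[symmetric] by (simp add: algebra_simps)
      moreover have "\<bar>f t p q - f t z w\<bar> = \<bar>val t p q - val t z w\<bar> / real t"
        by (simp add: diff_divide_distrib[symmetric])
      ultimately show ?thesis using tpos by (simp only: pos_divide_le_eq mult.commute)
    qed
    have "f t p q - f s p q \<le> \<zeta>" if ts: "n0 \<le> t" "n0 \<le> s" for t s
    proof -
      have "f t z w - f s z w \<le> \<zeta> / 4"
      proof (rule val_canonical_scale[OF z(1,2) w(1,2) z(3) w(3)])
        show "f t x y - f s x y \<le> \<zeta> / 4" if "x \<in> mM.canon" "y \<in> mN.canon" for x y
          using n1[OF that, of t s] ts by (simp add: n0_def)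
      qed (use \<zeta> in simp)
      then show ?thesis using near[OF ts(1)] near[OF ts(2)] by linarith
    qed
    then show ?thesis by blast
  qed
  have "Cauchy (\<lambda>t. f t p q)"
  proof (rule metric_CauchyI)
    fix \<zeta> :: real assume "0 < \<zeta>"
    then have "0 < \<zeta> / 2" by simp
    from one_sided[OF this] obtain n0 where n0: "\<And>t s. n0 \<le> t \<Longrightarrow> n0 \<le> s \<Longrightarrow> f t p q - f s p q \<le> \<zeta> / 2" by blast
    have "dist (f t p q) (f s p q) < \<zeta>" if "n0 \<le> t" "n0 \<le> s" for t s
      unfolding dist_real_def using n0[OF that] n0[OF that(2,1)] \<open>0 < \<zeta>\<close> by linarith
    then show "\<exists>n0. \<forall>t\<ge>n0. \<forall>s\<ge>n0. dist (f t p q) (f s p q) < \<zeta>" by blast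
  qed
  then show ?thesis by (simp add: Cauchy_convergent_iff)
qed

end

section \<open>Strategies and plans\<close>

lemma pmf_exists:
  fixes x :: "'a::finite \<Rightarrow> real"
  assumes "\<And>a. 0 \<le> x a" "(\<Sum>a\<in>UNIV. x a) = 1"
  shows "\<exists>\<pi>. \<forall>a. pmf \<pi> a = x a"
proof -
  have "(\<integral>\<^sup>+ a. ennreal (x a) \<partial>count_space UNIV) = 1"
    using assms by (simp add: nn_integral_count_space_finite sum_ennreal)
  then show ?thesis using pmf_embed_pmf[of x] assms(1) by blast
qed

lemma sum_pmf_UNIV [simp]: "(\<Sum>a\<in>UNIV. pmf (\<pi> :: 'a::finite pmf) a) = 1"
  by (rule sum_pmf_eq_1) auto

text \<open>
  The contribution of one player to the probability that the states are \<open>ks\<close> and the actions are \<open>h\<close>, where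
  both lists have the same length.
\<close>

definition path_weight ::
  "('e \<Rightarrow> 'a) \<Rightarrow> ('s \<Rightarrow> 's pmf) \<Rightarrow> 's pmf \<Rightarrow> ('e list \<Rightarrow> 's list \<Rightarrow> 'a pmf) \<Rightarrow> 's list \<Rightarrow> 'e list \<Rightarrow> real" where
  "path_weight sel P p \<sigma> ks h =
     (\<Prod>t<length h. pmf (next_state P p (take t ks)) (ks ! t) * pmf (\<sigma> (take t h) (take (Suc t) ks)) (sel (h ! t)))"

definition induced_plan ::
  "('e \<Rightarrow> 'a) \<Rightarrow> ('s::finite \<Rightarrow> 's pmf) \<Rightarrow> 's pmf \<Rightarrow> ('e list \<Rightarrow> 's list \<Rightarrow> 'a pmf) \<Rightarrow> ('e, 'a, 's) plan" where
  "induced_plan sel P p \<sigma> h a k =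
     (\<Sum>ks\<in>hist (length h). path_weight sel P p \<sigma> ks h * pmf (next_state P p ks) k * pmf (\<sigma> h (ks @ [k])) a)"

lemma path_weight_Nil [simp]: "path_weight sel P p \<sigma> [] [] = 1"
  by (simp add: path_weight_def)

lemma path_weight_snoc:
  assumes "length ks = length h"
  shows "path_weight sel P p \<sigma> (ks @ [k]) (h @ [e]) =
    path_weight sel P p \<sigma> ks h * pmf (next_state P p ks) k * pmf (\<sigma> h (ks @ [k])) (sel e)"
proof -
  have "(\<Prod>t<length h. pmf (next_state P p (take t (ks @ [k]))) ((ks @ [k]) ! t) *
        pmf (\<sigma> (take t (h @ [e])) (take (Suc t) (ks @ [k]))) (sel ((h @ [e]) ! t)))
      = path_weight sel P p \<sigma> ks h"
    unfolding path_weight_def using assms by (intro prod.cong refl) (simp add: nth_append)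
  then show ?thesis
    using assms by (simp add: path_weight_def[of _ _ _ _ "ks @ [k]"] nth_append mult.assoc)
qed

lemma path_weight_nonneg: "0 \<le> path_weight sel P p \<sigma> ks h"
  unfolding path_weight_def by (intro prod_nonneg) simp

lemma stochastic_pmf: "stochastic (\<lambda>k. pmf ((P :: 's::finite \<Rightarrow> 's pmf) k))"
  by (simp add: stochastic_def)

lemma weights_induced_plan:
  fixes P :: "'s::finite \<Rightarrow> 's pmf"
  shows "weights sel (\<lambda>k. pmf (P k)) (pmf p) (induced_plan sel P p \<sigma>) h k =
    (\<Sum>ks\<in>hist (length h). path_weight sel P p \<sigma> ks h * pmf (next_state P p ks) k)"
proof (cases h rule: rev_cases)
  case Nil
  then show ?thesis by (simp add: next_state_def)
next
  case (snoc h' e)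
  let ?u = "\<lambda>ks k'. path_weight sel P p \<sigma> ks h' * pmf (next_state P p ks) k' * pmf (\<sigma> h' (ks @ [k'])) (sel e)"
  have "(\<Sum>ks\<in>hist (length h). path_weight sel P p \<sigma> ks h * pmf (next_state P p ks) k)
      = (\<Sum>ks\<in>hist (length h'). \<Sum>k'\<in>UNIV. ?u ks k' * pmf (P k') k)"
    by (simp add: snoc sum_hist_Suc path_weight_snoc hist_length next_state_def[of _ _ "_ @ _"])
  also have "\<dots> = (\<Sum>k'\<in>UNIV. (\<Sum>ks\<in>hist (length h'). ?u ks k') * pmf (P k') k)"
    by (subst sum.swap) (simp add: sum_distrib_right)
  finally show ?thesis by (simp add: snoc step_def induced_plan_def)
qed

lemma induced_plan_in_plans:
  fixes P :: "'s::finite \<Rightarrow> 's pmf" and sel :: "'e \<Rightarrow> 'a::finite"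
  shows "induced_plan sel P p \<sigma> \<in> plans sel (\<lambda>k. pmf (P k)) (pmf p)"
proof -
  have "(\<Sum>a\<in>UNIV. induced_plan sel P p \<sigma> h a k) =
      (\<Sum>ks\<in>hist (length h). path_weight sel P p \<sigma> ks h * pmf (next_state P p ks) k)" for h k
    unfolding induced_plan_def by (subst sum.swap) (simp add: sum_distrib_left[symmetric])
  moreover have "0 \<le> induced_plan sel P p \<sigma> h a k" for h a k
    unfolding induced_plan_def by (intro sum_nonneg mult_nonneg_nonneg path_weight_nonneg) auto
  ultimately show ?thesis
    unfolding plans_def mem_Collect_eq weights_induced_plan by blast
qed

text \<open>
  The strategy remembers the public history, but of its own states only the current one.
\<close>

lemma plan_is_induced:
  fixes P :: "'s::finite \<Rightarrow> 's pmf" and sel :: "'e \<Rightarrow> 'a::finite"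
  assumes c: "c \<in> plans sel (\<lambda>k. pmf (P k)) (pmf p)"
  obtains \<sigma> where "induced_plan sel P p \<sigma> = c"
proof -
  let ?x = "behaviour sel (\<lambda>k. pmf (P k)) (pmf p) c"
  have "\<forall>h. \<exists>\<pi>. \<forall>k a. pmf (\<pi> k) a = ?x h k a"
  proof
    fix h
    have "\<forall>k. \<exists>\<pi>. \<forall>a. pmf \<pi> a = ?x h k a"
      using pmf_exists behaviour(1,2)[OF c] by blast
    from choice[OF this] show "\<exists>\<pi>. \<forall>k a. pmf (\<pi> k) a = ?x h k a" .
  qed
  from choice[OF this] obtain \<pi> where \<pi>: "\<And>h k a. pmf (\<pi> h k) a = ?x h k a" by blast
  define \<sigma> where "\<sigma> h ks = \<pi> h (last ks)" for h and ks :: "'s list"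
  have "induced_plan sel P p \<sigma> h a k =
      weights sel (\<lambda>k. pmf (P k)) (pmf p) (induced_plan sel P p \<sigma>) h k * ?x h k a" for h a k
    unfolding weights_induced_plan by (simp add: induced_plan_def \<sigma>_def \<pi> sum_distrib_right)
  then have "induced_plan sel P p \<sigma> = realize ?x sel (\<lambda>k. pmf (P k)) (pmf p)"
    by (rule plan_eq_realize)
  then show ?thesis using that behaviour(3)[OF c] by simp
qed

lemma expectation_bind_finite:
  fixes h :: "'b \<Rightarrow> real"
  assumes "finite (set_pmf p)" "\<And>x. x \<in> set_pmf p \<Longrightarrow> finite (set_pmf (f x))"
  shows "measure_pmf.expectation (bind_pmf p f) h = measure_pmf.expectation p (\<lambda>x. measure_pmf.expectation (f x) h)"
proof -
  have "measure_pmf.expectation (bind_pmf p f) h = (\<Sum>x\<in>set_pmf p. pmf p x *\<^sub>R measure_pmf.expectation (f x) h)"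
    using assms by (intro pmf_expectation_bind) auto
  also have "\<dots> = measure_pmf.expectation p (\<lambda>x. measure_pmf.expectation (f x) h)"
    using assms(1) by (subst integral_measure_pmf[of "set_pmf p"]) auto
  finally show ?thesis .
qed

lemma expectation_finite_type:
  fixes h :: "'a::finite \<Rightarrow> real"
  shows "measure_pmf.expectation p h = (\<Sum>x\<in>UNIV. pmf p x * h x)"
  by (subst integral_measure_pmf[of UNIV]) auto

lemma finite_play:
  fixes M :: "'k::finite \<Rightarrow> 'k pmf" and N :: "'l::finite \<Rightarrow> 'l pmf"
    and \<sigma> :: "('i::finite, 'j::finite, 'k, 'i) strategy" and \<tau> :: "('i, 'j, 'l, 'j) strategy"
  shows "finite (set_pmf (play_pmf M N p q \<sigma> \<tau> t))"
  by (induction t) auto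

lemma expectation_play_Suc:
  fixes M :: "'k::finite \<Rightarrow> 'k pmf" and N :: "'l::finite \<Rightarrow> 'l pmf"
    and \<sigma> :: "('i::finite, 'j::finite, 'k, 'i) strategy" and \<tau> :: "('i, 'j, 'l, 'j) strategy"
    and H :: "('k, 'l, 'i, 'j) play \<Rightarrow> real"
  shows "measure_pmf.expectation (play_pmf M N p q \<sigma> \<tau> (Suc t)) H =
    measure_pmf.expectation (play_pmf M N p q \<sigma> \<tau> t) (\<lambda>w.
      \<Sum>k\<in>UNIV. \<Sum>l\<in>UNIV. \<Sum>i\<in>UNIV. \<Sum>j\<in>UNIV.
        pmf (next_state M p (states1 w)) k * pmf (next_state N q (states2 w)) l *
        pmf (\<sigma> (actions w) (states1 w @ [k])) i * pmf (\<tau> (actions w) (states2 w @ [l])) j *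
        H (w @ [(k, l, i, j)]))"
  unfolding play_pmf.simps
  by (subst expectation_bind_finite; (simp add: finite_play)?)
    (simp add: expectation_bind_finite expectation_finite_type sum_distrib_left mult.assoc)

lemma states_actions_snoc [simp]:
  "states1 (w @ [(k, l, i, j)]) = states1 w @ [k]"
  "states2 (w @ [(k, l, i, j)]) = states2 w @ [l]"
  "actions (w @ [(k, l, i, j)]) = actions w @ [(i, j)]"
  by (simp_all add: states1_def states2_def actions_def)

text \<open>
  The probability of a play is the product of the contributions of the two players.
\<close>

lemma expectation_play:
  fixes M :: "'k::finite \<Rightarrow> 'k pmf" and N :: "'l::finite \<Rightarrow> 'l pmf"
    and \<sigma> :: "('i::finite, 'j::finite, 'k, 'i) strategy" and \<tau> :: "('i, 'j, 'l, 'j) strategy"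
  shows "measure_pmf.expectation (play_pmf M N p q \<sigma> \<tau> t) (\<lambda>w. F (actions w) (states1 w) (states2 w)) =
    (\<Sum>h\<in>hist t. \<Sum>ks\<in>hist t. \<Sum>ls\<in>hist t.
      path_weight fst M p \<sigma> ks h * path_weight snd N q \<tau> ls h * F h ks ls)"
proof (induction t arbitrary: F)
  case 0
  show ?case by (simp add: states1_def states2_def actions_def)
next
  case (Suc t)
  let ?u = "\<lambda>h ks k i. pmf (next_state M p ks) k * pmf (\<sigma> h (ks @ [k])) i"
  let ?v = "\<lambda>h ls l j. pmf (next_state N q ls) l * pmf (\<tau> h (ls @ [l])) j"
  let ?X = "path_weight fst M p \<sigma>" and ?Y = "path_weight snd N q \<tau>"
  let ?F = "\<lambda>h ks ls. \<Sum>k\<in>UNIV. \<Sum>l\<in>UNIV. \<Sum>i\<in>UNIV. \<Sum>j\<in>UNIV.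
      ?u h ks k i * ?v h ls l j * F (h @ [(i, j)]) (ks @ [k]) (ls @ [l])"
  have "measure_pmf.expectation (play_pmf M N p q \<sigma> \<tau> (Suc t)) (\<lambda>w. F (actions w) (states1 w) (states2 w))
      = measure_pmf.expectation (play_pmf M N p q \<sigma> \<tau> t) (\<lambda>w. ?F (actions w) (states1 w) (states2 w))"
    unfolding expectation_play_Suc by (simp add: mult_ac)
  also have "\<dots> = (\<Sum>h\<in>hist t. \<Sum>ks\<in>hist t. \<Sum>ls\<in>hist t. ?X ks h * ?Y ls h * ?F h ks ls)"
    by (rule Suc.IH)
  also have "\<dots> = (\<Sum>h\<in>hist t. \<Sum>ks\<in>hist t. \<Sum>ls\<in>hist t. \<Sum>k\<in>UNIV. \<Sum>l\<in>UNIV. \<Sum>e\<in>UNIV.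
      ?X (ks @ [k]) (h @ [e]) * ?Y (ls @ [l]) (h @ [e]) * F (h @ [e]) (ks @ [k]) (ls @ [l]))"
  proof (intro sum.cong refl)
    fix h :: "('i \<times> 'j) list" and ks :: "'k list" and ls :: "'l list"
    assume "h \<in> hist t" "ks \<in> hist t" "ls \<in> hist t"
    then have len: "length ks = length h" "length ls = length h" by (simp_all add: hist_def)
    have "(\<Sum>e\<in>UNIV. ?X (ks @ [k]) (h @ [e]) * ?Y (ls @ [l]) (h @ [e]) * F (h @ [e]) (ks @ [k]) (ls @ [l]))
        = (\<Sum>i\<in>UNIV. \<Sum>j\<in>UNIV. ?X ks h * ?Y ls h * (?u h ks k i * ?v h ls l j * F (h @ [(i, j)]) (ks @ [k]) (ls @ [l])))"
      for k l
      unfolding UNIV_Times_UNIV[symmetric] sum.cartesian_product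
      by (intro sum.cong refl) (auto simp: path_weight_snoc len mult_ac)
    then show "?X ks h * ?Y ls h * ?F h ks ls = (\<Sum>k\<in>UNIV. \<Sum>l\<in>UNIV. \<Sum>e\<in>UNIV.
      ?X (ks @ [k]) (h @ [e]) * ?Y (ls @ [l]) (h @ [e]) * F (h @ [e]) (ks @ [k]) (ls @ [l]))"
      by (simp add: sum_distrib_left)
  qed
  also have "\<dots> = (\<Sum>h\<in>hist t. \<Sum>e\<in>UNIV. \<Sum>ks\<in>hist t. \<Sum>k\<in>UNIV. \<Sum>ls\<in>hist t. \<Sum>l\<in>UNIV.
      ?X (ks @ [k]) (h @ [e]) * ?Y (ls @ [l]) (h @ [e]) * F (h @ [e]) (ks @ [k]) (ls @ [l]))"
  proof (rule sum.cong[OF refl])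
    fix h :: "('i \<times> 'j) list"
    let ?G = "\<lambda>ks ls k l e. ?X (ks @ [k]) (h @ [e]) * ?Y (ls @ [l]) (h @ [e]) * F (h @ [e]) (ks @ [k]) (ls @ [l])"
    have "(\<Sum>ks\<in>hist t. \<Sum>ls\<in>hist t. \<Sum>k\<in>UNIV. \<Sum>l\<in>UNIV. \<Sum>e\<in>UNIV. ?G ks ls k l e)
        = (\<Sum>ks\<in>hist t. \<Sum>k\<in>UNIV. \<Sum>ls\<in>hist t. \<Sum>l\<in>UNIV. \<Sum>e\<in>UNIV. ?G ks ls k l e)"
      by (intro sum.cong refl sum.swap)
    also have "\<dots> = (\<Sum>ks\<in>hist t. \<Sum>k\<in>UNIV. \<Sum>ls\<in>hist t. \<Sum>e\<in>UNIV. \<Sum>l\<in>UNIV. ?G ks ls k l e)"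
      by (intro sum.cong refl sum.swap)
    also have "\<dots> = (\<Sum>ks\<in>hist t. \<Sum>k\<in>UNIV. \<Sum>e\<in>UNIV. \<Sum>ls\<in>hist t. \<Sum>l\<in>UNIV. ?G ks ls k l e)"
      by (intro sum.cong refl sum.swap)
    also have "\<dots> = (\<Sum>ks\<in>hist t. \<Sum>e\<in>UNIV. \<Sum>k\<in>UNIV. \<Sum>ls\<in>hist t. \<Sum>l\<in>UNIV. ?G ks ls k l e)"
      by (intro sum.cong refl sum.swap)
    also have "\<dots> = (\<Sum>e\<in>UNIV. \<Sum>ks\<in>hist t. \<Sum>k\<in>UNIV. \<Sum>ls\<in>hist t. \<Sum>l\<in>UNIV. ?G ks ls k l e)"
      by (rule sum.swap)
    finally show "(\<Sum>ks\<in>hist t. \<Sum>ls\<in>hist t. \<Sum>k\<in>UNIV. \<Sum>l\<in>UNIV. \<Sum>e\<in>UNIV. ?G ks ls k l e)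
        = (\<Sum>e\<in>UNIV. \<Sum>ks\<in>hist t. \<Sum>k\<in>UNIV. \<Sum>ls\<in>hist t. \<Sum>l\<in>UNIV. ?G ks ls k l e)" .
  qed
  finally show ?case by (simp only: sum_hist_Suc)
qed

locale markov_chain_game =
  fixes g :: "'k::finite \<Rightarrow> 'l::finite \<Rightarrow> 'i::finite \<Rightarrow> 'j::finite \<Rightarrow> real"
    and M :: "'k \<Rightarrow> 'k pmf" and N :: "'l \<Rightarrow> 'l pmf" and p :: "'k pmf" and q :: "'l pmf"
  assumes bound: "\<bar>g k l i j\<bar> \<le> 1"
begin

sublocale game "fst :: 'i \<times> 'j \<Rightarrow> 'i" "snd :: 'i \<times> 'j \<Rightarrow> 'j" "\<lambda>k. pmf (M k)" "\<lambda>l. pmf (N l)"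
  "\<lambda>k l e. g k l (fst e) (snd e)"
  by unfold_locales (use bound in \<open>auto simp: stochastic_pmf bij_def inj_def surj_def\<close>)

abbreviation "plan1 \<equiv> induced_plan fst M p"
abbreviation "plan2 \<equiv> induced_plan snd N q"

lemma nonneg_pmf: "nonneg (pmf \<pi>)"
  by (simp add: nonneg_def)

lemma expected_sum_eq_total:
  "measure_pmf.expectation (play_pmf M N p q \<sigma> \<tau> t) (\<lambda>w. \<Sum>(k, l, i, j)\<leftarrow>w. g k l i j)
   = total t (plan1 \<sigma>) (plan2 \<tau>)"
proof (induction t)
  case 0
  show ?case by (simp add: total_def)
next
  case (Suc t)
  let ?S = "\<lambda>w. \<Sum>(k, l, i, j)\<leftarrow>w. g k l i j"
  let ?n1 = "\<lambda>ks k. pmf (next_state M p ks) k" and ?n2 = "\<lambda>ls l. pmf (next_state N q ls) l"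
  let ?a1 = "\<lambda>h ks k i. pmf (\<sigma> h (ks @ [k])) i" and ?a2 = "\<lambda>h ls l j. pmf (\<tau> h (ls @ [l])) j"
  let ?F = "\<lambda>h ks ls. \<Sum>k\<in>UNIV. \<Sum>l\<in>UNIV. \<Sum>i\<in>UNIV. \<Sum>j\<in>UNIV.
      ?n1 ks k * ?n2 ls l * ?a1 h ks k i * ?a2 h ls l j * g k l i j"
  let ?E = "measure_pmf.expectation (play_pmf M N p q \<sigma> \<tau> t)"
  have int: "integrable (measure_pmf (play_pmf M N p q \<sigma> \<tau> t)) H" for H :: "('k, 'l, 'i, 'j) play \<Rightarrow> real"
    by (rule integrable_measure_pmf_finite[OF finite_play])
  have one: "(\<Sum>k\<in>UNIV. \<Sum>l\<in>UNIV. \<Sum>i\<in>UNIV. \<Sum>j\<in>UNIV. ?n1 ks k * ?n2 ls l * ?a1 h ks k i * ?a2 h ls l j) = 1"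
    for h ks ls
    by (simp add: sum_distrib_left[symmetric])
  have "(\<Sum>k\<in>UNIV. \<Sum>l\<in>UNIV. \<Sum>i\<in>UNIV. \<Sum>j\<in>UNIV.
      ?n1 ks k * ?n2 ls l * ?a1 h ks k i * ?a2 h ls l j * (s + g k l i j)) = s + ?F h ks ls" for h ks ls s
  proof -
    have "(\<Sum>k\<in>UNIV. \<Sum>l\<in>UNIV. \<Sum>i\<in>UNIV. \<Sum>j\<in>UNIV.
      ?n1 ks k * ?n2 ls l * ?a1 h ks k i * ?a2 h ls l j * (s + g k l i j))
      = (\<Sum>k\<in>UNIV. \<Sum>l\<in>UNIV. \<Sum>i\<in>UNIV. \<Sum>j\<in>UNIV. ?n1 ks k * ?n2 ls l * ?a1 h ks k i * ?a2 h ls l j) * s + ?F h ks ls"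
      by (simp only: distrib_left sum.distrib sum_distrib_right)
    then show ?thesis by (simp only: one mult_1)
  qed
  then have "measure_pmf.expectation (play_pmf M N p q \<sigma> \<tau> (Suc t)) ?S
      = ?E (\<lambda>w. ?S w + ?F (actions w) (states1 w) (states2 w))"
    unfolding expectation_play_Suc by simp
  also have "\<dots> = ?E ?S + ?E (\<lambda>w. ?F (actions w) (states1 w) (states2 w))"
    by (rule Bochner_Integration.integral_add[OF int int])
  also have "?E (\<lambda>w. ?F (actions w) (states1 w) (states2 w)) = (\<Sum>h\<in>hist t. \<Sum>ks\<in>hist t. \<Sum>ls\<in>hist t.
      path_weight fst M p \<sigma> ks h * path_weight snd N q \<tau> ls h * ?F h ks ls)"
    by (rule expectation_play[where F = ?F])
  also have "\<dots> = (\<Sum>h\<in>hist t. stage (plan1 \<sigma>) (plan2 \<tau>) h)"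
  proof (rule sum.cong[OF refl])
    fix h :: "('i \<times> 'j) list" assume "h \<in> hist t"
    then have len: "length h = t" by (rule hist_length)
    let ?X = "path_weight fst M p \<sigma>" and ?Y = "path_weight snd N q \<tau>"
    let ?u = "\<lambda>ks k i. ?X ks h * ?n1 ks k * ?a1 h ks k i" and ?v = "\<lambda>ls l j. ?Y ls h * ?n2 ls l * ?a2 h ls l j"
    have "(\<Sum>ks\<in>hist t. \<Sum>ls\<in>hist t. ?X ks h * ?Y ls h * ?F h ks ls)
        = (\<Sum>ks\<in>hist t. \<Sum>ls\<in>hist t. \<Sum>k\<in>UNIV. \<Sum>l\<in>UNIV. \<Sum>i\<in>UNIV. \<Sum>j\<in>UNIV. ?u ks k i * ?v ls l j * g k l i j)"
      by (simp add: sum_distrib_left mult_ac)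
    also have "\<dots> = (\<Sum>i\<in>UNIV. \<Sum>j\<in>UNIV. \<Sum>k\<in>UNIV. \<Sum>l\<in>UNIV. \<Sum>ks\<in>hist t. \<Sum>ls\<in>hist t. ?u ks k i * ?v ls l j * g k l i j)"
    proof -
      have "(\<Sum>ks\<in>hist t. \<Sum>ls\<in>hist t. \<Sum>k\<in>UNIV. \<Sum>l\<in>UNIV. \<Sum>i\<in>UNIV. \<Sum>j\<in>UNIV. ?u ks k i * ?v ls l j * g k l i j)
          = (\<Sum>(ks, ls)\<in>hist t \<times> hist t. \<Sum>(k, l)\<in>UNIV \<times> UNIV. \<Sum>(i, j)\<in>UNIV \<times> UNIV. ?u ks k i * ?v ls l j * g k l i j)"
        by (simp add: sum.cartesian_product[symmetric] del: UNIV_Times_UNIV)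
      also have "\<dots> = (\<Sum>(ks, ls)\<in>hist t \<times> hist t. \<Sum>(i, j)\<in>UNIV \<times> UNIV. \<Sum>(k, l)\<in>UNIV \<times> UNIV. ?u ks k i * ?v ls l j * g k l i j)"
        unfolding split_def by (intro sum.cong refl sum.swap)
      also have "\<dots> = (\<Sum>(i, j)\<in>UNIV \<times> UNIV. \<Sum>(ks, ls)\<in>hist t \<times> hist t. \<Sum>(k, l)\<in>UNIV \<times> UNIV. ?u ks k i * ?v ls l j * g k l i j)"
        unfolding split_def by (rule sum.swap)
      also have "\<dots> = (\<Sum>(i, j)\<in>UNIV \<times> UNIV. \<Sum>(k, l)\<in>UNIV \<times> UNIV. \<Sum>(ks, ls)\<in>hist t \<times> hist t. ?u ks k i * ?v ls l j * g k l i j)"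
        unfolding split_def by (intro sum.cong refl sum.swap)
      finally show ?thesis
        by (simp add: sum.cartesian_product[symmetric] del: UNIV_Times_UNIV)
    qed
    also have "\<dots> = (\<Sum>i\<in>UNIV. \<Sum>j\<in>UNIV. \<Sum>k\<in>UNIV. \<Sum>l\<in>UNIV. plan1 \<sigma> h i k * plan2 \<tau> h j l * g k l i j)"
      unfolding induced_plan_def len sum_product by (simp add: sum_distrib_right)
    also have "\<dots> = stage (plan1 \<sigma>) (plan2 \<tau>) h"
      unfolding stage_def
      by (subst sum_sel[symmetric, of "\<lambda>i j. \<Sum>k\<in>UNIV. \<Sum>l\<in>UNIV. plan1 \<sigma> h i k * plan2 \<tau> h j l * g k l i j"]) simp
    finally show "(\<Sum>ks\<in>hist t. \<Sum>ls\<in>hist t. ?X ks h * ?Y ls h * ?F h ks ls) = stage (plan1 \<sigma>) (plan2 \<tau>) h" .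
  qed
  finally show ?case using Suc by (simp add: total_def)
qed

lemma payoff_eq: "payoff g M N p q t \<sigma> \<tau> = total t (plan1 \<sigma>) (plan2 \<tau>) / real t"
  unfolding payoff_def by (simp add: expected_sum_eq_total)

end

lemma is_maxminI:
  assumes min: "\<And>x. \<exists>y. \<forall>y'. F x y \<le> F x y'" and x: "\<And>y. v \<le> F x y" and y: "\<And>x. F x y \<le> v"
  shows "is_maxmin F v"
proof -
  from choice[of "\<lambda>x y. \<forall>y'. F x y \<le> F x y'"] min
  obtain r where r: "\<And>x y'. F x (r x) \<le> F x y'" by blast
  have "is_min (range (F x')) (F x' (r x'))" for x' using r by (auto simp: is_min_def)
  moreover have "F x (r x) = v" using x[of "r x"] y[of x] r[of x y] by linarith
  then have "v \<in> range (\<lambda>x. F x (r x))" by blast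
  then have "is_max (range (\<lambda>x. F x (r x))) v"
    using r y order_trans unfolding is_max_def by blast
  ultimately show ?thesis unfolding is_maxmin_def by (intro exI[of _ "\<lambda>x. F x (r x)"]) blast
qed

lemma is_minmaxI:
  assumes max: "\<And>y. \<exists>x. \<forall>x'. F x' y \<le> F x y" and x: "\<And>y. v \<le> F x y" and y: "\<And>x. F x y \<le> v"
  shows "is_minmax F v"
proof -
  from choice[of "\<lambda>y x. \<forall>x'. F x' y \<le> F x y"] max
  obtain r where r: "\<And>y x'. F x' y \<le> F (r y) y" by blast
  have "is_max (range (\<lambda>x. F x y')) (F (r y') y')" for y' using r by (auto simp: is_max_def)
  moreover have "F (r y) y = v" using x[of y] y[of "r y"] r[of x y] by linarith
  then have "v \<in> range (\<lambda>y. F (r y) y)" by blast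
  then have "is_min (range (\<lambda>y. F (r y) y)) v"
    using r x order_trans unfolding is_min_def by blast
  ultimately show ?thesis unfolding is_minmax_def by (intro exI[of _ "\<lambda>y. F (r y) y"]) blast
qed

context markov_chain_game
begin

lemma game_value: "is_game_value g M N p q t (val t (pmf p) (pmf q) / real t)"
proof -
  let ?A = "A (pmf p)" and ?B = "B (pmf q)"
  obtain c where c: "c \<in> ?A" "\<And>d. d \<in> ?B \<Longrightarrow> val t (pmf p) (pmf q) \<le> total t c d"
    by (rule optimal1[where n = t, OF nonneg_pmf nonneg_pmf], rule that)
  obtain d where d: "d \<in> ?B" "\<And>c. c \<in> ?A \<Longrightarrow> total t c d \<le> val t (pmf p) (pmf q)"
    by (rule optimal2[where n = t, OF nonneg_pmf nonneg_pmf], rule that)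
  obtain \<sigma> where \<sigma>: "plan1 \<sigma> = c" using plan_is_induced[OF c(1)] by blast
  obtain \<tau> where \<tau>: "plan2 \<tau> = d" using plan_is_induced[OF d(1)] by blast
  have opt1: "val t (pmf p) (pmf q) / real t \<le> payoff g M N p q t \<sigma> \<tau>'" for \<tau>'
    unfolding payoff_eq \<sigma> by (intro divide_right_mono c(2) induced_plan_in_plans) simp
  have opt2: "payoff g M N p q t \<sigma>' \<tau> \<le> val t (pmf p) (pmf q) / real t" for \<sigma>'
    unfolding payoff_eq \<tau> by (intro divide_right_mono d(2) induced_plan_in_plans) simp
  have reply2: "\<exists>\<tau>0. \<forall>\<tau>'. payoff g M N p q t \<sigma>' \<tau>0 \<le> payoff g M N p q t \<sigma>' \<tau>'" for \<sigma>'
  proof -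
    obtain d0 where d0: "d0 \<in> ?B" "\<forall>d'\<in>?B. total t (plan1 \<sigma>') d0 \<le> total t (plan1 \<sigma>') d'"
      using continuous_attains_inf[OF compact_plans[OF N nonneg_pmf] plans_nonempty[OF N nonneg_pmf] continuous_on_total_right]
      by blast
    obtain \<tau>0 where "plan2 \<tau>0 = d0" using plan_is_induced[OF d0(1)] by blast
    then have "total t (plan1 \<sigma>') (plan2 \<tau>0) \<le> total t (plan1 \<sigma>') (plan2 \<tau>')" for \<tau>'
      using d0(2) induced_plan_in_plans[of snd N q \<tau>'] by blast
    then show ?thesis unfolding payoff_eq by (intro exI[of _ \<tau>0] allI divide_right_mono) auto
  qed
  have reply1: "\<exists>\<sigma>0. \<forall>\<sigma>'. payoff g M N p q t \<sigma>' \<tau>' \<le> payoff g M N p q t \<sigma>0 \<tau>'" for \<tau>'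
  proof -
    obtain c0 where c0: "c0 \<in> ?A" "\<forall>c'\<in>?A. total t c' (plan2 \<tau>') \<le> total t c0 (plan2 \<tau>')"
      using continuous_attains_sup[OF compact_plans[OF M nonneg_pmf] plans_nonempty[OF M nonneg_pmf] continuous_on_total_left]
      by blast
    obtain \<sigma>0 where "plan1 \<sigma>0 = c0" using plan_is_induced[OF c0(1)] by blast
    then have "total t (plan1 \<sigma>') (plan2 \<tau>') \<le> total t (plan1 \<sigma>0) (plan2 \<tau>')" for \<sigma>'
      using c0(2) induced_plan_in_plans[of fst M p \<sigma>'] by blast
    then show ?thesis unfolding payoff_eq by (intro exI[of _ \<sigma>0] allI divide_right_mono) auto
  qed
  show ?thesis
    unfolding is_game_value_def
  proof
    show "is_maxmin (payoff g M N p q t) (val t (pmf p) (pmf q) / real t)"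
      by (rule is_maxminI[where x = \<sigma> and y = \<tau>]) (rule reply2 opt1 opt2)+
    show "is_minmax (payoff g M N p q t) (val t (pmf p) (pmf q) / real t)"
      by (rule is_minmaxI[where x = \<sigma> and y = \<tau>]) (rule reply1 opt1 opt2)+
  qed
qed

end

theorem theorem2p2:
  fixes g :: "'k::finite \<Rightarrow> 'l::finite \<Rightarrow> 'i::finite \<Rightarrow> 'j::finite \<Rightarrow> real"
    and M :: "'k \<Rightarrow> 'k pmf" and N :: "'l \<Rightarrow> 'l pmf"
    and p :: "'k pmf" and q :: "'l pmf"
  assumes "\<And>k l i j. g k l i j \<in> {-1..1}"
  shows "\<exists>(v\<^sub>T :: nat \<Rightarrow> real) v.
           (\<forall>T\<ge>1. is_game_value g M N p q T (v\<^sub>T T)) \<and> v\<^sub>T \<longlonglongrightarrow> v"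
proof -
  interpret markov_chain_game g M N p q
    using assms by unfold_locales (simp add: abs_le_iff minus_le_iff)
  obtain D \<alpha> where mix: "mixing (\<lambda>k. pmf (M k)) D \<alpha>" "mixing (\<lambda>l. pmf (N l)) D \<alpha>"
    using mixing_exists[OF stochastic_pmf stochastic_pmf] by blast
  interpret mixing_game fst snd "\<lambda>k. pmf (M k)" "\<lambda>l. pmf (N l)" "\<lambda>k l (e :: 'i \<times> 'j). g k l (fst e) (snd e)" D \<alpha>
    using mix by (intro mixing_game.intro game_axioms)
  have "convergent (\<lambda>T. val T (pmf p) (pmf q) / real T)"
    by (rule val_average_convergent) (simp_all add: nonneg_pmf)
  then obtain v where "(\<lambda>T. val T (pmf p) (pmf q) / real T) \<longlonglongrightarrow> v"
    by (auto simp: convergent_def)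
  moreover have "\<forall>T\<ge>1. is_game_value g M N p q T (val T (pmf p) (pmf q) / real T)"
    using game_value by blast
  ultimately show ?thesis
    by (intro exI[of _ "\<lambda>T. val T (pmf p) (pmf q) / real T"] exI[of _ v] conjI)
qed

end
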